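(* Let $T\in B(\mathcal{H})$ be a multiplicity-free operator of class $C_0$ whose minimal function is a Blaschke product $\theta$ (finite or infinite). Assume that $\|\psi(T)\|=1$ for some big inner divisor $\psi$ of $\theta$. Then $T$ is unitarily equivalent to $S(\theta)$.
   Context: $H^\infty$ is the algebra of bounded holomorphic functions on the open unit disc $\mathbb{D}$, and $H^2$ is the Hardy space of holomorphic functions $f(z)=\sum_{n\ge0}a_nz^n$ on $\mathbb{D}$ with $\|f\|^2=\sum|a_n|^2<\infty$. For a completely non-unitary contraction $T\in B(\mathcal{H})$, the Sz.-Nagy--Foias functional calculus is the contractive, weak-star continuous algebra homomorphism $\Phi:H^\infty\to B(\mathcal{H})$, $u\mapsto u(T)$, extending $p\mapsto p(T)$ for polynomials $p$. $T$ is of class $C_0$ if it is a completely non-unitary contraction and $\Phi$ has non-trivial kernel; then $\ker\Phi=\theta H^\infty$ for an inner function $\theta$, the minimal function of $T$, unique up to a unimodular constant. $T$ is multiplicity-free if it has a cyclic vector, i.e. a vector $x$ such that the closed linear span of $\{T^nx:n\ge0\}$ is $\mathcal{H}$. For an inner function $\theta$, $H(\theta)=H^2\ominus\theta H^2$ and the Jordan block $S(\theta)\in B(H(\theta))$ is defined by $S(\theta)^*=S^*|H(\theta)$, where $S$ is the unilateral shift (multiplication by $z$) on $H^2$. A function $u\in H^\infty$ divides $v\in H^\infty$ if $v=uf$ for some $f\in H^\infty$. The Blaschke factor with root $\lambda\in\mathbb{D}$ is $b_\lambda(z)=\frac{z-\lambda}{1-\overline{\lambda}z}$. An inner divisor $\psi$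 of a Blaschke product $\theta$ is called big if $\theta/\psi$ is a Blaschke factor (inner functions being identified when they differ by a unimodular constant). *)

theory Defs
  imports "HOL-Complex_Analysis.Complex_Analysis"
begin

section \<open>Complex Hilbert spaces and operators\<close>

text \<open>The inner product is linear in its first argument.\<close>

class complex_hilbert = banach +
  fixes scaleC :: "complex \<Rightarrow> 'a \<Rightarrow> 'a" (infixr \<open>*\<^sub>C\<close> 75)
    and cinner :: "'a \<Rightarrow> 'a \<Rightarrow> complex"
  assumes scaleC_add_right: "c *\<^sub>C (x + y) = c *\<^sub>C x + c *\<^sub>C y"
    and scaleC_add_left: "(c + d) *\<^sub>C x = c *\<^sub>C x + d *\<^sub>C x"
    and scaleC_scaleC: "c *\<^sub>C d *\<^sub>C x = (c * d) *\<^sub>C x"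
    and scaleC_of_real: "complex_of_real r *\<^sub>C x = r *\<^sub>R x"
    and cinner_commute: "cinner x y = cnj (cinner y x)"
    and cinner_add_left: "cinner (x + y) z = cinner x z + cinner y z"
    and cinner_scaleC_left: "cinner (c *\<^sub>C x) y = c * cinner x y"
    and cinner_self: "cinner x x = complex_of_real ((norm x)\<^sup>2)"

global_interpretation complex_vs:
  vector_space "scaleC :: complex \<Rightarrow> 'a \<Rightarrow> 'a::complex_hilbert"
proof
  fix x :: 'a
  show "1 *\<^sub>C x = x"
    using scaleC_of_real[of 1 x] by simp
qed (simp_all add: scaleC_add_right scaleC_add_left scaleC_scaleC)

definition bounded_clinear :: "('a::complex_hilbert \<Rightarrow> 'a) \<Rightarrow> bool" where
  "bounded_clinear A \<longleftrightarrow> bounded_linear A \<and> (\<forall>c x. A (c *\<^sub>C x) = c *\<^sub>C A x)"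

definition orth_compl :: "'a::complex_hilbert set \<Rightarrow> 'a set" where
  "orth_compl M = {x. \<forall>y\<in>M. cinner x y = 0}"

definition reducing_subspace :: "('a::complex_hilbert \<Rightarrow> 'a) \<Rightarrow> 'a set \<Rightarrow> bool" where
  "reducing_subspace T M \<longleftrightarrow> complex_vs.subspace M \<and> closed M \<and>
     T ` M \<subseteq> M \<and> T ` orth_compl M \<subseteq> orth_compl M"

definition unitary_on :: "('a::complex_hilbert \<Rightarrow> 'a) \<Rightarrow> 'a set \<Rightarrow> bool" where
  "unitary_on T M \<longleftrightarrow> T ` M = M \<and> (\<forall>x\<in>M. \<forall>y\<in>M. cinner (T x) (T y) = cinner x y)"

definition cnu_contraction :: "('a::complex_hilbert \<Rightarrow> 'a) \<Rightarrow> bool" where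
  "cnu_contraction T \<longleftrightarrow> bounded_clinear T \<and> onorm T \<le> 1 \<and>
     (\<forall>M. reducing_subspace T M \<and> unitary_on T M \<longrightarrow> M = {0})"

definition multiplicity_free :: "('a::complex_hilbert \<Rightarrow> 'a) \<Rightarrow> bool" where
  "multiplicity_free T \<longleftrightarrow>
     (\<exists>x. closure (complex_vs.span (range (\<lambda>n. (T ^^ n) x))) = UNIV)"

definition poly_operator :: "complex poly \<Rightarrow> ('a::complex_hilbert \<Rightarrow> 'a) \<Rightarrow> 'a \<Rightarrow> 'a" where
  "poly_operator p T x = (\<Sum>i\<le>degree p. coeff p i *\<^sub>C (T ^^ i) x)"

section \<open>Bounded holomorphic functions on the disc\<close>

text \<open>Elements of \<open>Hinf\<close> are functions on all of \<open>\<complex>\<close> whose values outside the disc are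
  irrelevant; they are only ever compared on the disc.\<close>

abbreviation disc :: "complex set" where
  "disc \<equiv> ball 0 1"

definition Hinf :: "(complex \<Rightarrow> complex) set" where
  "Hinf = {u. u holomorphic_on disc \<and> bounded (u ` disc)}"

definition Hinf_norm :: "(complex \<Rightarrow> complex) \<Rightarrow> real" where
  "Hinf_norm u = (SUP z\<in>disc. norm (u z))"

definition Hinf_divides :: "(complex \<Rightarrow> complex) \<Rightarrow> (complex \<Rightarrow> complex) \<Rightarrow> bool" where
  "Hinf_divides u v \<longleftrightarrow> (\<exists>f\<in>Hinf. \<forall>z\<in>disc. v z = u z * f z)"

definition inner_function :: "(complex \<Rightarrow> complex) \<Rightarrow> bool" where
  "inner_function u \<longleftrightarrow> u \<in> Hinf \<and>
     (AE t in lborel. t \<in> {0..2 * pi} \<longrightarrow>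
        (\<exists>w. ((\<lambda>r. u (complex_of_real r * cis t)) \<longlongrightarrow> w) (at_left 1) \<and> norm w = 1))"

definition blaschke_factor :: "complex \<Rightarrow> complex \<Rightarrow> complex" where
  "blaschke_factor a z = (z - a) / (1 - cnj a * z)"

text \<open>The unimodular constants making the factors positive at the origin, without which
  an infinite product need not converge.\<close>

definition blaschke_sign :: "complex \<Rightarrow> complex" where
  "blaschke_sign a = (if a = 0 then 1 else - (complex_of_real (norm a) / a))"

text \<open>Finite and infinite products are treated together through the index set \<open>I\<close>;
  the roots \<open>a n\<close> may repeat.\<close>

definition blaschke_product :: "(complex \<Rightarrow> complex) \<Rightarrow> bool" where
  "blaschke_product \<theta> \<longleftrightarrow>
     (\<exists>(I::nat set) a c. (\<forall>n\<in>I. a n \<in> disc) \<and> (\<lambda>n. 1 - norm (a n)) summable_on I \<and> norm c = 1 \<and>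
        (\<forall>z\<in>disc. (\<lambda>N. c * (\<Prod>n\<in>I \<inter> {..<N}. blaschke_sign (a n) * blaschke_factor (a n) z))
                    \<longlonglongrightarrow> \<theta> z))"

definition big_inner_divisor :: "(complex \<Rightarrow> complex) \<Rightarrow> (complex \<Rightarrow> complex) \<Rightarrow> bool" where
  "big_inner_divisor \<psi> \<theta> \<longleftrightarrow> inner_function \<psi> \<and> Hinf_divides \<psi> \<theta> \<and>
     (\<exists>a\<in>disc. \<exists>c. norm c = 1 \<and> (\<forall>z\<in>disc. \<theta> z = \<psi> z * (c * blaschke_factor a z)))"

section \<open>The Sz.-Nagy--Foias functional calculus\<close>

definition initial_topology :: "'a set \<Rightarrow> ('a \<Rightarrow> complex) set \<Rightarrow> 'a topology" where
  "initial_topology X F = topology_generated_by {{x\<in>X. f x \<in> V} | f V. f \<in> F \<and> open V}"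

text \<open>\<open>H\<^sup>\<infinity>\<close> carries the weak-star topology of \<open>L\<^sup>\<infinity> = (L\<^sup>1)\<^sup>*\<close> on the circle, via
  radial boundary values, which exist almost everywhere by Fatou's theorem.\<close>

definition boundary_value :: "(complex \<Rightarrow> complex) \<Rightarrow> real \<Rightarrow> complex" where
  "boundary_value u t = Lim (at_left 1) (\<lambda>r. u (complex_of_real r * cis t))"

definition weak_star_Hinf :: "(complex \<Rightarrow> complex) topology" where
  "weak_star_Hinf = initial_topology Hinf
     {\<lambda>u. LINT t:{0..2 * pi}|lborel. boundary_value u t * g t | g :: real \<Rightarrow> complex.
        set_integrable lborel {0..2 * pi} g}"

text \<open>The weak-star topology of \<open>B(H)\<close> as the dual of the trace class: its continuous
  functionals are \<open>A \<mapsto> \<Sum>n. \<langle>A x\<^sub>n, y\<^sub>n\<rangle>\<close> with square-summable \<open>x\<close> and \<open>y\<close>.\<close>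

definition weak_star_operators :: "('a::complex_hilbert \<Rightarrow> 'a) topology" where
  "weak_star_operators = initial_topology {A. bounded_clinear A}
     {\<lambda>A. \<Sum>n. cinner (A (x n)) (y n) | x y :: nat \<Rightarrow> 'a.
        summable (\<lambda>n. (norm (x n))\<^sup>2) \<and> summable (\<lambda>n. (norm (y n))\<^sup>2)}"

definition is_functional_calculus ::
  "('a::complex_hilbert \<Rightarrow> 'a) \<Rightarrow> ((complex \<Rightarrow> complex) \<Rightarrow> 'a \<Rightarrow> 'a) \<Rightarrow> bool" where
  "is_functional_calculus T \<Phi> \<longleftrightarrow>
     (\<forall>u\<in>Hinf. bounded_clinear (\<Phi> u)) \<and>
     (\<forall>u\<in>Hinf. \<forall>v\<in>Hinf. \<Phi> (\<lambda>z. u z + v z) = (\<lambda>x. \<Phi> u x + \<Phi> v x)) \<and>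
     (\<forall>c. \<forall>u\<in>Hinf. \<Phi> (\<lambda>z. c * u z) = (\<lambda>x. c *\<^sub>C \<Phi> u x)) \<and>
     (\<forall>u\<in>Hinf. \<forall>v\<in>Hinf. \<Phi> (\<lambda>z. u z * v z) = \<Phi> u \<circ> \<Phi> v) \<and>
     (\<forall>p. \<Phi> (poly p) = poly_operator p T) \<and>
     (\<forall>u\<in>Hinf. onorm (\<Phi> u) \<le> Hinf_norm u) \<and>
     continuous_map weak_star_Hinf weak_star_operators \<Phi>"

text \<open>\<open>Hinf_calculus T u\<close> is \<open>u(T)\<close>. The functional calculus is unique on \<open>Hinf\<close>, but its values
  elsewhere are arbitrary, hence \<open>SOME\<close> rather than \<open>THE\<close>.\<close>

definition Hinf_calculus ::
  "('a::complex_hilbert \<Rightarrow> 'a) \<Rightarrow> (complex \<Rightarrow> complex) \<Rightarrow> 'a \<Rightarrow> 'a" where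
  "Hinf_calculus T = (SOME \<Phi>. is_functional_calculus T \<Phi>)"

definition class_C0 :: "('a::complex_hilbert \<Rightarrow> 'a) \<Rightarrow> bool" where
  "class_C0 T \<longleftrightarrow> cnu_contraction T \<and>
     (\<exists>\<Phi>. is_functional_calculus T \<Phi> \<and>
        (\<exists>u\<in>Hinf. (\<exists>z\<in>disc. u z \<noteq> 0) \<and> \<Phi> u = (\<lambda>x. 0)))"

definition minimal_function ::
  "('a::complex_hilbert \<Rightarrow> 'a) \<Rightarrow> (complex \<Rightarrow> complex) \<Rightarrow> bool" where
  "minimal_function T \<theta> \<longleftrightarrow> inner_function \<theta> \<and>
     {u\<in>Hinf. Hinf_calculus T u = (\<lambda>x. 0)} = {u\<in>Hinf. Hinf_divides \<theta> u}"

section \<open>Hardy space and Jordan blocks\<close>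

definition taylor_coeff :: "(complex \<Rightarrow> complex) \<Rightarrow> nat \<Rightarrow> complex" where
  "taylor_coeff f n = (deriv ^^ n) f 0 / fact n"

text \<open>Elements of \<open>H2\<close> vanish outside the disc, so that equality of functions is equality
  in the Hardy space.\<close>

definition H2 :: "(complex \<Rightarrow> complex) set" where
  "H2 = {f. f holomorphic_on disc \<and> (\<forall>z. z \<notin> disc \<longrightarrow> f z = 0) \<and>
            summable (\<lambda>n. (norm (taylor_coeff f n))\<^sup>2)}"

definition H2_inner :: "(complex \<Rightarrow> complex) \<Rightarrow> (complex \<Rightarrow> complex) \<Rightarrow> complex" where
  "H2_inner f g = (\<Sum>n. taylor_coeff f n * cnj (taylor_coeff g n))"

definition shift :: "(complex \<Rightarrow> complex) \<Rightarrow> complex \<Rightarrow> complex" where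
  "shift f = (\<lambda>z. z * f z)"

definition shift_adjoint :: "(complex \<Rightarrow> complex) \<Rightarrow> complex \<Rightarrow> complex" where
  "shift_adjoint f = (THE g. g \<in> H2 \<and> (\<forall>h\<in>H2. H2_inner (shift h) f = H2_inner h g))"

definition model_space :: "(complex \<Rightarrow> complex) \<Rightarrow> (complex \<Rightarrow> complex) set" where
  "model_space \<theta> = {f\<in>H2. \<forall>g\<in>H2. H2_inner f (\<lambda>z. \<theta> z * g z) = 0}"

text \<open>The operator on \<open>model_space \<theta>\<close> whose adjoint is the restriction of \<open>shift_adjoint\<close>.\<close>

definition jordan_block ::
  "(complex \<Rightarrow> complex) \<Rightarrow> (complex \<Rightarrow> complex) \<Rightarrow> complex \<Rightarrow> complex" where
  "jordan_block \<theta> f = (THE g. g \<in> model_space \<theta> \<and>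
     (\<forall>h\<in>model_space \<theta>. H2_inner g h = H2_inner f (shift_adjoint h)))"

definition unitarily_equivalent_jordan_block ::
  "('a::complex_hilbert \<Rightarrow> 'a) \<Rightarrow> (complex \<Rightarrow> complex) \<Rightarrow> bool" where
  "unitarily_equivalent_jordan_block T \<theta> \<longleftrightarrow>
     (\<exists>U. (\<forall>x y. U (x + y) = (\<lambda>z. U x z + U y z)) \<and>
          (\<forall>c x. U (c *\<^sub>C x) = (\<lambda>z. c * U x z)) \<and>
          bij_betw U UNIV (model_space \<theta>) \<and>
          (\<forall>x y. H2_inner (U x) (U y) = cinner x y) \<and>
          (\<forall>x. U (T x) = jordan_block \<theta> (U x)))"

end

theory Submission
  imports Defs
begin

text \<open>
  Let \<open>\<mu>\<close> be the root with \<open>\<theta> = c b\<^sub>\<mu> \<psi>\<close>. Since \<open>(T - \<mu>) \<psi>(T) = 0\<close> and \<open>T\<close> is cyclic, \<open>\<psi>(T)\<close> has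
  rank one and attains its norm at a unit vector \<open>x\<close> with \<open>T\<^sup>* x = \<open>cnj \<mu>\<close> x\<close>. Every partial
  product \<open>F\<close> of \<open>\<psi>\<close> then satisfies \<open>\<parallel>F(T) x\<parallel> = 1\<close>, and a Schwarz-Pick argument shows that
  \<open>1 - b\<^sub>\<mu>(T) b\<^sub>\<mu>(T)\<^sup>* = x \<otimes> x\<close> on each \<open>F(T) x\<close>. By cyclicity these vectors span the kernels of
  \<open>(b\<^sub>\<mu> F)(T)\<^sup>*\<close>, and the kernels are dense because the tails of \<open>\<theta>\<close> tend weak-star to 1.
  Hence \<open>1 - T T\<^sup>* = \<delta> \<otimes> \<delta>\<close> for some vector \<open>\<delta>\<close> and \<open>T\<^sup>*\<^sup>n \<longrightarrow> 0\<close> strongly, so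
  \<open>h \<mapsto> \<Sum>n. \<langle>T\<^sup>*\<^sup>n h, \<delta>\<rangle> z\<^sup>n\<close> is an isometry into \<open>H\<^sup>2\<close> that intertwines \<open>T\<^sup>*\<close> with the backward
  shift. Comparing zeros with those of \<open>\<theta>\<close> identifies its range as the model space.
\<close>

section \<open>Hilbert space preliminaries\<close>

text \<open>The tails of an infinite product tend to 1 locally uniformly on the disc, but in general
  not in the sup norm, so contractivity of the calculus alone does not bring
  \<open>\<tau> j(T)\<close> close to the identity. This is the reason for the detour through
  boundary values: it yields weak-star convergence, the one place where the continuity of the
  calculus enters. Roots may repeat, so eigenvectors of the adjoint need not span the kernels. These
  are built up one factor at a time instead: the adjoint of the previous partial product carries
  each new direction to an eigenvector, and eigenspaces are lines because \<open>T\<close> is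
  cyclic. The same eigenvectors return at the end. A function orthogonal to the range of the
  isometry is divisible by every partial product of \<open>\<theta>\<close>, root by root with
  multiplicity, and a weak limit disposes of the tail; no description of the invariant subspaces of
  the shift is invoked. On \<open>H2\<close> multiplication by Blaschke factors is handled through
  Taylor coefficients and the shift alone, so boundary values are confined to the functional
  calculus.\<close>

lemma cinner_scaleC_right: "cinner x (c *\<^sub>C y) = cnj c * cinner x y"
  by (metis cinner_commute cinner_scaleC_left complex_cnj_mult)

lemma cinner_add_right: "cinner x (y + z) = cinner x y + cinner x z"
  by (metis cinner_add_left cinner_commute complex_cnj_add)

lemma cinner_scaleR_left: "cinner (r *\<^sub>R x) y = r *\<^sub>R cinner x y"
  by (metis cinner_scaleC_left scaleC_of_real scaleR_conv_of_real)

lemma cinner_scaleR_right: "cinner x (r *\<^sub>R y) = r *\<^sub>R cinner x y"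
  by (metis cinner_scaleC_right complex_cnj_complex_of_real scaleC_of_real scaleR_conv_of_real)

lemma Re_cinner_self: "Re (cinner x x) = (norm x)\<^sup>2"
  by (simp add: cinner_self)

lemma norm_scaleC: "norm (c *\<^sub>C x) = cmod c * norm (x::'a::complex_hilbert)"
proof -
  have "(norm (c *\<^sub>C x))\<^sup>2 = Re ((c * cnj c) * cinner x x)"
    unfolding Re_cinner_self[symmetric] by (simp only: cinner_scaleC_left cinner_scaleC_right mult_ac)
  also have "\<dots> = (cmod c * norm x)\<^sup>2"
    by (simp only: complex_norm_square[symmetric] cinner_self of_real_mult[symmetric] Re_complex_of_real
        power_mult_distrib)
  finally show ?thesis
    by (simp add: power2_eq_iff_nonneg)
qed

lemma cinner_zero_left [simp]: "cinner 0 y = 0"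
  using cinner_scaleR_left[of 0] by simp

lemma cinner_zero_right [simp]: "cinner y 0 = 0"
  using cinner_scaleR_right[of _ 0] by simp

lemma Re_cinner_commute: "Re (cinner y x) = Re (cinner x y)"
  by (metis cinner_commute complex_cnj cnj.sel(1))

lemma norm_add_square:
  "(norm (x + y))\<^sup>2 = (norm x)\<^sup>2 + (norm y)\<^sup>2 + 2 * Re (cinner x (y::'a::complex_hilbert))"
proof -
  have "(norm (x + y))\<^sup>2 = Re (cinner x x) + Re (cinner x y) + (Re (cinner y x) + Re (cinner y y))"
    by (simp only: Re_cinner_self[symmetric] cinner_add_left cinner_add_right plus_complex.sel add_ac)
  thus ?thesis by (simp only: Re_cinner_self Re_cinner_commute[of y x])
qed

lemma norm_cinner_le: "norm (cinner x y) \<le> norm x * norm (y::'a::complex_hilbert)"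
proof (cases "y = 0")
  case False
  \<comment> \<open>With this \<open>c\<close> the vector \<open>x + c *\<^sub>C y\<close> is
    orthogonal to \<open>y\<close>, so its norm is as small as possible.\<close>
  define c where "c = - cinner x y / complex_of_real ((norm y)\<^sup>2)"
  have c1: "cnj c * cinner x y = - complex_of_real ((cmod (cinner x y))\<^sup>2 / (norm y)\<^sup>2)"
    by (simp add: c_def complex_norm_square[symmetric] mult.commute)
  have "0 \<le> (norm (x + c *\<^sub>C y))\<^sup>2" by simp
  also have "\<dots> = (norm x)\<^sup>2 + (cmod c)\<^sup>2 * (norm y)\<^sup>2 + 2 * Re (cnj c * cinner x y)"
    by (simp add: norm_add_square norm_scaleC power_mult_distrib cinner_scaleC_right)
  also have "\<dots> = (norm x)\<^sup>2 - (cmod (cinner x y))\<^sup>2 / (norm y)\<^sup>2"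
    using False unfolding c1
    by (simp add: c_def norm_divide norm_power norm_mult field_simps power2_eq_square)
  finally have "(cmod (cinner x y))\<^sup>2 \<le> (norm x * norm y)\<^sup>2"
    using False by (simp add: field_simps power_mult_distrib)
  thus ?thesis by (rule power2_le_imp_le) simp
qed simp

global_interpretation cinner: bounded_bilinear "cinner :: 'a::complex_hilbert \<Rightarrow> 'a \<Rightarrow> complex"
  by unfold_locales
    (auto simp: cinner_add_left cinner_add_right cinner_scaleR_left cinner_scaleR_right
      intro!: exI[of _ 1] norm_cinner_le)

lemma cinner_self_eq_0: "cinner x x = 0 \<longleftrightarrow> x = 0"
  by (simp add: cinner_self)

lemma cinner_ext:
  assumes "\<And>z. cinner z x = cinner z y"
  shows "x = y"
  using assms[of "x - y"] cinner_self_eq_0[of "x - y"] by (simp add: cinner.diff_right)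

lemma parallelogram:
  "(norm (x + y))\<^sup>2 + (norm (x - y))\<^sup>2 = 2 * (norm x)\<^sup>2 + 2 * (norm (y::'a::complex_hilbert))\<^sup>2"
  using norm_add_square[of x y] norm_add_square[of x "- y"] by (simp add: cinner.minus_right)

lemma scaleC_half: "(1/2) *\<^sub>C x = (1/2::real) *\<^sub>R (x::'a::complex_hilbert)"
  using scaleC_of_real[of "1/2" x] by simp

text \<open>The vector is \<open>v - y\<close>, where \<open>y\<close> is the point of
  \<open>M\<close> nearest to some \<open>v\<close> outside \<open>M\<close>. A minimising sequence
  is Cauchy by the parallelogram law, because midpoints stay in \<open>M\<close> and so are no
  closer to \<open>v\<close> than \<open>d\<close>.\<close>

lemma exists_orthogonal:
  fixes M :: "'a::complex_hilbert set"
  assumes cl: "closed M" and sub: "complex_vs.subspace M" and ne: "M \<noteq> UNIV"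
  shows "\<exists>g. g \<noteq> 0 \<and> (\<forall>y\<in>M. cinner g y = 0)"
proof -
  obtain v where v: "v \<notin> M" using ne by auto
  have ne0: "M \<noteq> {}" using complex_vs.subspace_0[OF sub] by auto
  define d where "d = (INF y\<in>M. norm (v - y))"
  have bdd: "bdd_below ((\<lambda>y. norm (v - y)) ` M)" by (auto intro: bdd_belowI[of _ 0])
  have d_le: "d \<le> norm (v - y)" if "y \<in> M" for y
    unfolding d_def using bdd that by (rule cINF_lower)
  have d0: "d \<ge> 0" unfolding d_def using ne0 by (intro cINF_greatest) auto
  have "\<exists>y\<in>M. norm (v - y) < d + 1 / real (Suc n)" for n
    using cINF_less_iff[OF ne0 bdd, of "d + 1 / real (Suc n)"] by (auto simp: d_def[symmetric])
  then obtain Y where Y: "\<And>n. Y n \<in> M" "\<And>n. norm (v - Y n) < d + 1 / real (Suc n)"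
    by metis
  have lim: "(\<lambda>n. norm (v - Y n)) \<longlonglongrightarrow> d"
  proof (rule tendsto_sandwich[of "\<lambda>_. d" _ _ "\<lambda>n. d + 1 / real (Suc n)"])
    show "(\<lambda>n. d + 1 / real (Suc n)) \<longlonglongrightarrow> d"
      using tendsto_add[OF tendsto_const[of d] LIMSEQ_Suc[OF lim_1_over_n]] by simp
  qed (simp_all add: always_eventually d_le Y(1) less_imp_le[OF Y(2)] del: of_nat_Suc)
  have key: "(norm (Y m - Y n))\<^sup>2 \<le> 2 * (norm (v - Y m))\<^sup>2 + 2 * (norm (v - Y n))\<^sup>2 - 4 * d\<^sup>2" for m n
  proof -
    have mid: "(1/2::real) *\<^sub>R (Y m + Y n) \<in> M"
      using complex_vs.subspace_scale[OF sub complex_vs.subspace_add[OF sub Y(1)[of m] Y(1)[of n]], of "1/2"]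
      by (simp add: scaleC_half)
    have "(v - Y m) + (v - Y n) = 2 *\<^sub>R (v - (1/2::real) *\<^sub>R (Y m + Y n))"
      by (simp add: algebra_simps scaleR_2)
    hence "norm ((v - Y m) + (v - Y n)) = 2 * norm (v - (1/2::real) *\<^sub>R (Y m + Y n))" by simp
    hence "norm ((v - Y m) + (v - Y n)) \<ge> 2 * d" using d_le[OF mid] by simp
    hence "(norm ((v - Y m) + (v - Y n)))\<^sup>2 \<ge> (2 * d)\<^sup>2" using d0 by (intro power_mono) auto
    with parallelogram[of "v - Y m" "v - Y n"] show ?thesis
      by (simp add: norm_minus_commute)
  qed
  have "Cauchy Y"
  proof (rule metric_CauchyI)
    fix e :: real assume e: "e > 0"
    have "(\<lambda>n. (norm (v - Y n))\<^sup>2) \<longlonglongrightarrow> d\<^sup>2" by (intro tendsto_intros lim)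
    hence "eventually (\<lambda>n. (norm (v - Y n))\<^sup>2 < d\<^sup>2 + e\<^sup>2 / 4) sequentially"
      by (rule order_tendstoD) (use e in simp)
    then obtain N where N: "\<And>n. n \<ge> N \<Longrightarrow> (norm (v - Y n))\<^sup>2 < d\<^sup>2 + e\<^sup>2 / 4"
      by (auto simp: eventually_sequentially)
    show "\<exists>M. \<forall>m\<ge>M. \<forall>n\<ge>M. dist (Y m) (Y n) < e"
    proof (intro exI[of _ N] allI impI)
      fix m n assume "m \<ge> N" "n \<ge> N"
      hence "(norm (Y m - Y n))\<^sup>2 < e\<^sup>2" using key[of m n] N[of m] N[of n] by linarith
      thus "dist (Y m) (Y n) < e"
        using e by (simp add: dist_norm power2_less_imp_less)
    qed
  qed
  then obtain y where y: "Y \<longlonglongrightarrow> y" by (auto simp: Cauchy_convergent_iff convergent_def)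
  have yM: "y \<in> M" using cl y Y(1) by (metis closed_sequentially)
  define g where "g = v - y"
  have ng: "norm g = d"
  proof (rule LIMSEQ_unique[OF _ lim])
    show "(\<lambda>n. norm (v - Y n)) \<longlonglongrightarrow> norm g" unfolding g_def by (intro tendsto_intros y)
  qed
  have orth: "cinner g w = 0" if w: "w \<in> M" for w
  proof (rule ccontr)
    assume nz: "cinner g w \<noteq> 0"
    define p where "p = cinner g w"
    \<comment> \<open>Moving \<open>g\<close> by \<open>c *\<^sub>C w\<close> changes its squared
      norm by \<open>(t\<^sup>2 (norm w)\<^sup>2 - 2 t) (cmod p)\<^sup>2\<close>, which is negative
      since \<open>t (norm w)\<^sup>2 \<le> 1\<close>; the 1 in the denominator keeps
      \<open>t\<close> defined for every \<open>w\<close>.\<close>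
    define t where "t = 1 / (1 + (norm w)\<^sup>2)"
    have t0: "t > 0" by (simp add: t_def add_pos_nonneg)
    define c where "c = - complex_of_real t * p"
    have "y - c *\<^sub>C w \<in> M"
      using sub yM w by (intro complex_vs.subspace_diff complex_vs.subspace_scale)
    hence "d \<le> norm (g + c *\<^sub>C w)" using d_le[of "y - c *\<^sub>C w"] by (simp add: g_def algebra_simps)
    hence "(norm g)\<^sup>2 \<le> (norm (g + c *\<^sub>C w))\<^sup>2" using ng d0 by (intro power_mono) auto
    also have "\<dots> = (norm g)\<^sup>2 + (cmod c)\<^sup>2 * (norm w)\<^sup>2 + 2 * Re (cnj c * p)"
      by (simp add: norm_add_square norm_scaleC power_mult_distrib cinner_scaleC_right p_def)
    also have "cnj c * p = - complex_of_real (t * (cmod p)\<^sup>2)"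
      unfolding of_real_mult complex_norm_square by (simp add: c_def mult_ac)
    finally have "2 * (t * (cmod p)\<^sup>2) \<le> t\<^sup>2 * (cmod p)\<^sup>2 * (norm w)\<^sup>2"
      by (simp add: c_def norm_mult power_mult_distrib)
    hence "2 * t \<le> t\<^sup>2 * (norm w)\<^sup>2"
      using nz mult_le_cancel_left_pos[of "(cmod p)\<^sup>2" "2 * t" "t\<^sup>2 * (norm w)\<^sup>2"]
      by (simp add: p_def mult_ac)
    hence "2 \<le> t * (norm w)\<^sup>2" using t0 by (simp add: power2_eq_square mult.assoc)
    moreover have "t * (norm w)\<^sup>2 \<le> 1" by (simp add: t_def add_pos_nonneg)
    ultimately show False by simp
  qed
  have "g \<noteq> 0" using v yM by (auto simp: g_def)
  with orth show ?thesis by blast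
qed

lemma riesz_representation:
  fixes f :: "'a::complex_hilbert \<Rightarrow> complex"
  assumes bl: "bounded_linear f" and sc: "\<And>c x. f (c *\<^sub>C x) = c * f x"
  shows "\<exists>v. \<forall>x. f x = cinner x v"
proof (cases "\<forall>x. f x = 0")
  case True
  thus ?thesis by (auto intro: exI[of _ 0])
next
  case False
  interpret bounded_linear f by fact
  define M where "M = {x. f x = 0}"
  have M1: "closed M" unfolding M_def
    by (intro closed_Collect_eq linear_continuous_on bl continuous_intros)
  have M2: "complex_vs.subspace M"
    unfolding complex_vs.subspace_def M_def by (auto simp: zero add sc)
  have M3: "M \<noteq> UNIV" using False by (auto simp: M_def)
  obtain g where g: "g \<noteq> 0" "\<And>y. y \<in> M \<Longrightarrow> cinner g y = 0"
    using exists_orthogonal[OF M1 M2 M3] by metis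
  have "g \<notin> M" using g cinner_self_eq_0 by blast
  hence fg: "f g \<noteq> 0" by (simp add: M_def)
  have gg: "cinner g g \<noteq> 0" using g by (simp add: cinner_self_eq_0)
  have "f x = cinner x (cnj (f g / cinner g g) *\<^sub>C g)" for x
  proof -
    have "x - (f x / f g) *\<^sub>C g \<in> M" using fg by (simp add: M_def diff sc)
    hence "cinner g (x - (f x / f g) *\<^sub>C g) = 0" by (rule g)
    hence "cinner (x - (f x / f g) *\<^sub>C g) g = 0" by (metis cinner_commute complex_cnj_zero)
    hence "cinner x g = f x / f g * cinner g g"
      by (simp add: cinner.diff_left cinner_scaleC_left)
    thus ?thesis using fg gg by (simp add: cinner_scaleC_right)
  qed
  thus ?thesis by blast
qed

section \<open>Adjoint operators and their eigenvectors\<close>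

definition adj :: "('a::complex_hilbert \<Rightarrow> 'a) \<Rightarrow> 'a \<Rightarrow> 'a" where
  "adj A y = (SOME v. \<forall>x. cinner (A x) y = cinner x v)"

lemma bounded_clinearD:
  assumes "bounded_clinear A"
  shows "bounded_linear A" "A (c *\<^sub>C x) = c *\<^sub>C A x" "A (x + y) = A x + A y"
    "A (x - y) = A x - A y" "A 0 = 0"
  using assms linear_simps[of A] by (auto simp: bounded_clinear_def)

text \<open>Riesz representation supplies the vector chosen by \<open>adj\<close>, which is why
  facts about adjoints assume \<open>bounded_clinear\<close>; uniqueness is
  \<open>cinner_ext\<close>.\<close>

lemma adj_right:
  assumes A: "bounded_clinear A"
  shows "cinner (A x) y = cinner x (adj A y)"
proof -
  have "\<exists>v. \<forall>x. cinner (A x) y = cinner x v"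
  proof (rule riesz_representation)
    show "bounded_linear (\<lambda>x. cinner (A x) y)"
      using bounded_linear_compose[OF cinner.bounded_linear_left bounded_clinearD(1)[OF A]] by (simp add: o_def)
  qed (simp add: bounded_clinearD[OF A] cinner_scaleC_left)
  from someI_ex[OF this] show ?thesis unfolding adj_def by (rule spec)
qed

lemma adj_left:
  assumes A: "bounded_clinear A"
  shows "cinner (adj A x) y = cinner x (A y)"
  unfolding cinner_commute[of "adj A x"] cinner_commute[of x] by (simp only: adj_right[OF A])

lemma adj_eqI:
  assumes "bounded_clinear A" "\<And>z. cinner (A z) x = cinner z y"
  shows "adj A x = y"
  by (rule cinner_ext) (simp only: adj_right[OF assms(1), symmetric] assms(2))

lemma bounded_clinear_adj:
  assumes A: "bounded_clinear A"
  shows "bounded_clinear (adj A)"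
proof -
  obtain K where K: "K > 0" "\<And>x. norm (A x) \<le> norm x * K"
    using bounded_linear.pos_bounded[OF bounded_clinearD(1)[OF A]] by auto
  have add: "adj A (x + y) = adj A x + adj A y" for x y
    by (rule adj_eqI[OF A]) (simp add: cinner_add_right adj_right[OF A])
  have sc: "adj A (c *\<^sub>C x) = c *\<^sub>C adj A x" for c x
    by (rule adj_eqI[OF A]) (simp add: cinner_scaleC_right adj_right[OF A])
  have bd: "norm (adj A y) \<le> norm y * K" for y
  proof (cases "adj A y = 0")
    case False
    have "(norm (adj A y))\<^sup>2 = norm (cinner (adj A y) (adj A y))"
      by (simp add: cinner_self norm_power)
    also have "\<dots> = norm (cinner (A (adj A y)) y)" by (simp add: adj_right[OF A])
    also have "\<dots> \<le> norm (A (adj A y)) * norm y" by (rule norm_cinner_le)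
    also have "\<dots> \<le> norm (adj A y) * K * norm y" by (intro mult_right_mono K) auto
    finally show ?thesis using False by (simp add: power2_eq_square mult_ac)
  qed (use K in auto)
  have "bounded_linear (adj A)"
    by (rule bounded_linear_intro[of _ K]) (auto simp: add bd sc scaleC_of_real[symmetric])
  with sc show ?thesis by (simp add: bounded_clinear_def)
qed

lemma norm_adj_le:
  assumes A: "bounded_clinear A" and C: "\<And>x. norm (A x) \<le> norm x"
  shows "norm (adj A y) \<le> norm y"
proof (cases "adj A y = 0")
  case False
  have "(norm (adj A y))\<^sup>2 = norm (cinner (adj A y) (adj A y))"
    by (simp add: cinner_self norm_power)
  also have "\<dots> = norm (cinner (A (adj A y)) y)" by (simp add: adj_right[OF A])
  also have "\<dots> \<le> norm (A (adj A y)) * norm y" by (rule norm_cinner_le)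
  also have "\<dots> \<le> norm (adj A y) * norm y" by (intro mult_right_mono C) auto
  finally show ?thesis using False by (simp add: power2_eq_square)
qed auto

lemma adj_comp:
  assumes "bounded_clinear A" "bounded_clinear B"
  shows "adj (A \<circ> B) = adj B \<circ> adj A"
proof
  fix x
  have "cinner y (adj (A \<circ> B) x) = cinner y (adj B (adj A x))" for y
  proof -
    have "bounded_clinear (A \<circ> B)"
      using assms bounded_linear_compose[of A B] by (auto simp: bounded_clinear_def o_def)
    thus ?thesis using assms by (simp add: adj_right[symmetric])
  qed
  thus "adj (A \<circ> B) x = (adj B \<circ> adj A) x" by (auto intro: cinner_ext)
qed

text \<open>In the squared norm of \<open>adj A (A y) - y\<close> the cross term is
  \<open>- 2 (norm y)\<^sup>2\<close> and \<open>adj A\<close> is contractive, so nothing is left.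
  This is how a preserved norm is turned into an identity throughout.\<close>

lemma adj_app_norm_preserving:
  assumes A: "bounded_clinear A" and C: "\<And>x. norm (A x) \<le> norm x" and eq: "norm (A y) = norm y"
  shows "adj A (A y) = y"
proof -
  have "(norm (adj A (A y) - y))\<^sup>2 = (norm (adj A (A y)))\<^sup>2 + (norm y)\<^sup>2 - 2 * Re (cinner (adj A (A y)) y)"
    using norm_add_square[of "adj A (A y)" "- y"] by (simp add: cinner.minus_right)
  also have "Re (cinner (adj A (A y)) y) = (norm y)\<^sup>2"
    by (simp add: adj_left[OF A] cinner_self eq)
  also have "(norm (adj A (A y)))\<^sup>2 \<le> (norm y)\<^sup>2"
    using norm_adj_le[OF A C, of "A y"] eq by (intro power_mono) auto
  finally have "(norm (adj A (A y) - y))\<^sup>2 \<le> 0" by simp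
  thus ?thesis by simp
qed

text \<open>An eigenvector of \<open>adj T\<close> orthogonal to the cyclic vector is orthogonal to
  its whole orbit, hence 0; so pairing with the cyclic vector is injective on each eigenspace.
  Cyclicity is used only through this lemma.\<close>

lemma cyclic_adj_eigenvector:
  assumes mf: "multiplicity_free T" and T: "bounded_clinear T"
    and h: "adj T h = \<mu> *\<^sub>C h" and g: "adj T g = \<mu> *\<^sub>C g" "g \<noteq> 0"
  shows "\<exists>c. h = c *\<^sub>C g"
proof -
  obtain x where x: "closure (complex_vs.span (range (\<lambda>n. (T ^^ n) x))) = UNIV"
    using mf by (auto simp: multiplicity_free_def)
  have *: "k = 0" if k: "adj T k = \<mu> *\<^sub>C k" "cinner x k = 0" for k
  proof -
    have pw: "cinner ((T ^^ n) x) k = 0" for n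
      by (induction n) (simp_all add: k adj_right[OF T] cinner_scaleC_right)
    define M where "M = {y. cinner y k = 0}"
    have sp: "complex_vs.span (range (\<lambda>n. (T ^^ n) x)) \<subseteq> M"
    proof (rule complex_vs.span_minimal)
      show "complex_vs.subspace M"
        unfolding complex_vs.subspace_def M_def by (auto simp: cinner_add_left cinner_scaleC_left)
    qed (auto simp: M_def pw)
    have "closed M" unfolding M_def
      by (intro closed_Collect_eq continuous_intros linear_continuous_on cinner.bounded_linear_left)
    with sp have "M = UNIV" using x closure_minimal by blast
    hence "cinner k k = 0" by (auto simp: M_def)
    thus "k = 0" by (simp add: cinner_self_eq_0)
  qed
  have A: "bounded_clinear (adj T)" by (rule bounded_clinear_adj[OF T])
  have gx: "cinner x g \<noteq> 0" using *[OF g(1)] g(2) by blast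
  define c where "c = cnj (cinner x h / cinner x g)"
  have "h - c *\<^sub>C g = 0"
  proof (rule *)
    show "adj T (h - c *\<^sub>C g) = \<mu> *\<^sub>C (h - c *\<^sub>C g)"
      by (simp add: bounded_clinearD[OF A] h g complex_vs.scale_right_diff_distrib scaleC_scaleC mult.commute)
    show "cinner x (h - c *\<^sub>C g) = 0"
      using gx by (simp add: cinner.diff_right cinner_scaleC_right c_def)
  qed
  thus ?thesis by (auto intro: exI[of _ c])
qed

lemma one_minus_cnj_mult_nonzero:
  assumes "a \<in> disc" "norm z \<le> 1" shows "1 - cnj a * z \<noteq> 0"
proof
  assume "1 - cnj a * z = 0"
  hence "norm (cnj a * z) = 1" by (metis norm_one right_minus_eq)
  moreover have "norm (cnj a * z) < 1"
    using assms mult_le_cancel_left1[of "norm a" "norm z"] by (auto simp: norm_mult)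
  ultimately show False by simp
qed

section \<open>Blaschke factors\<close>

lemma Moebius_norm_identity:
  "(norm (1 - cnj a * z))\<^sup>2 - (norm (z - a))\<^sup>2 = (1 - (norm a)\<^sup>2) * (1 - (norm z)\<^sup>2)"
  by (simp only: cmod_power2 minus_complex.sel times_complex.sel one_complex.sel cnj.sel)
     (simp add: power2_eq_square algebra_simps)

lemma Moebius_norm_le:
  assumes "norm a \<le> 1" "norm z \<le> 1"
  shows "norm (z - a) \<le> norm (1 - cnj a * z)"
proof -
  have "(norm a)\<^sup>2 \<le> 1" "(norm z)\<^sup>2 \<le> 1" using assms by (simp_all add: abs_square_le_1)
  hence "0 \<le> (1 - (norm a)\<^sup>2) * (1 - (norm z)\<^sup>2)" by simp
  hence "(norm (z - a))\<^sup>2 \<le> (norm (1 - cnj a * z))\<^sup>2"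
    using Moebius_norm_identity[of a z] by linarith
  thus ?thesis by (rule power2_le_imp_le) simp
qed

lemma norm_blaschke_le:
  assumes "a \<in> disc" "z \<in> disc" shows "norm (blaschke_factor a z) \<le> 1"
  using Moebius_norm_le[of a z] one_minus_cnj_mult_nonzero[of a z] assms
  by (simp add: blaschke_factor_def norm_divide)

lemma norm_blaschke_less:
  assumes "a \<in> disc" "z \<in> disc" shows "norm (blaschke_factor a z) < 1"
proof -
  have "(norm a)\<^sup>2 < 1" "(norm z)\<^sup>2 < 1" using assms by (simp_all add: abs_square_less_1)
  hence "0 < (1 - (norm a)\<^sup>2) * (1 - (norm z)\<^sup>2)" by simp
  hence "(norm (z - a))\<^sup>2 < (norm (1 - cnj a * z))\<^sup>2"
    using Moebius_norm_identity[of a z] by linarith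
  hence "norm (z - a) < norm (1 - cnj a * z)" by (rule power2_less_imp_less) simp
  thus ?thesis by (simp add: blaschke_factor_def norm_divide divide_less_eq)
qed

lemma norm_blaschke_circle:
  assumes "a \<in> disc" "norm z = 1" shows "norm (blaschke_factor a z) = 1"
proof -
  have "norm (z - a) = norm (1 - cnj a * z)"
    using Moebius_norm_identity[of a z] assms by (simp add: power2_eq_iff_nonneg)
  thus ?thesis using one_minus_cnj_mult_nonzero[of a z] assms
    by (simp add: blaschke_factor_def norm_divide)
qed

lemma blaschke_holomorphic:
  assumes "a \<in> disc" shows "blaschke_factor a holomorphic_on cball 0 1"
  unfolding blaschke_factor_def
  using one_minus_cnj_mult_nonzero[OF assms] by (intro holomorphic_intros) auto

lemma blaschke_holomorphic_disc:
  assumes "a \<in> disc" shows "blaschke_factor a holomorphic_on disc"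
  by (rule holomorphic_on_subset[OF blaschke_holomorphic[OF assms]]) auto

lemma blaschke_eq_0_iff:
  assumes "a \<in> disc" "z \<in> disc" shows "blaschke_factor a z = 0 \<longleftrightarrow> z = a"
  using one_minus_cnj_mult_nonzero[of a z] assms by (auto simp: blaschke_factor_def)

lemma blaschke_inverse:
  assumes a: "a \<in> disc" and z: "z \<in> disc"
  shows "blaschke_factor (- a) (blaschke_factor a z) = z"
proof -
  have n: "1 - cnj a * z \<noteq> 0" using one_minus_cnj_mult_nonzero[of a z] assms by simp
  have "cnj a * a \<noteq> 1" using one_minus_cnj_mult_nonzero[of a a] a by auto
  have "blaschke_factor a z + a = z * (1 - cnj a * a) / (1 - cnj a * z)"
    using n by (simp add: blaschke_factor_def field_simps)
  moreover have "1 + cnj a * blaschke_factor a z = (1 - cnj a * a) / (1 - cnj a * z)"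
    using n by (simp add: blaschke_factor_def field_simps)
  ultimately show ?thesis using n \<open>cnj a * a \<noteq> 1\<close>
    by (simp add: blaschke_factor_def[of "- a"])
qed

text \<open>Schwarz's lemma for \<open>g\<close> composed with the inverse automorphism
  \<open>blaschke_factor (- a)\<close>. That lemma wants values strictly inside the disc, so
  \<open>g\<close> is divided by \<open>M + e\<close> and \<open>e\<close> tends to 0; this also
  covers \<open>M = 0\<close>.\<close>

lemma Blaschke_division:
  assumes g: "g holomorphic_on disc" and M: "\<And>z. z \<in> disc \<Longrightarrow> norm (g z) \<le> M"
    and a: "a \<in> disc" and ga: "g a = 0"
  shows "\<exists>\<sigma>. \<sigma> holomorphic_on disc \<and> (\<forall>z\<in>disc. norm (\<sigma> z) \<le> M) \<and>
    (\<forall>z\<in>disc. g z = blaschke_factor a z * \<sigma> z)"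
proof -
  have M0: "M \<ge> 0" using M[OF a] norm_ge_zero order_trans by blast
  have a': "- a \<in> disc" using a by simp
  have main: "norm (g z) \<le> M * norm (blaschke_factor a z)" if z: "z \<in> disc" for z
  proof -
    have "norm (g z) \<le> (M + e) * norm (blaschke_factor a z)" if e: "e > 0" for e
    proof -
      define f where "f w = g (blaschke_factor (- a) w) / of_real (M + e)" for w
      have maps: "blaschke_factor (- a) w \<in> disc" if "w \<in> disc" for w
        using norm_blaschke_less[OF a' that] by simp
      have "norm (f (blaschke_factor a z)) \<le> norm (blaschke_factor a z)"
      proof (rule Schwarz_Lemma(1))
        have "(g \<circ> blaschke_factor (- a)) holomorphic_on disc"
          by (rule holomorphic_on_compose_gen[OF blaschke_holomorphic_disc[OF a'] g]) (use maps in auto)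
        thus "f holomorphic_on disc"
          unfolding f_def using M0 e by (intro holomorphic_intros) (auto simp: o_def simp del: of_real_add)
        show "f 0 = 0" by (simp add: f_def blaschke_factor_def ga)
        show "norm (blaschke_factor a z) < 1" by (rule norm_blaschke_less[OF a z])
        show "norm (f w) < 1" if "norm w < 1" for w
        proof -
          have "norm (g (blaschke_factor (- a) w)) < M + e"
            using M[OF maps[of w]] that e by simp
          thus ?thesis using M0 e by (simp add: f_def norm_divide del: of_real_add)
        qed
      qed
      thus ?thesis using M0 e
        by (simp add: f_def blaschke_inverse[OF a z] norm_divide field_simps del: of_real_add)
    qed
    note * = this
    show ?thesis
    proof (rule field_le_epsilon)
      fix e :: real assume e: "e > 0"
      have "norm (g z) \<le> (M + e) * norm (blaschke_factor a z)" by (rule *[OF e])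
      also have "\<dots> \<le> M * norm (blaschke_factor a z) + e"
        using norm_blaschke_le[OF a z] e by (simp add: algebra_simps mult_left_le)
      finally show "norm (g z) \<le> M * norm (blaschke_factor a z) + e" .
    qed
  qed
  \<comment> \<open>The difference quotient with its singularity removed; the factor
    \<open>1 - cnj a * z\<close> in \<open>\<sigma>\<close> then undoes the denominator of the
    Blaschke factor.\<close>
  define k where "k z = (if z = a then deriv g a else (g z - g a) / (z - a))" for z
  have k: "k holomorphic_on disc" unfolding k_def by (rule pole_lemma_open) (use g in auto)
  define \<sigma> where "\<sigma> z = k z * (1 - cnj a * z)" for z
  have \<sigma>: "\<sigma> holomorphic_on disc" unfolding \<sigma>_def by (intro holomorphic_intros k)
  have fac: "g z = blaschke_factor a z * \<sigma> z" if "z \<in> disc" for z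
    using one_minus_cnj_mult_nonzero[OF a, of z] that
    by (auto simp: \<sigma>_def k_def blaschke_factor_def ga)
  have bd: "norm (\<sigma> z) \<le> M" if z: "z \<in> disc" "z \<noteq> a" for z
  proof -
    have "norm (blaschke_factor a z) > 0" using blaschke_eq_0_iff[OF a z(1)] z by simp
    moreover have "norm (blaschke_factor a z) * norm (\<sigma> z) \<le> M * norm (blaschke_factor a z)"
      using main[OF z(1)] fac[OF z(1)] by (simp add: norm_mult)
    ultimately show ?thesis by (simp add: mult.commute)
  qed
  \<comment> \<open>Division by the Blaschke factor says nothing at its root, where the bound is
    recovered by continuity.\<close>
  have "norm (\<sigma> a) \<le> M"
  proof (rule tendsto_upperbound)
    have "isCont \<sigma> a"
      using \<sigma> a by (meson continuous_on_eq_continuous_at holomorphic_on_imp_continuous_on open_ball)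
    thus "((\<lambda>z. norm (\<sigma> z)) \<longlongrightarrow> norm (\<sigma> a)) (at a)"
      by (intro tendsto_norm) (simp add: isCont_def)
    show "eventually (\<lambda>z. norm (\<sigma> z) \<le> M) (at a)"
      using a eventually_at_in_open[of disc a] by (auto elim!: eventually_mono intro: bd)
  qed auto
  with \<sigma> fac bd show ?thesis by (metis (no_types))
qed

text \<open>\<open>Blaschke_division\<close> for \<open>\<phi>\<close> followed by the automorphism
  that sends \<open>\<phi> a\<close> to 0. The conclusion is free of quotients, so that the
  functional calculus applies to it directly.\<close>

lemma Schwarz_Pick_division:
  assumes p: "\<phi> holomorphic_on disc" and b: "\<And>z. z \<in> disc \<Longrightarrow> norm (\<phi> z) \<le> 1"
    and a: "a \<in> disc" and less: "norm (\<phi> a) < 1"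
  shows "\<exists>\<sigma>. \<sigma> holomorphic_on disc \<and> (\<forall>z\<in>disc. norm (\<sigma> z) \<le> 1) \<and>
    (\<forall>z\<in>disc. \<phi> z - \<phi> a = blaschke_factor a z * (\<sigma> z * (1 - cnj (\<phi> a) * \<phi> z)))"
proof -
  have c: "\<phi> a \<in> disc" using less by simp
  have nz: "1 - cnj (\<phi> a) * \<phi> z \<noteq> 0" if "z \<in> disc" for z
    using one_minus_cnj_mult_nonzero[OF c b[OF that]] .
  define g where "g z = (\<phi> z - \<phi> a) / (1 - cnj (\<phi> a) * \<phi> z)" for z
  have "g holomorphic_on disc" unfolding g_def by (intro holomorphic_intros p nz)
  moreover have "norm (g z) \<le> 1" if "z \<in> disc" for z
    using Moebius_norm_le[of "\<phi> a" "\<phi> z"] b[OF that] b[OF a] nz[OF that]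
    by (simp add: g_def norm_divide)
  moreover have "g a = 0" by (simp add: g_def)
  ultimately obtain \<sigma> where \<sigma>: "\<sigma> holomorphic_on disc" "\<And>z. z \<in> disc \<Longrightarrow> norm (\<sigma> z) \<le> 1"
    "\<And>z. z \<in> disc \<Longrightarrow> g z = blaschke_factor a z * \<sigma> z"
    using Blaschke_division[of g 1 a] a by blast
  have "\<phi> z - \<phi> a = blaschke_factor a z * (\<sigma> z * (1 - cnj (\<phi> a) * \<phi> z))" if "z \<in> disc" for z
    using \<sigma>(3)[OF that] nz[OF that] by (simp add: g_def field_simps)
  with \<sigma> show ?thesis by blast
qed

section \<open>Infinite Blaschke products\<close>

text \<open>A product of factors \<open>1 + x n\<close> differs from 1 by at most
  \<open>exp (\<Sum>n. norm (x n)) - 1\<close>, so the tail sums of \<open>\<epsilon>\<close>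
  control the tails of the product. The factors stay abstract because two index sets are needed,
  before and after a root is taken out.\<close>

lemma infinite_product_tails:
  fixes \<beta> :: "nat \<Rightarrow> complex \<Rightarrow> complex" and \<epsilon> :: "nat \<Rightarrow> real"
  assumes holo: "\<And>n. \<beta> n holomorphic_on disc" and le1: "\<And>n z. z \<in> disc \<Longrightarrow> norm (\<beta> n z) \<le> 1"
    and sm: "summable \<epsilon>" and nonneg: "\<And>n. 0 \<le> \<epsilon> n"
    and bnd: "\<And>r. r < 1 \<Longrightarrow> \<exists>C\<ge>0. \<forall>n. \<forall>z\<in>cball 0 r. norm (\<beta> n z - 1) \<le> C * \<epsilon> n"
  shows "\<exists>\<tau>. (\<forall>j. \<tau> j holomorphic_on disc \<and> (\<forall>z\<in>disc. norm (\<tau> j z) \<le> 1) \<and>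
      (\<forall>r<1. uniform_limit (cball 0 r) (\<lambda>N z. \<Prod>n<N. \<beta> (n + j) z) (\<tau> j) sequentially) \<and>
      (\<forall>z\<in>disc. \<tau> 0 z = (\<Prod>n<j. \<beta> n z) * \<tau> j z)) \<and>
      (\<forall>r<1. uniform_limit (cball 0 r) \<tau> (\<lambda>_. 1) sequentially)"
proof -
  define P where "P j N z = (\<Prod>n<N. \<beta> (n + j) z)" for j N z
  define \<tau> where "\<tau> j z = lim (\<lambda>N. P j N z)" for j z
  have ul: "uniform_limit (cball 0 r) (P j) (\<tau> j) sequentially" if r: "r < 1" for r j
  proof -
    obtain C where C: "C \<ge> 0" "\<And>n z. z \<in> cball 0 r \<Longrightarrow> norm (\<beta> n z - 1) \<le> C * \<epsilon> n"
      using bnd[OF r] by blast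
    have "uniformly_convergent_on (cball 0 r) (\<lambda>N z. \<Prod>n<N. \<beta> (n + j) z)"
    proof (rule uniformly_convergent_on_prod')
      show "continuous_on (cball 0 r) (\<beta> (n + j))" for n
        by (rule holomorphic_on_imp_continuous_on, rule holomorphic_on_subset[OF holo]) (use r in auto)
      show "uniformly_convergent_on (cball 0 r) (\<lambda>N x. \<Sum>n<N. norm (\<beta> (n + j) x - 1))"
        by (rule Weierstrass_m_test'[where M = "\<lambda>n. C * \<epsilon> (n + j)"])
           (auto intro!: C summable_mult summable_ignore_initial_segment sm)
    qed auto
    thus ?thesis
      unfolding uniformly_convergent_uniform_limit_iff P_def[abs_def] \<tau>_def[abs_def] .
  qed
  have pt: "(\<lambda>N. P j N z) \<longlonglongrightarrow> \<tau> j z" if z: "z \<in> disc" for j z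
    using tendsto_uniform_limitI[OF ul[of "norm z"]] z by simp
  have Pholo: "P j N holomorphic_on disc" for j N
    unfolding P_def by (intro holomorphic_intros holo)
  have Ple: "norm (P j N z) \<le> 1" if "z \<in> disc" for j N z
    unfolding P_def prod_norm[symmetric] by (intro prod_le_1) (auto intro!: le1 that)
  have h: "\<tau> j holomorphic_on disc" for j
  proof (rule holomorphic_uniform_sequence[OF open_ball Pholo])
    fix x :: complex assume x: "x \<in> disc"
    define d where "d = (1 - norm x) / 2"
    have sub: "cball x d \<subseteq> cball 0 ((1 + norm x) / 2)"
    proof
      fix y assume "y \<in> cball x d"
      thus "y \<in> cball 0 ((1 + norm x) / 2)"
        using norm_triangle_sub[of y x] by (simp add: d_def dist_norm norm_minus_commute field_simps)
    qed
    moreover have "cball 0 ((1 + norm x) / 2) \<subseteq> disc" using x by auto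
    ultimately show "\<exists>d. 0 < d \<and> cball x d \<subseteq> disc \<and> uniform_limit (cball x d) (P j) (\<tau> j) sequentially"
      using x ul[of "(1 + norm x) / 2" j]
      by (intro exI[of _ d]) (auto simp: d_def intro: uniform_limit_on_subset)
  qed
  have n: "norm (\<tau> j z) \<le> 1" if "z \<in> disc" for j z
    by (rule LIMSEQ_le_const2[OF tendsto_norm[OF pt[OF that]]]) (auto intro: Ple that)
  have fac: "\<tau> 0 z = (\<Prod>n<j. \<beta> n z) * \<tau> j z" if z: "z \<in> disc" for j z
  proof (rule LIMSEQ_unique)
    show "(\<lambda>N. P 0 (N + j) z) \<longlonglongrightarrow> \<tau> 0 z" by (rule LIMSEQ_ignore_initial_segment[OF pt[OF z]])
    have "P 0 (N + j) z = (\<Prod>n<j. \<beta> n z) * P j N z" for N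
    proof -
      have "P 0 (N + j) z = (\<Prod>n\<in>{0..<j}. \<beta> n z) * (\<Prod>n\<in>{j..<N + j}. \<beta> n z)"
        unfolding P_def lessThan_atLeast0 by (simp add: prod.atLeastLessThan_concat)
      also have "(\<Prod>n\<in>{j..<N + j}. \<beta> n z) = P j N z"
        using prod.shift_bounds_nat_ivl[of "\<lambda>n. \<beta> n z" 0 j N] by (simp add: P_def lessThan_atLeast0)
      finally show ?thesis by (simp add: lessThan_atLeast0)
    qed
    thus "(\<lambda>N. P 0 (N + j) z) \<longlonglongrightarrow> (\<Prod>n<j. \<beta> n z) * \<tau> j z"
      by (simp only:) (intro tendsto_intros pt[OF z])
  qed
  have lim1: "uniform_limit (cball 0 r) \<tau> (\<lambda>_. 1) sequentially" if r: "r < 1" for r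
  proof -
    obtain C where C: "C \<ge> 0" "\<And>n z. z \<in> cball 0 r \<Longrightarrow> norm (\<beta> n z - 1) \<le> C * \<epsilon> n"
      using bnd[OF r] by blast
    have est: "norm (\<tau> j z - 1) \<le> exp (C * (\<Sum>n. \<epsilon> (n + j))) - 1" if z: "z \<in> cball 0 r" for j z
    proof (rule LIMSEQ_le_const2)
      have z': "z \<in> disc" using z r by auto
      show "(\<lambda>N. norm (P j N z - 1)) \<longlonglongrightarrow> norm (\<tau> j z - 1)"
        by (intro tendsto_intros pt[OF z'])
      have "norm (P j N z - 1) \<le> exp (C * (\<Sum>n. \<epsilon> (n + j))) - 1" for N
      proof -
        have "norm ((\<Prod>n<N. 1 + (\<beta> (n + j) z - 1)) - 1) \<le> (\<Prod>n<N. 1 + norm (\<beta> (n + j) z - 1)) - 1"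
          by (rule norm_prod_minus1_le_prod_minus1)
        also have "(\<Prod>n<N. 1 + norm (\<beta> (n + j) z - 1)) \<le> exp (\<Sum>n<N. norm (\<beta> (n + j) z - 1))"
          by (rule prod_le_exp_sum) auto
        also have "(\<Sum>n<N. norm (\<beta> (n + j) z - 1)) \<le> (\<Sum>n<N. C * \<epsilon> (n + j))"
          by (intro sum_mono C z)
        also have "\<dots> \<le> C * (\<Sum>n. \<epsilon> (n + j))"
          unfolding sum_distrib_left[symmetric]
          by (intro mult_left_mono C sum_le_suminf summable_ignore_initial_segment sm) (auto simp: nonneg)
        finally show ?thesis by (simp add: P_def)
      qed
      thus "\<exists>N. \<forall>n\<ge>N. norm (P j n z - 1) \<le> exp (C * (\<Sum>n. \<epsilon> (n + j))) - 1" by blast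
    qed
    have "(\<lambda>j. exp (C * (\<Sum>n. \<epsilon> (n + j))) - 1) \<longlonglongrightarrow> exp (C * 0) - 1"
      by (intro tendsto_intros suminf_exist_split2 sm)
    hence l: "(\<lambda>j. exp (C * (\<Sum>n. \<epsilon> (n + j))) - 1) \<longlonglongrightarrow> 0" by simp
    show ?thesis
    proof (rule uniform_limitI)
      fix e :: real assume e: "e > 0"
      have "eventually (\<lambda>j. exp (C * (\<Sum>n. \<epsilon> (n + j))) - 1 < e) sequentially"
        by (rule order_tendstoD(2)[OF l e])
      thus "\<forall>\<^sub>F j in sequentially. \<forall>z\<in>cball 0 r. dist (\<tau> j z) 1 < e"
      proof eventually_elim
        case (elim j)
        thus ?case using le_less_trans[OF est elim] by (simp add: dist_norm)
      qed
    qed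
  qed
  show ?thesis
    using h n ul fac lim1 unfolding P_def[abs_def] by (intro exI[of _ \<tau>]) auto
qed

text \<open>\<open>\<beta> n\<close> is allowed to be constantly 1 so that finite and infinite products are treated alike.\<close>

definition blaschke_or_one :: "(complex \<Rightarrow> complex) \<Rightarrow> bool" where
  "blaschke_or_one b \<longleftrightarrow> b = (\<lambda>z. 1) \<or>
     (\<exists>a c. a \<in> disc \<and> norm c = 1 \<and> b = (\<lambda>z. c * blaschke_factor a z))"

lemma norm_blaschke_sign: "norm (blaschke_sign a) = 1"
  by (auto simp: blaschke_sign_def norm_divide)

text \<open>The sign is what makes \<open>1 - norm a\<close>, the summable quantity, an exact factor
  of the difference. The remaining quotient is at most \<open>2 * norm a\<close> over
  \<open>norm a * (1 - r)\<close>.\<close>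

lemma norm_signed_blaschke_minus_one_le:
  assumes a: "a \<in> disc" and z: "z \<in> cball 0 r" and r: "r < 1"
  shows "norm (blaschke_sign a * blaschke_factor a z - 1) \<le> 2 / (1 - r) * (1 - norm a)"
proof (cases "a = 0")
  case True
  have "norm (z - 1) \<le> 2" using norm_triangle_ineq4[of z 1] z r by simp
  also have "2 \<le> 2 / (1 - r)" using r z by (simp add: field_simps) (use norm_ge_zero order_trans in blast)
  finally show ?thesis using True by (simp add: blaschke_sign_def blaschke_factor_def)
next
  case False
  have z1: "norm z \<le> 1" using z r by simp
  have nz: "1 - cnj a * z \<noteq> 0" by (rule one_minus_cnj_mult_nonzero[OF a z1])
  have na: "norm a < 1" using a by simp
  define m where "m = complex_of_real (norm a)"
  have mm: "a * cnj a = m * m" using complex_norm_square[of a] by (simp add: m_def power2_eq_square)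
  have "blaschke_sign a * blaschke_factor a z - 1 = - ((1 - m) * (a + m * z)) / (a * (1 - cnj a * z))"
  proof -
    have "blaschke_sign a * blaschke_factor a z - 1 = (- m * (z - a) - a * (1 - cnj a * z)) / (a * (1 - cnj a * z))"
      using False nz by (simp add: blaschke_sign_def blaschke_factor_def m_def[symmetric] divide_simps)
    also have "- m * (z - a) - a * (1 - cnj a * z) = m * a - m * z - a + (a * cnj a) * z"
      by (simp add: algebra_simps)
    also have "\<dots> = - ((1 - m) * (a + m * z))"
      unfolding mm by (simp add: algebra_simps)
    finally show ?thesis .
  qed
  hence "norm (blaschke_sign a * blaschke_factor a z - 1) = (norm (1 - m) * norm (a + m * z)) / (norm a * norm (1 - cnj a * z))"
    by (simp add: norm_divide norm_mult)
  also have "norm (1 - m) = 1 - norm a"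
    unfolding m_def using na by (metis abs_of_nonneg diff_ge_0_iff_ge less_imp_le norm_of_real of_real_1 of_real_diff)
  also have "(1 - norm a) * norm (a + m * z) / (norm a * norm (1 - cnj a * z)) \<le> (1 - norm a) * (2 * norm a) / (norm a * (1 - r))"
  proof (intro frac_le mult_left_mono)
    have "norm (m * z) \<le> norm a * 1" using z1 by (simp add: m_def norm_mult mult_left_le)
    thus "norm (a + m * z) \<le> 2 * norm a" using norm_triangle_ineq[of a "m * z"] by simp
    have "norm (cnj a * z) \<le> 1 * r" unfolding norm_mult using na z by (intro mult_mono) auto
    thus "1 - r \<le> norm (1 - cnj a * z)" using norm_triangle_ineq2[of 1 "cnj a * z"] by simp
  qed (use na False r in auto)
  also have "\<dots> = 2 / (1 - r) * (1 - norm a)" using False by simp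
  finally show ?thesis .
qed

text \<open>Far-out tails are close to 1 at \<open>\<mu>\<close>, so the zero of
  \<open>\<theta>\<close> must come from a finite partial product; the responsible factor is moved
  to the front.\<close>

lemma blaschke_product_structure:
  assumes bp: "blaschke_product \<theta>" and lam: "\<mu> \<in> disc" "\<theta> \<mu> = 0"
  shows "\<exists>\<beta> \<tau> c. norm c = 1 \<and> (\<forall>n. blaschke_or_one (\<beta> n)) \<and>
      (\<forall>j. \<tau> j holomorphic_on disc \<and> (\<forall>z\<in>disc. norm (\<tau> j z) \<le> 1) \<and>
      (\<forall>r<1. uniform_limit (cball 0 r) (\<lambda>N z. \<Prod>n<N. \<beta> (n + j) z) (\<tau> j) sequentially) \<and>
      (\<forall>z\<in>disc. \<theta> z = c * blaschke_factor \<mu> z * (\<Prod>n<j. \<beta> n z) * \<tau> j z)) \<and>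
      (\<forall>r<1. uniform_limit (cball 0 r) \<tau> (\<lambda>_. 1) sequentially)"
proof -
  obtain I :: "nat set" and a c where I: "\<And>n. n \<in> I \<Longrightarrow> a n \<in> disc"
    "(\<lambda>n. 1 - norm (a n)) summable_on I" "norm c = 1"
    and lim: "\<And>z. z \<in> disc \<Longrightarrow> (\<lambda>N. c * (\<Prod>n\<in>I \<inter> {..<N}. blaschke_sign (a n) * blaschke_factor (a n) z)) \<longlonglongrightarrow> \<theta> z"
    using bp unfolding blaschke_product_def by blast
  \<comment> \<open>Indices outside \<open>K\<close> contribute the factor 1, so that every product
    runs over all of \<open>nat\<close>.\<close>
  define B where "B K n = (if n \<in> K then (\<lambda>z. blaschke_sign (a n) * blaschke_factor (a n) z) else (\<lambda>z. 1))" for K n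
  define \<epsilon> where "\<epsilon> n = (if n \<in> I then 1 - norm (a n) else 0)" for n
  have bo: "blaschke_or_one (B K n)" if "K \<subseteq> I" for K n
  proof (cases "n \<in> K")
    case True
    thus ?thesis unfolding blaschke_or_one_def using that I(1)[of n] norm_blaschke_sign[of "a n"]
      by (intro disjI2 exI[of _ "a n"] exI[of _ "blaschke_sign (a n)"]) (auto simp: B_def)
  qed (simp add: B_def blaschke_or_one_def)
  have e0: "\<epsilon> n \<ge> 0" for n using I(1)[of n] by (auto simp: \<epsilon>_def)
  have "(\<lambda>n. \<epsilon> n) summable_on UNIV"
    using I(2) by (subst summable_on_cong_neutral[where T = I and g = "\<lambda>n. 1 - norm (a n)"]) (auto simp: \<epsilon>_def)
  hence esm: "summable \<epsilon>"
    using e0 by (subst (asm) summable_on_UNIV_nonneg_real_iff) auto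
  have holo: "B K n holomorphic_on disc" if "K \<subseteq> I" for K n
    using that I(1) by (auto simp: B_def intro!: holomorphic_intros blaschke_holomorphic_disc)
  have le1: "norm (B K n z) \<le> 1" if "K \<subseteq> I" "z \<in> disc" for K n z
    using that I(1) norm_blaschke_le[of "a n" z] by (auto simp: B_def norm_mult norm_blaschke_sign)
  have bnd: "\<exists>C\<ge>0. \<forall>n. \<forall>z\<in>cball 0 r. norm (B K n z - 1) \<le> C * \<epsilon> n" if "K \<subseteq> I" "r < 1" for K r
  proof (intro exI[of _ "2 / (1 - r)"] conjI allI ballI)
    fix n and z :: complex assume "z \<in> cball 0 r"
    thus "norm (B K n z - 1) \<le> 2 / (1 - r) * \<epsilon> n"
      using norm_signed_blaschke_minus_one_le[OF I(1)[of n], of z r] that e0[of n] by (auto simp: B_def \<epsilon>_def)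
  qed (use that in auto)
  note tails = infinite_product_tails[OF holo le1 esm e0 bnd]
  obtain \<tau>' where \<tau>': "\<And>j. \<tau>' j holomorphic_on disc"
     "\<And>j r. r < 1 \<Longrightarrow> uniform_limit (cball 0 r) (\<lambda>N z. \<Prod>n<N. B I (n + j) z) (\<tau>' j) sequentially"
     "\<And>j z. z \<in> disc \<Longrightarrow> \<tau>' 0 z = (\<Prod>n<j. B I n z) * \<tau>' j z"
     "\<And>r. r < 1 \<Longrightarrow> uniform_limit (cball 0 r) \<tau>' (\<lambda>_. 1) sequentially"
    using tails[of I, simplified order_refl simp_thms] by blast
  have th: "\<theta> z = c * \<tau>' 0 z" if z: "z \<in> disc" for z
  proof (rule LIMSEQ_unique[OF lim[OF z]])
    have "(\<Prod>n<N. B I n z) = (\<Prod>n\<in>I \<inter> {..<N}. blaschke_sign (a n) * blaschke_factor (a n) z)" for N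
      unfolding B_def by (rule prod.mono_neutral_cong_right) auto
    moreover have "(\<lambda>N. \<Prod>n<N. B I n z) \<longlonglongrightarrow> \<tau>' 0 z"
      using tendsto_uniform_limitI[OF \<tau>'(2)[where r = "norm z" and j = 0], where x = z] z by simp
    ultimately show "(\<lambda>N. c * (\<Prod>n\<in>I \<inter> {..<N}. blaschke_sign (a n) * blaschke_factor (a n) z)) \<longlonglongrightarrow> c * \<tau>' 0 z"
      by (intro tendsto_intros) simp
  qed
  have "(\<lambda>j. \<tau>' j \<mu>) \<longlonglongrightarrow> 1"
    using tendsto_uniform_limitI[OF \<tau>'(4)[where r = "norm \<mu>"], where x = \<mu>] lam by simp
  hence "eventually (\<lambda>j. \<tau>' j \<mu> \<noteq> 0) sequentially"
    by (rule tendsto_imp_eventually_ne) simp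
  then obtain j where "\<tau>' j \<mu> \<noteq> 0" by (auto simp: eventually_sequentially)
  moreover have "c \<noteq> 0" using I(3) by auto
  ultimately have "(\<Prod>n<j. B I n \<mu>) = 0" using th[OF lam(1)] lam(2) \<tau>'(3)[OF lam(1), of j] by auto
  then obtain m where "B I m \<mu> = 0" by auto
  hence m: "m \<in> I" "a m = \<mu>"
    using blaschke_eq_0_iff[of "a m" \<mu>] I(1)[of m] lam norm_blaschke_sign[of "a m"] by (auto simp: B_def split: if_splits)
  \<comment> \<open>A single index is dropped; further indices with the same root stay in the
    product.\<close>
  define J where "J = I - {m}"
  have J: "J \<subseteq> I" by (auto simp: J_def)
  obtain \<tau> where \<tau>: "\<And>j. \<tau> j holomorphic_on disc" "\<And>j z. z \<in> disc \<Longrightarrow> norm (\<tau> j z) \<le> 1"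
     "\<And>j r. r < 1 \<Longrightarrow> uniform_limit (cball 0 r) (\<lambda>N z. \<Prod>n<N. B J (n + j) z) (\<tau> j) sequentially"
     "\<And>j z. z \<in> disc \<Longrightarrow> \<tau> 0 z = (\<Prod>n<j. B J n z) * \<tau> j z"
     "\<And>r. r < 1 \<Longrightarrow> uniform_limit (cball 0 r) \<tau> (\<lambda>_. 1) sequentially"
    using tails[of J, simplified J simp_thms] by blast
  have eq: "\<tau>' 0 z = blaschke_sign \<mu> * blaschke_factor \<mu> z * \<tau> 0 z" if z: "z \<in> disc" for z
  proof (rule LIMSEQ_unique)
    \<comment> \<open>At least \<open>Suc m\<close> factors are taken, so that the index
      \<open>m\<close> is always among them.\<close>
    show "(\<lambda>N. \<Prod>n<N + Suc m. B I n z) \<longlonglongrightarrow> \<tau>' 0 z"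
      using LIMSEQ_ignore_initial_segment[OF tendsto_uniform_limitI[OF \<tau>'(2)[where r = "norm z" and j = 0], where x = z], of "Suc m"] z
      by (simp del: prod.lessThan_Suc add_Suc_right)
    have "(\<Prod>n<N + Suc m. B I n z) = blaschke_sign \<mu> * blaschke_factor \<mu> z * (\<Prod>n<N + Suc m. B J n z)" for N
    proof -
      have mm: "m \<in> {..<N + Suc m}" by simp
      have "(\<Prod>n\<in>{..<N + Suc m} - {m}. B I n z) = (\<Prod>n\<in>{..<N + Suc m} - {m}. B J n z)"
        by (rule prod.cong) (auto simp: B_def J_def)
      moreover have "(\<Prod>n<N + Suc m. B I n z) = B I m z * (\<Prod>n\<in>{..<N + Suc m} - {m}. B I n z)"
        by (rule prod.remove[OF _ mm]) simp
      moreover have "(\<Prod>n<N + Suc m. B J n z) = B J m z * (\<Prod>n\<in>{..<N + Suc m} - {m}. B J n z)"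
        by (rule prod.remove[OF _ mm]) simp
      ultimately show ?thesis using m by (simp add: B_def J_def)
    qed
    moreover have "(\<lambda>N. \<Prod>n<N + Suc m. B J n z) \<longlonglongrightarrow> \<tau> 0 z"
      using LIMSEQ_ignore_initial_segment[OF tendsto_uniform_limitI[OF \<tau>(3)[where r = "norm z" and j = 0], where x = z], of "Suc m"] z
      by (simp del: prod.lessThan_Suc add_Suc_right)
    ultimately show "(\<lambda>N. \<Prod>n<N + Suc m. B I n z) \<longlonglongrightarrow> blaschke_sign \<mu> * blaschke_factor \<mu> z * \<tau> 0 z"
      by (simp only:) (intro tendsto_intros)
  qed
  have "\<theta> z = (c * blaschke_sign \<mu>) * blaschke_factor \<mu> z * (\<Prod>n<j. B J n z) * \<tau> j z" if "z \<in> disc" for z j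
    using th[OF that] eq[OF that] \<tau>(4)[OF that, of j] by (simp add: mult_ac)
  moreover have "norm (c * blaschke_sign \<mu>) = 1" by (simp add: norm_mult norm_blaschke_sign I)
  ultimately show ?thesis
    using \<tau> bo[OF J] by (intro exI[of _ "B J"] exI[of _ \<tau>] exI[of _ "c * blaschke_sign \<mu>"]) blast
qed

section \<open>The Hardy space\<close>

abbreviation square_summable :: "(nat \<Rightarrow> complex) \<Rightarrow> bool" where
  "square_summable a \<equiv> summable (\<lambda>n. (norm (a n))\<^sup>2)"

lemma square_summable_mult:
  assumes "square_summable a" "square_summable b"
  shows "summable (\<lambda>n. norm (a n * b n))"
proof (rule summable_comparison_test')
  show "summable (\<lambda>n. (norm (a n))\<^sup>2 + (norm (b n))\<^sup>2)" by (intro summable_add assms)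
  show "norm (norm (a n * b n)) \<le> (norm (a n))\<^sup>2 + (norm (b n))\<^sup>2" for n
  proof -
    have "norm (norm (a n * b n)) = norm (a n) * norm (b n)" by (simp add: norm_mult)
    moreover have "0 \<le> norm (a n) * norm (b n)" by simp
    ultimately show ?thesis using sum_squares_bound[of "norm (a n)" "norm (b n)"] by linarith
  qed
qed

lemma square_summable_mult_cnj:
  assumes "square_summable a" "square_summable b"
  shows "summable (\<lambda>n. norm (a n * cnj (b n)))"
  using square_summable_mult[of a "\<lambda>n. cnj (b n)"] assms by simp

lemma L2_set_le_suminf:
  assumes "square_summable a"
  shows "L2_set (\<lambda>n. norm (a n)) {..<N} \<le> sqrt (\<Sum>n. (norm (a n))\<^sup>2)"
  unfolding L2_set_def using assms by (intro real_sqrt_le_mono sum_le_suminf) auto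

lemma square_summable_bounded:
  assumes "\<And>N. L2_set (\<lambda>n. norm (a n)) {..<N} \<le> C"
  shows "square_summable a" "(\<Sum>n. (norm (a n))\<^sup>2) \<le> C\<^sup>2"
proof -
  have C: "0 \<le> C" using assms[of 0] by simp
  have le: "(\<Sum>n<N. (norm (a n))\<^sup>2) \<le> C\<^sup>2" for N
    using power_mono[OF assms[of N] L2_set_nonneg, of 2] by (simp add: L2_set_def sum_nonneg)
  show "square_summable a"
    by (rule bounded_imp_summable[of _ "C\<^sup>2"]) (use le[of "Suc _"] in \<open>auto simp: lessThan_Suc_atMost\<close>)
  thus "(\<Sum>n. (norm (a n))\<^sup>2) \<le> C\<^sup>2"
    by (rule suminf_le_const) (rule le)
qed

lemma norm_suminf_mult_cnj_le:
  assumes a: "square_summable a" and b: "square_summable b"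
  shows "norm (\<Sum>n. a n * cnj (b n)) \<le> sqrt (\<Sum>n. (norm (a n))\<^sup>2) * sqrt (\<Sum>n. (norm (b n))\<^sup>2)"
proof (rule LIMSEQ_le_const2)
  show "(\<lambda>N. norm (\<Sum>n<N. a n * cnj (b n))) \<longlonglongrightarrow> norm (\<Sum>n. a n * cnj (b n))"
    by (intro tendsto_norm summable_LIMSEQ summable_norm_cancel[OF square_summable_mult_cnj] a b)
  have "norm (\<Sum>n<N. a n * cnj (b n)) \<le> sqrt (\<Sum>n. (norm (a n))\<^sup>2) * sqrt (\<Sum>n. (norm (b n))\<^sup>2)" for N
  proof -
    have "norm (\<Sum>n<N. a n * cnj (b n)) \<le> (\<Sum>n<N. \<bar>norm (a n)\<bar> * \<bar>norm (b n)\<bar>)"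
      by (rule order_trans[OF norm_sum]) (simp add: norm_mult)
    also have "\<dots> \<le> L2_set (\<lambda>n. norm (a n)) {..<N} * L2_set (\<lambda>n. norm (b n)) {..<N}"
      by (rule L2_set_mult_ineq)
    also have "\<dots> \<le> sqrt (\<Sum>n. (norm (a n))\<^sup>2) * sqrt (\<Sum>n. (norm (b n))\<^sup>2)"
      by (intro mult_mono L2_set_le_suminf a b L2_set_nonneg real_sqrt_ge_zero suminf_nonneg) auto
    finally show ?thesis .
  qed
  thus "\<exists>N. \<forall>n\<ge>N. norm (\<Sum>n<n. a n * cnj (b n)) \<le> sqrt (\<Sum>n. (norm (a n))\<^sup>2) * sqrt (\<Sum>n. (norm (b n))\<^sup>2)"
    by blast
qed

section \<open>Taylor coefficients at the origin\<close>

lemma has_fps_expansion_disc: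
  assumes "f holomorphic_on disc"
  shows "f has_fps_expansion fps_expansion f 0"
  using assms by (intro has_fps_expansion_fps_expansion[of disc]) auto

lemma taylor_coeff_fps: "taylor_coeff f n = fps_nth (fps_expansion f 0) n"
  by (simp add: taylor_coeff_def fps_expansion_def)

lemma taylor_coeff_eqI:
  assumes "f has_fps_expansion F"
  shows "taylor_coeff f n = fps_nth F n"
  using fps_nth_fps_expansion[OF assms, of n] by (simp add: taylor_coeff_def)

lemma taylor_coeff_sums:
  assumes "f holomorphic_on disc" "z \<in> disc"
  shows "(\<lambda>n. taylor_coeff f n * z ^ n) sums f z"
  using holomorphic_power_series[OF assms] by (simp add: taylor_coeff_def)

lemma taylor_coeff_lin:
  assumes "f holomorphic_on disc" "g holomorphic_on disc"
  shows "taylor_coeff (\<lambda>z. f z + c * g z) n = taylor_coeff f n + c * taylor_coeff g n"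
proof -
  have "(\<lambda>z. f z + c * g z) has_fps_expansion (fps_expansion f 0 + fps_const c * fps_expansion g 0)"
    by (intro fps_expansion_intros has_fps_expansion_disc assms)
  from taylor_coeff_eqI[OF this, of n] show ?thesis by (simp add: taylor_coeff_fps)
qed

lemma taylor_coeff_shift:
  assumes "f holomorphic_on disc"
  shows "taylor_coeff (\<lambda>z. z * f z) n = (if n = 0 then 0 else taylor_coeff f (n - 1))"
proof -
  have "(\<lambda>z. z * f z) has_fps_expansion (fps_X * fps_expansion f 0)"
    by (intro fps_expansion_intros has_fps_expansion_disc assms)
  from taylor_coeff_eqI[OF this, of n] show ?thesis by (simp add: taylor_coeff_fps)
qed

lemma taylor_coeff_cong:
  assumes "\<And>z. z \<in> disc \<Longrightarrow> f z = g z"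
  shows "taylor_coeff f n = taylor_coeff g n"
proof -
  have "eventually (\<lambda>z. f z = g z) (nhds 0)"
    using assms by (intro eventually_nhds_in_open[of disc, THEN eventually_mono]) auto
  thus ?thesis unfolding taylor_coeff_fps by (simp add: fps_expansion_cong)
qed

section \<open>Norm and inner product of the Hardy space\<close>

definition H2_sqnorm :: "(complex \<Rightarrow> complex) \<Rightarrow> real" where
  "H2_sqnorm f = (\<Sum>n. (norm (taylor_coeff f n))\<^sup>2)"

lemma H2D:
  assumes "f \<in> H2"
  shows "f holomorphic_on disc" "z \<notin> disc \<Longrightarrow> f z = 0" "square_summable (taylor_coeff f)"
  using assms by (auto simp: H2_def)

lemma H2_eqI:
  assumes "f \<in> H2" "g \<in> H2" "\<And>n. taylor_coeff f n = taylor_coeff g n"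
  shows "f = g"
proof
  fix z show "f z = g z"
  proof (cases "z \<in> disc")
    case True
    thus ?thesis using taylor_coeff_sums[OF H2D(1)[OF assms(1)]] taylor_coeff_sums[OF H2D(1)[OF assms(2)]]
      by (simp add: assms(3)) (metis sums_unique2)
  qed (use H2D(2) assms in metis)
qed

lemma zero_in_H2: "(\<lambda>z. 0) \<in> H2" and taylor_coeff_zero: "taylor_coeff (\<lambda>z. 0) n = 0"
proof -
  show *: "taylor_coeff (\<lambda>z. 0) n = 0" for n
    using taylor_coeff_eqI[OF has_fps_expansion_0, of n] by simp
  show "(\<lambda>z. 0) \<in> H2" by (simp add: H2_def *)
qed

lemma H2_lin:
  assumes f: "f \<in> H2" and g: "g \<in> H2"
  shows "(\<lambda>z. f z + c * g z) \<in> H2"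
proof -
  have "square_summable (\<lambda>n. taylor_coeff f n + c * taylor_coeff g n)"
  proof (rule square_summable_bounded(1))
    fix N
    have "L2_set (\<lambda>n. norm (taylor_coeff f n + c * taylor_coeff g n)) {..<N}
        \<le> L2_set (\<lambda>n. norm (taylor_coeff f n) + norm c * norm (taylor_coeff g n)) {..<N}"
      by (intro L2_set_mono) (auto simp: norm_mult[symmetric] norm_triangle_ineq)
    also have "\<dots> \<le> L2_set (\<lambda>n. norm (taylor_coeff f n)) {..<N} + L2_set (\<lambda>n. norm c * norm (taylor_coeff g n)) {..<N}"
      by (rule L2_set_triangle_ineq)
    also have "\<dots> \<le> sqrt (H2_sqnorm f) + norm c * sqrt (H2_sqnorm g)"
      by (subst L2_set_right_distrib[symmetric])
         (auto intro!: add_mono mult_left_mono L2_set_le_suminf H2D(3) f g simp: H2_sqnorm_def)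
    finally show "L2_set (\<lambda>n. norm (taylor_coeff f n + c * taylor_coeff g n)) {..<N} \<le> \<dots>" .
  qed
  thus ?thesis using assms
    by (auto simp: H2_def taylor_coeff_lin intro!: holomorphic_intros)
qed

lemma H2_diff: "f \<in> H2 \<Longrightarrow> g \<in> H2 \<Longrightarrow> (\<lambda>z. f z - g z) \<in> H2"
  using H2_lin[of f g "-1"] by simp

lemma H2_scale: "g \<in> H2 \<Longrightarrow> (\<lambda>z. c * g z) \<in> H2"
  using H2_lin[OF zero_in_H2, of g c] by simp

lemma H2_inner_summable:
  assumes "f \<in> H2" "g \<in> H2"
  shows "summable (\<lambda>n. taylor_coeff f n * cnj (taylor_coeff g n))"
  by (intro summable_norm_cancel[OF square_summable_mult_cnj] H2D(3) assms)

lemma H2_inner_lin: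
  assumes "f \<in> H2" "g \<in> H2" "h \<in> H2"
  shows "H2_inner (\<lambda>z. f z + c * g z) h = H2_inner f h + c * H2_inner g h"
proof -
  have "H2_inner (\<lambda>z. f z + c * g z) h =
     (\<Sum>n. taylor_coeff f n * cnj (taylor_coeff h n) + c * (taylor_coeff g n * cnj (taylor_coeff h n)))"
    unfolding H2_inner_def using assms by (simp add: taylor_coeff_lin H2D algebra_simps)
  also have "\<dots> = H2_inner f h + c * H2_inner g h"
    unfolding H2_inner_def
    by (subst suminf_add[symmetric]) (auto intro!: summable_mult H2_inner_summable assms simp: suminf_mult H2_inner_summable assms)
  finally show ?thesis .
qed

lemma H2_inner_zero_left [simp]: "H2_inner (\<lambda>z. 0) g = 0"
  by (simp add: H2_inner_def taylor_coeff_zero)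

lemma H2_inner_commute:
  assumes "f \<in> H2" "g \<in> H2"
  shows "H2_inner g f = cnj (H2_inner f g)"
proof -
  have "(\<lambda>n. cnj (taylor_coeff f n * cnj (taylor_coeff g n))) sums cnj (H2_inner f g)"
    unfolding H2_inner_def using assms by (intro sums_cnj[THEN iffD2] summable_sums H2_inner_summable)
  thus ?thesis by (simp add: H2_inner_def sums_iff mult.commute)
qed

lemma H2_inner_diff_left:
  assumes "f \<in> H2" "g \<in> H2" "h \<in> H2"
  shows "H2_inner (\<lambda>z. f z - g z) h = H2_inner f h - H2_inner g h"
  using H2_inner_lin[OF assms, of "-1"] by simp

lemma H2_inner_diff_right:
  assumes "f \<in> H2" "g \<in> H2" "h \<in> H2"
  shows "H2_inner h (\<lambda>z. f z - g z) = H2_inner h f - H2_inner h g"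
  by (simp only: H2_inner_commute[OF H2_diff[OF assms(1,2)] assms(3)] H2_inner_diff_left[OF assms]
      H2_inner_commute[OF assms(1,3)] H2_inner_commute[OF assms(2,3)] complex_cnj_diff)

lemma H2_inner_scale_left:
  assumes "g \<in> H2" "h \<in> H2"
  shows "H2_inner (\<lambda>z. c * g z) h = c * H2_inner g h"
  using H2_inner_lin[OF zero_in_H2 assms, of c] by simp

lemma H2_inner_scale_right:
  assumes "g \<in> H2" "h \<in> H2"
  shows "H2_inner h (\<lambda>z. c * g z) = cnj c * H2_inner h g"
  by (simp only: H2_inner_commute[OF H2_scale[OF assms(1)] assms(2)] H2_inner_scale_left[OF assms]
      H2_inner_commute[OF assms] complex_cnj_mult)

lemma H2_inner_self:
  assumes "f \<in> H2" shows "H2_inner f f = of_real (H2_sqnorm f)"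
proof -
  have "(\<lambda>n. complex_of_real ((norm (taylor_coeff f n))\<^sup>2)) sums of_real (H2_sqnorm f)"
    unfolding H2_sqnorm_def by (intro sums_of_real summable_sums H2D(3) assms)
  hence "(\<lambda>n. taylor_coeff f n * cnj (taylor_coeff f n)) sums of_real (H2_sqnorm f)"
    by (simp only: complex_norm_square)
  thus ?thesis by (simp add: H2_inner_def sums_iff)
qed

lemma norm_H2_inner_le:
  assumes "f \<in> H2" "g \<in> H2"
  shows "norm (H2_inner f g) \<le> sqrt (H2_sqnorm f) * sqrt (H2_sqnorm g)"
  unfolding H2_inner_def H2_sqnorm_def by (intro norm_suminf_mult_cnj_le H2D(3) assms)

lemma H2_sqnorm_nonneg: "f \<in> H2 \<Longrightarrow> H2_sqnorm f \<ge> 0"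
  unfolding H2_sqnorm_def by (intro suminf_nonneg H2D(3)) auto

lemma H2_sqnorm_eq_0:
  assumes f: "f \<in> H2" and z: "H2_sqnorm f = 0"
  shows "f = (\<lambda>z. 0)"
proof (rule H2_eqI[OF f zero_in_H2])
  fix n
  have "(norm (taylor_coeff f n))\<^sup>2 \<le> H2_sqnorm f"
    unfolding H2_sqnorm_def using sum_le_suminf[OF H2D(3)[OF f], of "{n}"] by simp
  thus "taylor_coeff f n = taylor_coeff (\<lambda>z. 0) n" by (simp add: z taylor_coeff_zero)
qed

lemma H2_sqnorm_lin:
  assumes f: "f \<in> H2" and g: "g \<in> H2"
  shows "H2_sqnorm (\<lambda>z. f z + c * g z) = H2_sqnorm f + (norm c)\<^sup>2 * H2_sqnorm g + 2 * Re (cnj c * H2_inner f g)"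
proof -
  note l = H2_lin[OF f g, of c]
  have "complex_of_real (H2_sqnorm (\<lambda>z. f z + c * g z)) = H2_inner f (\<lambda>z. f z + c * g z) + c * H2_inner g (\<lambda>z. f z + c * g z)"
    by (simp add: H2_inner_self[OF l, symmetric] H2_inner_lin[OF f g l])
  also have "\<dots> = cnj (H2_inner f f + c * H2_inner g f) + c * cnj (H2_inner f g + c * H2_inner g g)"
    by (simp only: H2_inner_commute[OF l f] H2_inner_commute[OF l g] H2_inner_lin[OF f g f] H2_inner_lin[OF f g g])
  also have "\<dots> = of_real (H2_sqnorm f) + (c * cnj c) * of_real (H2_sqnorm g)
      + (cnj c * H2_inner f g + cnj (cnj c * H2_inner f g))"
    by (simp add: H2_inner_self f g H2_inner_commute[OF f g] algebra_simps)
  also have "c * cnj c = of_real ((norm c)\<^sup>2)" by (rule complex_norm_square[symmetric])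
  also have "cnj c * H2_inner f g + cnj (cnj c * H2_inner f g) = of_real (2 * Re (cnj c * H2_inner f g))"
    by (rule complex_add_cnj)
  finally show ?thesis
    by (simp only: of_real_add[symmetric] of_real_mult[symmetric] of_real_eq_iff)
qed

subsection \<open>Functions given by square-summable coefficients\<close>

definition H2_of_seq :: "(nat \<Rightarrow> complex) \<Rightarrow> complex \<Rightarrow> complex" where
  "H2_of_seq a z = (if z \<in> disc then \<Sum>n. a n * z ^ n else 0)"

lemma
  assumes a: "square_summable a"
  shows H2_of_seq_in_H2: "H2_of_seq a \<in> H2" and taylor_coeff_H2_of_seq: "taylor_coeff (H2_of_seq a) n = a n"
proof -
  define F where "F = Abs_fps a"
  have sm: "summable (\<lambda>n. a n * z ^ n)" if "norm z < 1" for z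
  proof -
    have "square_summable (\<lambda>n. z ^ n)"
      using that summable_geometric[of "(norm z)\<^sup>2"]
      by (simp add: norm_power power_mult[symmetric] mult.commute abs_square_less_1)
    from summable_norm_cancel[OF square_summable_mult[OF a this]] show ?thesis .
  qed
  have "conv_radius a \<ge> 1"
  proof (rule conv_radius_geI_ex')
    fix r :: real assume "0 < r" "ereal r < 1"
    thus "summable (\<lambda>n. a n * of_real r ^ n)" by (intro sm) auto
  qed
  hence cr: "fps_conv_radius F \<ge> 1" by (simp add: F_def fps_conv_radius_def)
  have eq: "H2_of_seq a z = eval_fps F z" if "z \<in> disc" for z
    using that by (simp add: H2_of_seq_def eval_fps_def F_def)
  have "eval_fps F holomorphic_on disc"
  proof (rule holomorphic_on_eval_fps)
    have "norm z < 1 \<Longrightarrow> ereal (norm z) < fps_conv_radius F" for z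
      using cr by (metis ereal_less(3) less_ereal.simps(1) less_le_trans one_ereal_def)
    thus "disc \<subseteq> eball 0 (fps_conv_radius F)"
      by (auto simp: in_eball_iff)
  qed
  hence holo: "H2_of_seq a holomorphic_on disc"
    using eq by (metis (no_types, lifting) holomorphic_transform)
  have "eval_fps F has_fps_expansion F"
    by (intro eval_fps_has_fps_expansion less_le_trans[OF _ cr]) simp
  hence tc: "taylor_coeff (H2_of_seq a) n = a n" for n
    using taylor_coeff_eqI[of "eval_fps F" F n] taylor_coeff_cong[of "H2_of_seq a" "eval_fps F", OF eq]
    by (simp add: F_def)
  show "H2_of_seq a \<in> H2"
    using a holo by (auto simp: H2_def tc H2_of_seq_def)
  show "taylor_coeff (H2_of_seq a) n = a n" by (rule tc)
qed

subsection \<open>Multiplication operators\<close>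

lemma H2_shift:
  assumes f: "f \<in> H2"
  shows "(\<lambda>z. z * f z) \<in> H2" "H2_sqnorm (\<lambda>z. z * f z) = H2_sqnorm f"
proof -
  have *: "(\<lambda>n. (norm (taylor_coeff (\<lambda>z. z * f z) n))\<^sup>2) sums H2_sqnorm f"
    using sums_Suc[of "\<lambda>n. (norm (taylor_coeff (\<lambda>z. z * f z) n))\<^sup>2"] summable_sums[OF H2D(3)[OF f]]
    by (simp add: taylor_coeff_shift H2D f H2_sqnorm_def)
  thus "(\<lambda>z. z * f z) \<in> H2" using f
    by (auto simp: H2_def sums_iff intro!: holomorphic_intros)
  show "H2_sqnorm (\<lambda>z. z * f z) = H2_sqnorm f" using * by (simp add: H2_sqnorm_def sums_iff)
qed

lemma H2_inner_shift:
  assumes f: "f \<in> H2" and g: "g \<in> H2" and k: "k \<in> H2"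
    and k': "\<And>n. taylor_coeff k n = taylor_coeff g (Suc n)"
  shows "H2_inner (\<lambda>z. z * f z) g = H2_inner f k"
proof -
  have "(\<lambda>n. taylor_coeff (\<lambda>z. z * f z) (Suc n) * cnj (taylor_coeff g (Suc n))) sums H2_inner f k"
    using summable_sums[OF H2_inner_summable[OF f k]]
    by (simp add: taylor_coeff_shift H2D(1) f k' H2_inner_def)
  hence "(\<lambda>n. taylor_coeff (\<lambda>z. z * f z) n * cnj (taylor_coeff g n)) sums H2_inner f k"
    using sums_Suc[of "\<lambda>n. taylor_coeff (\<lambda>z. z * f z) n * cnj (taylor_coeff g n)"]
    by (simp add: taylor_coeff_shift H2D(1) f)
  thus ?thesis by (simp add: H2_inner_def sums_iff)
qed

text \<open>Each coefficient of the quotient is that of \<open>g\<close> plus \<open>cnj a\<close>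
  times the preceding one. Hence the norm \<open>L\<close> of any finite section satisfies
  \<open>L \<le> sqrt (H2_sqnorm g) + norm a * L\<close>, and \<open>norm a < 1\<close> absorbs the
  last term.\<close>

lemma H2_div_Szego:
  assumes g: "g \<in> H2" and a: "a \<in> disc"
  shows "(\<lambda>z. g z / (1 - cnj a * z)) \<in> H2"
proof -
  define k where "k = (\<lambda>z. g z / (1 - cnj a * z))"
  have kh: "k holomorphic_on disc"
    unfolding k_def using one_minus_cnj_mult_nonzero[OF a] H2D(1)[OF g] by (intro holomorphic_intros) auto
  have gk: "g z = k z + (- cnj a) * (z * k z)" if "z \<in> disc" for z
  proof -
    have "g z = (1 - cnj a * z) * k z"
      using one_minus_cnj_mult_nonzero[OF a, of z] that by (simp add: k_def)
    thus ?thesis by (simp add: algebra_simps)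
  qed
  define k' where "k' n = (if n = 0 then 0 else taylor_coeff k (n - 1))" for n
  have kk: "taylor_coeff k n = taylor_coeff g n + cnj a * k' n" for n
  proof -
    have "taylor_coeff g n = taylor_coeff (\<lambda>z. k z + (- cnj a) * (z * k z)) n"
      by (intro taylor_coeff_cong gk)
    also have "\<dots> = taylor_coeff k n - cnj a * k' n"
      using kh by (subst taylor_coeff_lin) (auto intro!: holomorphic_intros simp: taylor_coeff_shift k'_def)
    finally show ?thesis by simp
  qed
  have "square_summable (taylor_coeff k)"
  proof (rule square_summable_bounded(1))
    fix N
    let ?L = "L2_set (\<lambda>n. norm (taylor_coeff k n)) {..<N}"
    have "(\<Sum>n<N. (norm (k' n))\<^sup>2) \<le> (\<Sum>n<N. (norm (taylor_coeff k n))\<^sup>2)"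
    proof (cases N)
      case (Suc M)
      have "(\<Sum>n<N. (norm (k' n))\<^sup>2) = (\<Sum>n<M. (norm (taylor_coeff k n))\<^sup>2)"
        unfolding Suc sum.lessThan_Suc_shift by (simp add: k'_def)
      thus ?thesis by (simp add: Suc)
    qed simp
    hence k'L: "L2_set (\<lambda>n. norm (k' n)) {..<N} \<le> ?L"
      by (simp add: L2_set_def)
    have "?L \<le> L2_set (\<lambda>n. norm (taylor_coeff g n) + norm a * norm (k' n)) {..<N}"
      by (intro L2_set_mono) (auto simp: kk intro: order_trans[OF norm_triangle_ineq] simp: norm_mult)
    also have "\<dots> \<le> L2_set (\<lambda>n. norm (taylor_coeff g n)) {..<N} + L2_set (\<lambda>n. norm a * norm (k' n)) {..<N}"
      by (rule L2_set_triangle_ineq)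
    also have "\<dots> \<le> sqrt (H2_sqnorm g) + norm a * ?L"
      by (subst L2_set_right_distrib[symmetric])
         (auto intro!: add_mono mult_left_mono L2_set_le_suminf H2D(3) g k'L simp: H2_sqnorm_def)
    finally show "?L \<le> sqrt (H2_sqnorm g) / (1 - norm a)"
      using a by (simp add: field_simps)
  qed
  thus ?thesis using kh H2D(2)[OF g] by (auto simp: H2_def k_def[symmetric]) (simp add: k_def)
qed

text \<open>Here the recursion runs upwards: a section of length \<open>N\<close> is bounded through
  the one of length \<open>Suc N\<close>, so nothing can be absorbed before the whole sum is known
  to be finite. Damping the coefficients by \<open>r ^ n\<close> makes it finite, and the resulting
  bound survives \<open>r\<close> tending to 1.\<close>

lemma H2_divide_root:
  assumes f: "f \<in> H2" and a: "a \<in> disc" and fa: "f a = 0"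
  shows "\<exists>g\<in>H2. \<forall>z. f z = (z - a) * g z"
proof -
  define k where "k z = (if z \<in> disc then if z = a then deriv f a else f z / (z - a) else 0)" for z
  have "(\<lambda>z. if z = a then deriv f a else (f z - f a) / (z - a)) holomorphic_on disc"
    by (rule pole_lemma_open) (use H2D(1)[OF f] in auto)
  hence kh: "k holomorphic_on disc"
    by (rule holomorphic_transform) (auto simp: k_def fa)
  have fk: "f z = (z - a) * k z" for z
    using fa H2D(2)[OF f, of z] by (auto simp: k_def)
  have rec: "taylor_coeff f (Suc n) = taylor_coeff k n - a * taylor_coeff k (Suc n)" for n
  proof -
    have "taylor_coeff f (Suc n) = taylor_coeff (\<lambda>z. z * k z + (- a) * k z) (Suc n)"
      by (intro taylor_coeff_cong) (simp add: fk algebra_simps)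
    thus ?thesis using kh
      by (subst (asm) taylor_coeff_lin) (auto intro!: holomorphic_intros simp: taylor_coeff_shift)
  qed
  define C where "C = sqrt (H2_sqnorm f)"
  have main: "L2_set (\<lambda>n. norm (taylor_coeff k n) * r ^ n) {..<N} * (r - norm a) \<le> C"
    if r: "norm a < r" "r < 1" for r N
  proof -
    have r0: "0 < r" using r by (meson le_less_trans norm_ge_zero)
    define b where "b n = norm (taylor_coeff k n) * r ^ n" for n
    have "summable (\<lambda>n. norm (taylor_coeff k n * of_real r ^ n))"
    proof (rule powser_insidea)
      show "summable (\<lambda>n. taylor_coeff k n * of_real ((1 + r) / 2) ^ n)"
        by (rule sums_summable[OF taylor_coeff_sums[OF kh]]) (use r0 r in \<open>auto simp del: of_real_divide\<close>)
    qed (use r0 r in \<open>auto simp del: of_real_divide of_real_add\<close>)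
    hence sb: "summable b" using r0 by (simp add: b_def[abs_def] norm_mult norm_power)
    have b0: "b n \<ge> 0" for n using r0 by (simp add: b_def)
    have "summable (\<lambda>n. (b n)\<^sup>2)"
    proof (rule summable_comparison_test_ev[OF _ sb])
      have "eventually (\<lambda>n. b n < 1) sequentially"
        using summable_LIMSEQ_zero[OF sb] by (rule order_tendstoD) simp
      thus "eventually (\<lambda>n. norm ((b n)\<^sup>2) \<le> b n) sequentially"
        by eventually_elim (use b0 in \<open>simp add: power2_eq_square mult_left_le\<close>)
    qed
    define S where "S = sqrt (\<Sum>n. (b n)\<^sup>2)"
    have lim: "(\<lambda>N. L2_set b {..<N}) \<longlonglongrightarrow> S"
      unfolding L2_set_def S_def using \<open>summable (\<lambda>n. (b n)\<^sup>2)\<close>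
      by (intro tendsto_real_sqrt summable_LIMSEQ)
    have ineq: "r * L2_set b {..<N} \<le> C + norm a * L2_set b {..<Suc N}" for N
    proof -
      have p: "r * b n \<le> norm (taylor_coeff f (Suc n)) + norm a * b (Suc n)" for n
      proof -
        have "taylor_coeff k n = taylor_coeff f (Suc n) + a * taylor_coeff k (Suc n)"
          using rec[of n] by simp
        hence "norm (taylor_coeff k n) \<le> norm (taylor_coeff f (Suc n)) + norm a * norm (taylor_coeff k (Suc n))"
          by (metis norm_mult norm_triangle_ineq)
        hence "r ^ Suc n * norm (taylor_coeff k n) \<le> r ^ Suc n * (norm (taylor_coeff f (Suc n)) + norm a * norm (taylor_coeff k (Suc n)))"
          using r0 by (intro mult_left_mono) auto
        also have "\<dots> \<le> norm (taylor_coeff f (Suc n)) + norm a * b (Suc n)"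
          using mult_right_mono[OF power_le_one[of r "Suc n"], of "norm (taylor_coeff f (Suc n))"] r0 r
          by (simp add: b_def algebra_simps)
        finally show ?thesis by (simp add: b_def mult_ac)
      qed
      have "r * L2_set b {..<N} = L2_set (\<lambda>n. r * b n) {..<N}"
        using r0 by (simp add: L2_set_right_distrib)
      also have "\<dots> \<le> L2_set (\<lambda>n. norm (taylor_coeff f (Suc n)) + norm a * b (Suc n)) {..<N}"
        using p r0 b0 by (intro L2_set_mono) auto
      also have "\<dots> \<le> L2_set (\<lambda>n. norm (taylor_coeff f (Suc n))) {..<N} + L2_set (\<lambda>n. norm a * b (Suc n)) {..<N}"
        by (rule L2_set_triangle_ineq)
      also have "L2_set (\<lambda>n. norm a * b (Suc n)) {..<N} = norm a * L2_set (\<lambda>n. b (Suc n)) {..<N}"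
        by (simp add: L2_set_right_distrib)
      also have "L2_set (\<lambda>n. b (Suc n)) {..<N} \<le> L2_set b {..<Suc N}"
        unfolding L2_set_def sum.lessThan_Suc_shift by (simp add: b0)
      also have "L2_set (\<lambda>n. norm (taylor_coeff f (Suc n))) {..<N} \<le> L2_set (\<lambda>n. norm (taylor_coeff f n)) {..<Suc N}"
        unfolding L2_set_def sum.lessThan_Suc_shift[of _ N] by simp
      also have "\<dots> \<le> C" unfolding C_def H2_sqnorm_def by (intro L2_set_le_suminf H2D(3) f)
      finally show ?thesis by (simp add: mult_left_mono)
    qed
    have "r * S \<le> C + norm a * S"
    proof (rule LIMSEQ_le)
      show "(\<lambda>N. r * L2_set b {..<N}) \<longlonglongrightarrow> r * S" by (intro tendsto_intros lim)
      show "(\<lambda>N. C + norm a * L2_set b {..<Suc N}) \<longlonglongrightarrow> C + norm a * S"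
        by (intro tendsto_intros LIMSEQ_Suc[OF lim])
    qed (use ineq in blast)
    hence "S * (r - norm a) \<le> C" by (simp add: algebra_simps)
    moreover have "L2_set b {..<N} \<le> S"
      unfolding L2_set_def S_def using \<open>summable (\<lambda>n. (b n)\<^sup>2)\<close>
      by (intro real_sqrt_le_mono sum_le_suminf) auto
    ultimately show ?thesis using r mult_right_mono[of "L2_set b {..<N}" S "r - norm a"]
      unfolding b_def by linarith
  qed
  have "square_summable (taylor_coeff k)"
  proof (rule square_summable_bounded(1))
    fix N
    have "L2_set (\<lambda>n. norm (taylor_coeff k n) * 1 ^ n) {..<N} * (1 - norm a) \<le> C"
    proof (rule tendsto_upperbound)
      show "((\<lambda>r. L2_set (\<lambda>n. norm (taylor_coeff k n) * r ^ n) {..<N} * (r - norm a)) \<longlongrightarrow>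
          L2_set (\<lambda>n. norm (taylor_coeff k n) * 1 ^ n) {..<N} * (1 - norm a)) (at_left 1)"
        unfolding L2_set_def by (intro tendsto_intros)
      show "eventually (\<lambda>r. L2_set (\<lambda>n. norm (taylor_coeff k n) * r ^ n) {..<N} * (r - norm a) \<le> C) (at_left 1)"
        using eventually_at_left_real[of "norm a" 1] a by (auto elim!: eventually_mono intro!: main)
    qed auto
    thus "L2_set (\<lambda>n. norm (taylor_coeff k n)) {..<N} \<le> C / (1 - norm a)"
      using a by (simp add: field_simps)
  qed
  hence "k \<in> H2" using kh by (auto simp: H2_def k_def)
  with fk show ?thesis by blast
qed

text \<open>With \<open>k = g / (1 - cnj a * z)\<close> both functions are combinations of
  \<open>k\<close> and \<open>z * k\<close>: the product is \<open>z * k - a * k\<close>, and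
  \<open>g\<close> is \<open>k - cnj a * (z * k)\<close>. The shift is isometric and the cross terms
  are conjugate, so the norms agree.\<close>

lemma H2_blaschke_mult:
  assumes g: "g \<in> H2" and a: "a \<in> disc"
  shows "(\<lambda>z. blaschke_factor a z * g z) \<in> H2"
    "H2_sqnorm (\<lambda>z. blaschke_factor a z * g z) = H2_sqnorm g"
proof -
  define k where "k = (\<lambda>z. g z / (1 - cnj a * z))"
  have k: "k \<in> H2" unfolding k_def by (rule H2_div_Szego[OF g a])
  note zk = H2_shift[OF k]
  have k0: "z \<notin> disc \<Longrightarrow> k z = 0" for z by (rule H2D(2)[OF k])
  have 1: "(\<lambda>z. blaschke_factor a z * g z) = (\<lambda>z. z * k z + (- a) * k z)"
    by (auto simp: blaschke_factor_def k_def fun_eq_iff algebra_simps add_divide_distrib diff_divide_distrib)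
  have 2: "g = (\<lambda>z. k z + (- cnj a) * (z * k z))"
  proof
    fix z
    show "g z = k z + (- cnj a) * (z * k z)"
    proof (cases "z \<in> disc")
      case True
      hence "g z = (1 - cnj a * z) * k z"
        using one_minus_cnj_mult_nonzero[OF a, of z] by (simp add: k_def)
      thus ?thesis by (simp add: algebra_simps)
    qed (simp add: k0 H2D(2)[OF g])
  qed
  show "(\<lambda>z. blaschke_factor a z * g z) \<in> H2" unfolding 1 by (rule H2_lin[OF zk(1) k])
  have "H2_sqnorm g = H2_sqnorm k + (norm a)\<^sup>2 * H2_sqnorm k + 2 * Re (- a * H2_inner k (\<lambda>z. z * k z))"
    by (subst 2, subst H2_sqnorm_lin[OF k zk(1)]) (simp add: zk(2))
  moreover have "H2_sqnorm (\<lambda>z. blaschke_factor a z * g z)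
      = H2_sqnorm k + (norm a)\<^sup>2 * H2_sqnorm k + 2 * Re (- cnj a * H2_inner (\<lambda>z. z * k z) k)"
    unfolding 1 by (subst H2_sqnorm_lin[OF zk(1) k]) (simp add: zk(2))
  moreover have "- cnj a * H2_inner (\<lambda>z. z * k z) k = cnj (- a * H2_inner k (\<lambda>z. z * k z))"
    using H2_inner_commute[OF k zk(1)] by simp
  ultimately show "H2_sqnorm (\<lambda>z. blaschke_factor a z * g z) = H2_sqnorm g" by (simp only: cnj.sel)
qed

text \<open>A bounded sequence that converges coefficientwise converges weakly: beyond some
  \<open>K\<close> the small tail of \<open>f\<close> controls the sum, and the first
  \<open>K\<close> terms converge.\<close>

lemma H2_weak_limit:
  fixes b :: "nat \<Rightarrow> nat \<Rightarrow> complex"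
  assumes f: "square_summable f" and b: "\<And>j. square_summable (b j)" "\<And>j. (\<Sum>n. (norm (b j n))\<^sup>2) \<le> C"
    and lim: "\<And>n. (\<lambda>j. b j n) \<longlonglongrightarrow> f n"
  shows "(\<lambda>j. \<Sum>n. f n * cnj (b j n)) \<longlonglongrightarrow> (\<Sum>n. f n * cnj (f n))"
proof (rule LIMSEQ_I)
  fix e :: real assume e: "e > 0"
  \<comment> \<open>A bound, uniform in \<open>j\<close>, for the norm of
    \<open>b j - f\<close>.\<close>
  define D where "D = sqrt C + sqrt (\<Sum>n. (norm (f n))\<^sup>2)"
  have C0: "C \<ge> 0" using suminf_nonneg[OF b(1)] b(2)[of undefined] by (meson order_trans zero_le_power2)
  have D0: "D \<ge> 0" using suminf_nonneg[OF f] C0 by (auto simp: D_def)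
  have "(\<lambda>K. \<Sum>n. (norm (f (n + K)))\<^sup>2) \<longlonglongrightarrow> 0"
    using suminf_exist_split2[OF f] by simp
  hence "(\<lambda>K. sqrt (\<Sum>n. (norm (f (n + K)))\<^sup>2) * D) \<longlonglongrightarrow> sqrt 0 * D"
    by (intro tendsto_intros)
  hence "eventually (\<lambda>K. sqrt (\<Sum>n. (norm (f (n + K)))\<^sup>2) * D < e / 2) sequentially"
    by (rule order_tendstoD) (use e in simp)
  then obtain K where K: "sqrt (\<Sum>n. (norm (f (n + K)))\<^sup>2) * D < e / 2"
    by (auto simp: eventually_sequentially)
  have "(\<lambda>j. \<Sum>n<K. norm (f n * cnj (b j n - f n))) \<longlonglongrightarrow> (\<Sum>n<K. norm (f n * cnj (f n - f n)))"
    by (intro tendsto_intros lim)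
  hence "eventually (\<lambda>j. (\<Sum>n<K. norm (f n * cnj (b j n - f n))) < e / 2) sequentially"
    by (rule order_tendstoD) (use e in simp)
  then obtain J where J: "\<And>j. j \<ge> J \<Longrightarrow> (\<Sum>n<K. norm (f n * cnj (b j n - f n))) < e / 2"
    by (auto simp: eventually_sequentially)
  show "\<exists>J. \<forall>j\<ge>J. norm ((\<Sum>n. f n * cnj (b j n)) - (\<Sum>n. f n * cnj (f n))) < e"
  proof (intro exI[of _ J] allI impI)
    fix j assume j: "j \<ge> J"
    define d where "d n = b j n - f n" for n
    have dL: "L2_set (\<lambda>n. norm (d n)) {..<N} \<le> D" for N
    proof -
      have "L2_set (\<lambda>n. norm (d n)) {..<N} \<le> L2_set (\<lambda>n. norm (b j n) + norm (f n)) {..<N}"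
        by (intro L2_set_mono) (auto simp: d_def norm_triangle_ineq4)
      also have "\<dots> \<le> L2_set (\<lambda>n. norm (b j n)) {..<N} + L2_set (\<lambda>n. norm (f n)) {..<N}"
        by (rule L2_set_triangle_ineq)
      also have "\<dots> \<le> D" unfolding D_def
        by (intro add_mono L2_set_le_suminf f order_trans[OF L2_set_le_suminf[OF b(1)]] real_sqrt_le_mono b(2))
      finally show ?thesis .
    qed
    note ds = square_summable_bounded[of d, OF dL]
    have sm: "summable (\<lambda>n. f n * cnj (d n))"
      by (intro summable_norm_cancel[OF square_summable_mult_cnj] f ds)
    have dK: "square_summable (\<lambda>n. d (n + K))" using ds(1) by (rule summable_ignore_initial_segment)
    have fK: "square_summable (\<lambda>n. f (n + K))" using f by (rule summable_ignore_initial_segment)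
    have "(\<Sum>n. (norm (d (n + K)))\<^sup>2) \<le> D\<^sup>2"
      using suminf_split_initial_segment[OF ds(1), of K] ds(2) sum_nonneg[of "{..<K}" "\<lambda>n. (norm (d n))\<^sup>2"] by simp
    hence dKD: "sqrt (\<Sum>n. (norm (d (n + K)))\<^sup>2) \<le> D" using D0 by (simp add: real_le_lsqrt)
    have "(\<Sum>n. f n * cnj (b j n)) - (\<Sum>n. f n * cnj (f n)) = (\<Sum>n. f n * cnj (d n))"
      by (subst suminf_diff) (auto simp: d_def algebra_simps
          intro!: summable_norm_cancel[OF square_summable_mult_cnj] f b)
    also have "\<dots> = (\<Sum>n. f (n + K) * cnj (d (n + K))) + (\<Sum>n<K. f n * cnj (d n))"
      by (rule suminf_split_initial_segment[OF sm])
    finally have "norm ((\<Sum>n. f n * cnj (b j n)) - (\<Sum>n. f n * cnj (f n))) \<le>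
       norm (\<Sum>n. f (n + K) * cnj (d (n + K))) + norm (\<Sum>n<K. f n * cnj (d n))"
      by (simp add: norm_triangle_ineq)
    also have "norm (\<Sum>n. f (n + K) * cnj (d (n + K))) \<le> sqrt (\<Sum>n. (norm (f (n + K)))\<^sup>2) * sqrt (\<Sum>n. (norm (d (n + K)))\<^sup>2)"
      by (rule norm_suminf_mult_cnj_le[OF fK dK])
    also have "\<dots> \<le> sqrt (\<Sum>n. (norm (f (n + K)))\<^sup>2) * D"
      by (intro mult_left_mono dKD real_sqrt_ge_zero suminf_nonneg fK) auto
    also have "norm (\<Sum>n<K. f n * cnj (d n)) \<le> (\<Sum>n<K. norm (f n * cnj (d n)))" by (rule norm_sum)
    finally show "norm ((\<Sum>n. f n * cnj (b j n)) - (\<Sum>n. f n * cnj (f n))) < e"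
      using K J[OF j] unfolding d_def by linarith
  qed
qed

subsection \<open>Blaschke products as multipliers\<close>

lemma H2_blaschke_or_one_mult:
  assumes b: "blaschke_or_one b" and g: "g \<in> H2"
  shows "(\<lambda>z. b z * g z) \<in> H2" "H2_sqnorm (\<lambda>z. b z * g z) = H2_sqnorm g"
proof -
  have "(\<lambda>z. b z * g z) \<in> H2 \<and> H2_sqnorm (\<lambda>z. b z * g z) = H2_sqnorm g"
    using b unfolding blaschke_or_one_def
  proof (elim disjE exE conjE)
    fix a c assume a: "a \<in> disc" and c: "norm c = 1" and b: "b = (\<lambda>z. c * blaschke_factor a z)"
    have eq: "(\<lambda>z. b z * g z) = (\<lambda>z. 0 + c * (blaschke_factor a z * g z))"
      by (simp add: b mult.assoc)
    note bg = H2_blaschke_mult[OF g a]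
    have "H2_sqnorm (\<lambda>z. 0 + c * (blaschke_factor a z * g z)) = H2_sqnorm (\<lambda>z. blaschke_factor a z * g z)"
      using c H2_sqnorm_lin[OF zero_in_H2 bg(1), of c] by (simp add: H2_sqnorm_def taylor_coeff_zero)
    thus ?thesis unfolding eq using H2_lin[OF zero_in_H2 bg(1), of c] bg(2) by simp
  qed (simp add: g)
  thus "(\<lambda>z. b z * g z) \<in> H2" "H2_sqnorm (\<lambda>z. b z * g z) = H2_sqnorm g" by auto
qed

lemma H2_prod_mult:
  fixes N :: nat
  assumes b: "\<And>n. blaschke_or_one (\<beta> n)" and g: "g \<in> H2"
  shows "(\<lambda>z. (\<Prod>n<N. \<beta> n z) * g z) \<in> H2 \<and> H2_sqnorm (\<lambda>z. (\<Prod>n<N. \<beta> n z) * g z) = H2_sqnorm g"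
proof (induction N)
  case (Suc N)
  have "(\<lambda>z. (\<Prod>n<Suc N. \<beta> n z) * g z) = (\<lambda>z. \<beta> N z * ((\<Prod>n<N. \<beta> n z) * g z))"
    by (simp add: mult_ac)
  thus ?case using H2_blaschke_or_one_mult[OF b[of N] conjunct1[OF Suc]] Suc by simp
qed (simp add: g)

text \<open>Coefficients at 0 see only a neighbourhood of 0, so uniform convergence on one small
  disc suffices; the radius 1/2 is an arbitrary choice.\<close>

lemma taylor_coeff_limit:
  assumes lim: "uniform_limit (cball 0 (1/2)) u v sequentially"
    and u: "\<And>N. u N holomorphic_on disc" and g: "g holomorphic_on disc"
  shows "(\<lambda>N. taylor_coeff (\<lambda>z. u N z * g z) n) \<longlonglongrightarrow> taylor_coeff (\<lambda>z. v z * g z) n"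
  unfolding taylor_coeff_def
proof (intro tendsto_divide tendsto_const higher_deriv_complex_uniform_limit)
  have "continuous_on (cball 0 (1/2)) g"
    by (rule holomorphic_on_imp_continuous_on, rule holomorphic_on_subset[OF g]) auto
  hence "bounded (g ` cball 0 (1/2))" by (intro compact_imp_bounded compact_continuous_image) auto
  then obtain M where M: "M > 0" "\<And>z. z \<in> cball 0 (1/2) \<Longrightarrow> norm (g z) \<le> M"
    unfolding bounded_pos by blast
  show "uniform_limit (ball 0 (1/2)) (\<lambda>N z. u N z * g z) (\<lambda>z. v z * g z) sequentially"
  proof (rule uniform_limitI)
    fix e :: real assume "e > 0"
    hence "e / M > 0" using M by simp
    from uniform_limitD[OF lim this]
    show "\<forall>\<^sub>F N in sequentially. \<forall>z\<in>ball 0 (1/2). dist (u N z * g z) (v z * g z) < e"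
    proof eventually_elim
      case (elim N)
      show ?case
      proof
        fix z :: complex assume z: "z \<in> ball 0 (1/2)"
        have "dist (u N z * g z) (v z * g z) = dist (u N z) (v z) * norm (g z)"
          by (simp add: dist_norm norm_mult flip: left_diff_distrib)
        also have "\<dots> \<le> dist (u N z) (v z) * M" using M(2)[of z] z by (intro mult_left_mono) auto
        also have "\<dots> < e" using elim z M(1) by (auto simp: field_simps)
        finally show "dist (u N z * g z) (v z * g z) < e" .
      qed
    qed
  qed
  show "eventually (\<lambda>N. (\<lambda>z. u N z * g z) holomorphic_on ball 0 (1/2)) sequentially"
    by (intro always_eventually allI holomorphic_intros holomorphic_on_subset[OF u] holomorphic_on_subset[OF g]) auto
qed auto

text \<open>The bound holds for each finite section of coefficients and is kept in the limit.
  Equality of norms may be lost on the way, but contractivity of the limit multiplier is all that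
  the tails have to provide.\<close>

lemma H2_mult_limit:
  assumes lim: "uniform_limit (cball 0 (1/2)) u v sequentially"
    and u: "\<And>N. u N holomorphic_on disc" and v: "v holomorphic_on disc" and g: "g \<in> H2"
    and ug: "\<And>N. (\<lambda>z. u N z * g z) \<in> H2" "\<And>N. H2_sqnorm (\<lambda>z. u N z * g z) \<le> C"
  shows "(\<lambda>z. v z * g z) \<in> H2" "H2_sqnorm (\<lambda>z. v z * g z) \<le> C"
proof -
  have C: "0 \<le> C" using H2_sqnorm_nonneg[OF ug(1)] ug(2) order_trans by blast
  have L: "L2_set (\<lambda>n. norm (taylor_coeff (\<lambda>z. v z * g z) n)) {..<K} \<le> sqrt C" for K
  proof (rule LIMSEQ_le_const2)
    show "(\<lambda>N. L2_set (\<lambda>n. norm (taylor_coeff (\<lambda>z. u N z * g z) n)) {..<K})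
        \<longlonglongrightarrow> L2_set (\<lambda>n. norm (taylor_coeff (\<lambda>z. v z * g z) n)) {..<K}"
      unfolding L2_set_def
      by (intro tendsto_intros taylor_coeff_limit lim u H2D(1)[OF g])
    have "L2_set (\<lambda>n. norm (taylor_coeff (\<lambda>z. u N z * g z) n)) {..<K} \<le> sqrt C" for N
      using order_trans[OF L2_set_le_suminf[OF H2D(3)[OF ug(1)]] real_sqrt_le_mono[OF ug(2)[unfolded H2_sqnorm_def]]] .
    thus "\<exists>N0. \<forall>N\<ge>N0. L2_set (\<lambda>n. norm (taylor_coeff (\<lambda>z. u N z * g z) n)) {..<K} \<le> sqrt C" by blast
  qed
  note s = square_summable_bounded[OF L]
  show "(\<lambda>z. v z * g z) \<in> H2"
    using s(1) H2D(1,2)[OF g] v by (auto simp: H2_def intro!: holomorphic_intros)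
  show "H2_sqnorm (\<lambda>z. v z * g z) \<le> C" using s(2) C by (simp add: H2_sqnorm_def)
qed

lemma H2_mult_weak_limit:
  assumes lim: "uniform_limit (cball 0 (1/2)) \<tau> (\<lambda>_. 1) sequentially"
    and \<tau>: "\<And>j. \<tau> j holomorphic_on disc" and f: "f \<in> H2"
    and \<tau>f: "\<And>j. (\<lambda>z. \<tau> j z * f z) \<in> H2" "\<And>j. H2_sqnorm (\<lambda>z. \<tau> j z * f z) \<le> C"
  shows "(\<lambda>j. H2_inner f (\<lambda>z. \<tau> j z * f z)) \<longlonglongrightarrow> H2_inner f f"
  unfolding H2_inner_def
proof (rule H2_weak_limit)
  show "(\<lambda>j. taylor_coeff (\<lambda>z. \<tau> j z * f z) n) \<longlonglongrightarrow> taylor_coeff f n" for n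
    using taylor_coeff_limit[OF lim \<tau> H2D(1)[OF f], of n] by simp
qed (use H2D(3)[OF f] H2D(3)[OF \<tau>f(1)] \<tau>f(2) in \<open>auto simp: H2_sqnorm_def\<close>)

lemma H2_divide_blaschke:
  assumes f: "f \<in> H2" and a: "a \<in> disc" and fa: "f a = 0"
  shows "\<exists>g\<in>H2. \<forall>z. f z = blaschke_factor a z * g z"
proof -
  obtain k where k: "k \<in> H2" "\<And>z. f z = (z - a) * k z" using H2_divide_root[OF f a fa] by blast
  have "f z = blaschke_factor a z * (k z + (- cnj a) * (z * k z))" for z
  proof (cases "z \<in> disc")
    case True
    have "(z - a) * k z = (z - a) / (1 - cnj a * z) * ((1 - cnj a * z) * k z)"
      using one_minus_cnj_mult_nonzero[OF a, of z] True by simp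
    also have "(1 - cnj a * z) * k z = k z + (- cnj a) * (z * k z)" by (simp add: algebra_simps)
    finally show ?thesis by (simp add: k(2) blaschke_factor_def)
  qed (use H2D(2)[OF f] H2D(2)[OF k(1)] in auto)
  thus ?thesis
    by (intro bexI[of _ "\<lambda>z. k z + (- cnj a) * (z * k z)"] allI H2_lin H2_shift(1) k(1))
qed

text \<open>Testing the defining property against the difference of two candidates shows uniqueness,
  so the definite description is the backward shift of coefficients.\<close>

lemma shift_adjoint_eq:
  assumes f: "f \<in> H2" and g: "g \<in> H2" and tc: "\<And>n. taylor_coeff g n = taylor_coeff f (Suc n)"
  shows "shift_adjoint f = g"
  unfolding shift_adjoint_def
proof (rule the_equality)
  show ad: "g \<in> H2 \<and> (\<forall>h\<in>H2. H2_inner (shift h) f = H2_inner h g)"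
    using H2_inner_shift[OF _ f g tc] g by (simp add: shift_def)
  fix k assume k: "k \<in> H2 \<and> (\<forall>h\<in>H2. H2_inner (shift h) f = H2_inner h k)"
  define d where "d = (\<lambda>z. k z - g z)"
  have d: "d \<in> H2" using k g by (simp add: d_def H2_diff)
  have "H2_inner d k = H2_inner d g" using k ad d by metis
  hence "H2_inner d d = 0" unfolding d_def using k g H2_inner_diff_right[of k g] d d_def by simp
  hence "H2_sqnorm d = 0" using H2_inner_self[OF d] by simp
  hence "d = (\<lambda>z. 0)" by (rule H2_sqnorm_eq_0[OF d])
  thus "k = g" by (auto simp: d_def fun_eq_iff)
qed

section \<open>Radial boundary values\<close>

lemma HinfD:
  assumes "u \<in> Hinf"
  shows "u holomorphic_on disc" "continuous_on disc u" "\<exists>M>0. \<forall>z\<in>disc. norm (u z) \<le> M"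
proof -
  show 1: "u holomorphic_on disc" using assms by (simp add: Hinf_def)
  show "continuous_on disc u" using 1 by (rule holomorphic_on_imp_continuous_on)
  show "\<exists>M>0. \<forall>z\<in>disc. norm (u z) \<le> M"
    using assms unfolding Hinf_def bounded_pos by auto
qed

lemma radial_in_disc: "0 \<le> r \<Longrightarrow> r < 1 \<Longrightarrow> complex_of_real r * cis t \<in> disc"
  by (simp add: norm_mult)

lemma continuous_on_circle:
  assumes "u \<in> Hinf" "0 \<le> r" "r < 1"
  shows "continuous_on A (\<lambda>t. u (complex_of_real r * cis t))"
  by (rule continuous_on_compose2[OF HinfD(2)[OF assms(1)]])
     (use assms radial_in_disc in \<open>auto intro!: continuous_intros\<close>)

lemma radial_measurable:
  assumes "u \<in> Hinf" "0 \<le> r" "r < 1"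
  shows "(\<lambda>t. u (complex_of_real r * cis t)) \<in> borel_measurable borel"
  by (rule borel_measurable_continuous_onI[OF continuous_on_circle[OF assms]])

lemma boundary_value_eq:
  assumes "((\<lambda>r. u (complex_of_real r * cis t)) \<longlongrightarrow> w) (at_left 1)"
  shows "boundary_value u t = w"
  unfolding boundary_value_def by (rule tendsto_Lim[OF _ assms]) simp

text \<open>The summand 2 keeps \<open>radius 0\<close> positive, as Cauchy's formula on a circle
  requires.\<close>

definition radius :: "nat \<Rightarrow> real" where
  "radius n = 1 - 1 / (real n + 2)"

lemma radius: "0 < radius n" "radius n < 1" and radius_at_left: "filterlim radius (at_left 1) sequentially"
proof -
  show 1: "0 < radius n" "radius n < 1" for n by (simp_all add: radius_def)
  have "radius \<longlonglongrightarrow> 1" unfolding radius_def by real_asymp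
  thus "filterlim radius (at_left 1) sequentially"
    using 1 by (auto simp: filterlim_at less_imp_neq intro!: always_eventually)
qed

text \<open>Existence of the radial limit is a Cauchy condition on rational radii, hence a Borel condition on the angle.\<close>

lemma radial_limit_iff:
  assumes u: "u \<in> Hinf"
  shows "(\<exists>l. ((\<lambda>r. u (complex_of_real r * cis t)) \<longlongrightarrow> l) (at_left 1)) \<longleftrightarrow>
    (\<forall>k::nat. \<exists>m::nat. \<forall>p q::rat. 1 - 1 / real (Suc m) < real_of_rat p \<and> real_of_rat p < 1 \<and>
       1 - 1 / real (Suc m) < real_of_rat q \<and> real_of_rat q < 1 \<longrightarrow>
       dist (u (complex_of_real (real_of_rat p) * cis t)) (u (complex_of_real (real_of_rat q) * cis t)) \<le> 1 / real (Suc k))"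
    (is "?L \<longleftrightarrow> ?R")
proof
  define f where "f r = u (complex_of_real r * cis t)" for r
  assume ?L
  then obtain l where l: "(f \<longlongrightarrow> l) (at_left 1)" by (auto simp: f_def[abs_def])
  show ?R
  proof
    fix k :: nat
    define e where "e = 1 / real (Suc k) / 2"
    have "e > 0" by (simp add: e_def)
    with l have "eventually (\<lambda>r. dist (f r) l < e) (at_left 1)" by (rule tendstoD)
    then obtain b where b: "b < 1" "\<And>r. b < r \<Longrightarrow> r < 1 \<Longrightarrow> dist (f r) l < e"
      unfolding eventually_at_left_field by auto
    obtain m where m: "1 / real (Suc m) < 1 - b" using b(1) nat_approx_posE[of "1 - b"] by auto
    show "\<exists>m::nat. \<forall>p q::rat. 1 - 1 / real (Suc m) < real_of_rat p \<and> real_of_rat p < 1 \<and>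
       1 - 1 / real (Suc m) < real_of_rat q \<and> real_of_rat q < 1 \<longrightarrow>
       dist (u (complex_of_real (real_of_rat p) * cis t)) (u (complex_of_real (real_of_rat q) * cis t)) \<le> 1 / real (Suc k)"
    proof (intro exI[of _ m] allI impI)
      fix p q :: rat
      assume pq: "1 - 1 / real (Suc m) < real_of_rat p \<and> real_of_rat p < 1 \<and>
       1 - 1 / real (Suc m) < real_of_rat q \<and> real_of_rat q < 1"
      have "dist (f (real_of_rat p)) l < e" "dist (f (real_of_rat q)) l < e"
        using pq m by (auto intro!: b(2))
      hence "dist (f (real_of_rat p)) (f (real_of_rat q)) < e + e"
        by (metis add_strict_mono dist_commute dist_triangle le_less_trans)
      thus "dist (u (complex_of_real (real_of_rat p) * cis t)) (u (complex_of_real (real_of_rat q) * cis t)) \<le> 1 / real (Suc k)"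
        unfolding f_def e_def by (simp add: field_simps)
    qed
  qed
next
  define f where "f r = u (complex_of_real r * cis t)" for r
  assume R: ?R
  have cont: "isCont f r" if "0 < r" "r < 1" for r
  proof -
    have "continuous_on {0<..<1} f" unfolding f_def
      by (rule continuous_on_compose2[OF HinfD(2)[OF u]])
         (use radial_in_disc in \<open>auto intro!: continuous_intros\<close>)
    thus ?thesis using that by (simp add: continuous_on_eq_continuous_at)
  qed
  have win: "\<exists>b<1. \<forall>r s. b < r \<and> r < 1 \<and> b < s \<and> s < 1 \<longrightarrow> dist (f r) (f s) \<le> 1 / real (Suc k)" for k
  proof -
    obtain m where m: "\<And>p q. 1 - 1 / real (Suc m) < real_of_rat p \<Longrightarrow> real_of_rat p < 1 \<Longrightarrow>
       1 - 1 / real (Suc m) < real_of_rat q \<Longrightarrow> real_of_rat q < 1 \<Longrightarrow>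
       dist (f (real_of_rat p)) (f (real_of_rat q)) \<le> 1 / real (Suc k)"
      using R unfolding f_def by blast
    define b where "b = 1 - 1 / real (Suc m)"
    have b: "0 \<le> b" "b < 1" by (simp_all add: b_def)
    \<comment> \<open>By continuity an inequality that fails at \<open>r\<close> also fails just to
      the right of \<open>r\<close>, hence at some rational radius.\<close>
    have dense: "dist (f r) c \<le> e"
      if r: "b < r" "r < 1" and c: "\<And>p. b < real_of_rat p \<Longrightarrow> real_of_rat p < 1 \<Longrightarrow> dist (f (real_of_rat p)) c \<le> e" for r c e
    proof (rule ccontr)
      assume "\<not> dist (f r) c \<le> e"
      hence gt: "e < dist (f r) c" by simp
      have "isCont f r" using r b by (intro cont) auto
      hence "(f \<longlongrightarrow> f r) (at_right r)" unfolding isCont_def by (rule filterlim_mono) (auto simp: at_le)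
      hence "((\<lambda>s. dist (f s) c) \<longlongrightarrow> dist (f r) c) (at_right r)" by (intro tendsto_intros)
      hence "eventually (\<lambda>s. e < dist (f s) c) (at_right r)" using gt by (rule order_tendstoD(1))
      then obtain b' where b': "b' > r" "\<And>s. r < s \<Longrightarrow> s < b' \<Longrightarrow> e < dist (f s) c"
        unfolding eventually_at_right_field by auto
      obtain q where q: "r < real_of_rat q" "real_of_rat q < min b' 1"
        using of_rat_dense[of r "min b' 1"] b'(1) r by auto
      thus False using b'(2)[of "real_of_rat q"] c[of q] r by force
    qed
    show ?thesis
    proof (intro exI[of _ b] conjI allI impI)
      fix r s assume rs: "b < r \<and> r < 1 \<and> b < s \<and> s < 1"
      have 1: "dist (f (real_of_rat q)) (f s) \<le> 1 / real (Suc k)" if "b < real_of_rat q" "real_of_rat q < 1" for q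
        using dense[of s "f (real_of_rat q)" "1 / real (Suc k)"] m[of _ q] that rs by (simp add: b_def dist_commute)
      show "dist (f r) (f s) \<le> 1 / real (Suc k)"
        using dense[of r "f s" "1 / real (Suc k)"] 1 rs by blast
    qed (rule b)
  qed
  have small: "\<exists>b<1. \<forall>r s. b < r \<and> r < 1 \<and> b < s \<and> s < 1 \<longrightarrow> dist (f r) (f s) < e" if e: "e > 0" for e
  proof -
    obtain k where "1 / real (Suc k) < e" using nat_approx_posE[OF e] by blast
    thus ?thesis using win[of k] by (meson le_less_trans)
  qed
  have "Cauchy (\<lambda>n. f (radius n))"
  proof (rule metric_CauchyI)
    fix e :: real assume "e > 0"
    then obtain b where b: "b < 1" "\<And>r s. b < r \<Longrightarrow> r < 1 \<Longrightarrow> b < s \<Longrightarrow> s < 1 \<Longrightarrow> dist (f r) (f s) < e"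
      using small by blast
    have "eventually (\<lambda>r. b < r) (at_left 1)" using b(1)
      by (auto simp: eventually_at_left_field)
    hence "eventually (\<lambda>n. b < radius n) sequentially"
      using radius_at_left by (rule eventually_compose_filterlim)
    thus "\<exists>M. \<forall>m\<ge>M. \<forall>n\<ge>M. dist (f (radius m)) (f (radius n)) < e"
      unfolding eventually_sequentially using b(2) radius by meson
  qed
  then obtain l where l: "(\<lambda>n. f (radius n)) \<longlonglongrightarrow> l"
    by (auto simp: Cauchy_convergent_iff convergent_def)
  have "(f \<longlongrightarrow> l) (at_left 1)"
  proof (rule tendstoI)
    fix e :: real assume e: "e > 0"
    then obtain b where b: "b < 1" "\<And>r s. b < r \<Longrightarrow> r < 1 \<Longrightarrow> b < s \<Longrightarrow> s < 1 \<Longrightarrow> dist (f r) (f s) < e / 2"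
      using small[of "e / 2"] by auto
    have "eventually (\<lambda>r. b < r) (at_left 1)" using b(1)
      by (auto simp: eventually_at_left_field)
    hence "eventually (\<lambda>n. b < radius n) sequentially"
      using radius_at_left by (rule eventually_compose_filterlim)
    moreover have "eventually (\<lambda>n. dist (f (radius n)) l < e / 2) sequentially"
      using l e by (intro tendstoD) auto
    ultimately have "eventually (\<lambda>n. b < radius n \<and> dist (f (radius n)) l < e / 2) sequentially"
      by (rule eventually_conj)
    then obtain n where n: "b < radius n" "dist (f (radius n)) l < e / 2"
      by (auto simp: eventually_sequentially)
    have "dist (f r) l < e" if "b < r" "r < 1" for r
      using b(2)[OF that n(1) radius(2)] n(2) dist_triangle[of "f r" l "f (radius n)"] by simp
    thus "eventually (\<lambda>r. dist (f r) l < e) (at_left 1)"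
      unfolding eventually_at_left_field using b(1) by blast
  qed
  thus ?L by (auto simp: f_def[abs_def])
qed

lemma borel_measurable_boundary_value:
  assumes u: "u \<in> Hinf"
  shows "boundary_value u \<in> borel_measurable borel"
proof -
  define E where "E = {t. \<exists>l. ((\<lambda>r. u (complex_of_real r * cis t)) \<longlongrightarrow> l) (at_left 1)}"
  \<comment> \<open>Extended by 0 to all other radii, \<open>g r\<close> is measurable for every
    real \<open>r\<close>, so the condition can range over all rationals.\<close>
  define g where "g r t = (if 0 \<le> r \<and> r < 1 then u (complex_of_real r * cis t) else 0)" for r t
  have [measurable]: "g r \<in> borel_measurable borel" for r
    unfolding g_def using radial_measurable[OF u, of r] by (cases "0 \<le> r \<and> r < 1") auto
  have geq: "u (complex_of_real r * cis t) = g r t" if "1 - 1 / real (Suc m) < r" "r < 1" for r t m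
  proof -
    have "0 \<le> 1 - 1 / real (Suc m)" by simp
    hence "0 \<le> r" using that by linarith
    thus ?thesis using that by (simp add: g_def)
  qed
  have "E = {t. \<forall>k::nat. \<exists>m::nat. \<forall>p q::rat. 1 - 1 / real (Suc m) < real_of_rat p \<and> real_of_rat p < 1 \<and>
       1 - 1 / real (Suc m) < real_of_rat q \<and> real_of_rat q < 1 \<longrightarrow>
       dist (g (real_of_rat p) t) (g (real_of_rat q) t) \<le> 1 / real (Suc k)}"
    unfolding E_def radial_limit_iff[OF u]
    by (intro Collect_cong all_cong1 ex_cong1 imp_cong refl) (metis geq)
  also have "\<dots> = {t \<in> space borel. \<forall>k::nat. \<exists>m::nat. \<forall>p q::rat. 1 - 1 / real (Suc m) < real_of_rat p \<and> real_of_rat p < 1 \<and>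
       1 - 1 / real (Suc m) < real_of_rat q \<and> real_of_rat q < 1 \<longrightarrow>
       dist (g (real_of_rat p) t) (g (real_of_rat q) t) \<le> 1 / real (Suc k)}"
    by simp
  also have "\<dots> \<in> sets borel" by measurable
  finally have E [measurable]: "E \<in> sets borel" .
  \<comment> \<open>Where no radial limit exists, the predicate described by \<open>Lim\<close> is
    false for every value, so \<open>Lim\<close> returns the same unspecified value at all such
    angles. \<open>K\<close> is that value, taken at an arbitrary one of them.\<close>
  define K where "K = Lim (at_left (1::real)) (\<lambda>r. u (complex_of_real r * cis (SOME t. t \<notin> E)))"
  have "boundary_value u = (\<lambda>t. if t \<in> E then lim (\<lambda>n. g (radius n) t) else K)"
  proof
    fix t
    show "boundary_value u t = (if t \<in> E then lim (\<lambda>n. g (radius n) t) else K)"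
    proof (cases "t \<in> E")
      case True
      then obtain l where l: "((\<lambda>r. u (complex_of_real r * cis t)) \<longlongrightarrow> l) (at_left 1)"
        by (auto simp: E_def)
      have "(\<lambda>n. g (radius n) t) \<longlonglongrightarrow> l"
        using filterlim_compose[OF l radius_at_left] radius by (simp add: g_def less_imp_le)
      thus ?thesis using True boundary_value_eq[OF l] by (simp add: limI)
    next
      case False
      have no: "\<not> ((\<lambda>r. u (complex_of_real r * cis s)) \<longlongrightarrow> l) (at_left 1)" if "s \<notin> E" for s l
        using that by (auto simp: E_def)
      have "(SOME t. t \<notin> E) \<notin> E" using False by (rule someI)
      thus ?thesis using False by (simp add: boundary_value_def K_def Topological_Spaces.Lim_def no)
    qed
  qed
  thus ?thesis by simp
qed

lemma circle_mean_value:
  assumes u: "u \<in> Hinf" and r: "0 < r" "r < 1"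
  shows "(LINT t:{0..2 * pi}|lborel. u (complex_of_real r * cis t)) = complex_of_real (2 * pi) * u 0"
proof -
  have sub: "cball 0 r \<subseteq> disc" using r by auto
  have "((\<lambda>w. u w / (w - 0)) has_contour_integral (2 * of_real pi * \<i> * u 0)) (circlepath 0 r)"
    by (rule Cauchy_integral_circlepath_simple) (use r holomorphic_on_subset[OF HinfD(1)[OF u] sub] in auto)
  hence "((\<lambda>t. u (0 + r * cis t) / (0 + r * cis t - 0) * r * \<i> * cis t) has_integral (2 * of_real pi * \<i> * u 0)) {0..2 * pi}"
    unfolding circlepath_def by (subst (asm) has_contour_integral_part_circlepath_iff) auto
  hence "((\<lambda>t. \<i> * u (complex_of_real r * cis t)) has_integral (2 * of_real pi * \<i> * u 0)) {0..2 * pi}"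
    using r by (simp add: mult_ac)
  hence "((\<lambda>t. (- \<i>) * (\<i> * u (complex_of_real r * cis t))) has_integral (- \<i>) * (2 * of_real pi * \<i> * u 0)) {0..2 * pi}"
    by (rule has_integral_mult_right)
  hence hi: "((\<lambda>t. u (complex_of_real r * cis t)) has_integral complex_of_real (2 * pi) * u 0) {0..2 * pi}"
    by (simp add: mult_ac)
  have "set_integrable lborel {0..2 * pi} (\<lambda>t. u (complex_of_real r * cis t))"
    by (rule borel_integrable_atLeastAtMost'[OF continuous_on_circle[OF u]]) (use r in auto)
  from set_borel_integral_eq_integral(2)[OF this] hi show ?thesis
    by (simp add: integral_unique)
qed

text \<open>The mean value property on circles passes to the boundary by dominated convergence along
  \<open>radius\<close>; the bound of \<open>u\<close> is the dominating constant.\<close>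

lemma
  assumes u: "u \<in> Hinf" and lim: "AE t in lborel. t \<in> {0..2 * pi} \<longrightarrow>
     (\<exists>l. ((\<lambda>r. u (complex_of_real r * cis t)) \<longlongrightarrow> l) (at_left 1))"
  shows boundary_value_integrable: "set_integrable lborel {0..2 * pi} (boundary_value u)"
    and boundary_mean_value: "(LINT t:{0..2 * pi}|lborel. boundary_value u t) = complex_of_real (2 * pi) * u 0"
proof -
  obtain M where M: "M > 0" "\<And>z. z \<in> disc \<Longrightarrow> norm (u z) \<le> M" using HinfD(3)[OF u] by blast
  let ?s = "\<lambda>n t. indicator {0..2 * pi} t *\<^sub>R u (complex_of_real (radius n) * cis t)"
  let ?f = "\<lambda>t. indicator {0..2 * pi} t *\<^sub>R boundary_value u t"
  let ?w = "\<lambda>t. indicator {0..2 * pi} t *\<^sub>R M"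
  have [measurable]: "boundary_value u \<in> borel_measurable borel" by (rule borel_measurable_boundary_value[OF u])
  have [measurable]: "(\<lambda>t. u (complex_of_real (radius n) * cis t)) \<in> borel_measurable borel" for n
    by (rule radial_measurable[OF u]) (use radius in \<open>auto intro: less_imp_le\<close>)
  have m1: "?f \<in> borel_measurable lborel" by measurable
  have m2: "?s n \<in> borel_measurable lborel" for n by measurable
  have "set_integrable lborel {0..2 * pi} (\<lambda>t. M)"
    by (rule borel_integrable_atLeastAtMost') (intro continuous_intros)
  hence w: "integrable lborel ?w" by (simp add: set_integrable_def)
  have l: "AE t in lborel. (\<lambda>n. ?s n t) \<longlonglongrightarrow> ?f t"
    using lim
  proof eventually_elim
    case (elim t)
    show ?case
    proof (cases "t \<in> {0..2 * pi}")
      case True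
      then obtain l where l: "((\<lambda>r. u (complex_of_real r * cis t)) \<longlongrightarrow> l) (at_left 1)" using elim by blast
      thus ?thesis using True filterlim_compose[OF l radius_at_left] by (simp add: boundary_value_eq[OF l])
    qed simp
  qed
  have b: "AE t in lborel. norm (?s n t) \<le> ?w t" for n
    using M(2)[OF radial_in_disc[OF less_imp_le[OF radius(1)] radius(2)]] by (auto simp: indicator_def)
  show "set_integrable lborel {0..2 * pi} (boundary_value u)"
    unfolding set_integrable_def by (rule integrable_dominated_convergence[OF m1 m2 w l b])
  have "(\<lambda>n. integral\<^sup>L lborel (?s n)) \<longlonglongrightarrow> integral\<^sup>L lborel ?f"
    by (rule integral_dominated_convergence[OF m1 m2 w l b])
  moreover have "integral\<^sup>L lborel (?s n) = complex_of_real (2 * pi) * u 0" for n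
    using circle_mean_value[OF u radius] by (simp add: set_lebesgue_integral_def)
  ultimately show "(LINT t:{0..2 * pi}|lborel. boundary_value u t) = complex_of_real (2 * pi) * u 0"
    unfolding set_lebesgue_integral_def by (simp add: LIMSEQ_const_iff)
qed

section \<open>The weak-star topologies\<close>

lemma topspace_initial_topology:
  assumes "F \<noteq> {}" shows "topspace (initial_topology X F) = X"
proof -
  obtain f where "f \<in> F" using assms by auto
  hence "X \<in> {{x \<in> X. f x \<in> V} | f V. f \<in> F \<and> open V}"
    by (intro CollectI exI[of _ f] exI[of _ UNIV]) auto
  thus ?thesis unfolding initial_topology_def topology_generated_by_topspace by auto
qed

text \<open>Being eventually inside a set is stable under finite intersections and arbitrary unions,
  so it is enough to look at the generating preimages.\<close>

lemma limitin_initial_topology: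
  assumes F: "F \<noteq> {}" and l: "l \<in> X" and g: "\<And>k. g k \<in> X"
    and conv: "\<And>f. f \<in> F \<Longrightarrow> ((\<lambda>k. f (g k)) \<longlongrightarrow> f l) net"
  shows "limitin (initial_topology X F) g l net"
  unfolding limitin_def
proof (intro conjI allI impI)
  show "l \<in> topspace (initial_topology X F)" by (simp add: topspace_initial_topology[OF F] l)
  fix U assume "openin (initial_topology X F) U \<and> l \<in> U"
  hence "generate_topology_on {{x \<in> X. f x \<in> V} | f V. f \<in> F \<and> open V} U" "l \<in> U"
    by (auto simp: initial_topology_def openin_topology_generated_by_iff)
  thus "eventually (\<lambda>k. g k \<in> U) net"
  proof (induction rule: generate_topology_on.induct)
    case (Int a b)
    thus ?case by (auto intro: eventually_conj)
  next
    case (UN K)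
    then obtain k where "k \<in> K" "l \<in> k" by auto
    with UN.IH[of k] have "eventually (\<lambda>i. g i \<in> k) net" by auto
    thus ?case by (rule eventually_mono) (use \<open>k \<in> K\<close> in auto)
  next
    case (Basis s)
    then obtain f V where s: "s = {x \<in> X. f x \<in> V}" "f \<in> F" "open V" by auto
    with Basis have "f l \<in> V" by auto
    with s(3) conv[OF s(2)] have "eventually (\<lambda>k. f (g k) \<in> V) net" by (auto dest: topological_tendstoD)
    thus ?case by (rule eventually_mono) (use s g in auto)
  qed simp
qed

lemma limitin_initial_topologyD:
  assumes lim: "limitin (initial_topology X F) g l net" and f: "f \<in> F" and l: "l \<in> X"
  shows "((\<lambda>k. f (g k)) \<longlongrightarrow> f l) net"
proof (rule topological_tendstoI)
  fix V :: "complex set" assume V: "open V" "f l \<in> V"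
  have "openin (initial_topology X F) {x \<in> X. f x \<in> V}"
    unfolding initial_topology_def by (rule topology_generated_by_Basis) (use f V in auto)
  hence "eventually (\<lambda>k. g k \<in> {x \<in> X. f x \<in> V}) net"
    using lim V l unfolding limitin_def by blast
  thus "eventually (\<lambda>k. f (g k) \<in> V) net" by (rule eventually_mono) auto
qed

section \<open>Inner functions that tend to 1\<close>

lemma norm_minus_one_square: "norm w = 1 \<Longrightarrow> (norm (w - 1))\<^sup>2 = 2 - 2 * Re w"
proof -
  assume "norm w = 1"
  hence "(Re w)\<^sup>2 + (Im w)\<^sup>2 = 1" using cmod_power2[of w] by simp
  thus ?thesis unfolding cmod_power2[of "w - 1"] by (simp add: power2_eq_square algebra_simps)
qed

text \<open>The \<open>L\<^sup>2\<close> distance on the circle of an inner function \<open>u\<close> from 1 is determined by \<open>u 0\<close>.\<close>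

lemma inner_functions_weak_star_limit:
  assumes inn: "\<And>j. inner_function (\<tau> j)" and lim0: "(\<lambda>j. \<tau> j 0) \<longlonglongrightarrow> 1"
  shows "\<exists>r. strict_mono r \<and> limitin weak_star_Hinf (\<lambda>k. \<tau> (r k)) (\<lambda>z. 1) sequentially"
proof -
  have H: "\<tau> j \<in> Hinf" for j using inn by (simp add: inner_function_def)
  have lim: "AE t in lborel. t \<in> {0..2 * pi} \<longrightarrow> (\<exists>l. ((\<lambda>r. \<tau> j (complex_of_real r * cis t)) \<longlongrightarrow> l) (at_left 1))" for j
    using inn[of j] unfolding inner_function_def by (auto elim!: eventually_mono)
  have nrm: "AE t in lborel. t \<in> {0..2 * pi} \<longrightarrow> norm (boundary_value (\<tau> j) t) = 1" for j
  proof -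
    have "AE t in lborel. t \<in> {0..2 * pi} \<longrightarrow> (\<exists>w. ((\<lambda>r. \<tau> j (complex_of_real r * cis t)) \<longlongrightarrow> w) (at_left 1) \<and> norm w = 1)"
      using inn[of j] unfolding inner_function_def by blast
    thus ?thesis by eventually_elim (auto dest: boundary_value_eq)
  qed
  have meas [measurable]: "boundary_value (\<tau> j) \<in> borel_measurable borel" for j
    by (rule borel_measurable_boundary_value[OF H])
  note int = boundary_value_integrable[OF H lim] and mean = boundary_mean_value[OF H lim]
  \<comment> \<open>For a boundary value of modulus 1 this is its squared distance from 1, in a form
    affine in the boundary value, so that the mean value property computes the integral.\<close>
  define h where "h j t = indicator {0..2 * pi} t *\<^sub>R (2 - 2 * Re (boundary_value (\<tau> j) t))" for j t
  have c2: "set_integrable lborel {0..2 * pi} (\<lambda>t. 2::real)"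
    by (rule borel_integrable_atLeastAtMost') (intro continuous_intros)
  have intRe: "set_integrable lborel {0..2 * pi} (\<lambda>t. 2 * Re (boundary_value (\<tau> j) t))" for j
    using integrable_mult_right[OF integrable_Re[OF int[of j, unfolded set_integrable_def]], of 2]
    unfolding set_integrable_def by (simp add: mult_ac)
  have hint: "integrable lborel (h j)" for j
    unfolding h_def[abs_def] using set_integral_diff(1)[OF c2 intRe[of j]] by (simp add: set_integrable_def)
  have hpos: "AE t in lborel. norm (h j t) = h j t" for j
    using nrm[of j]
  proof eventually_elim
    case (elim t)
    have "Re (boundary_value (\<tau> j) t) \<le> 1" if "t \<in> {0..2 * pi}"
      using elim that complex_Re_le_cmod[of "boundary_value (\<tau> j) t"] by simp
    thus ?case by (auto simp: h_def indicator_def)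
  qed
  have hval: "(\<integral>t. norm (h j t) \<partial>lborel) = 4 * pi - 4 * pi * Re (\<tau> j 0)" for j
  proof -
    have "(\<integral>t. norm (h j t) \<partial>lborel) = (\<integral>t. h j t \<partial>lborel)"
      by (rule integral_cong_AE) (use hint hpos in auto)
    also have "\<dots> = (LINT t:{0..2 * pi}|lborel. (2 - 2 * Re (boundary_value (\<tau> j) t)))"
      by (simp add: h_def[abs_def] set_lebesgue_integral_def)
    also have "\<dots> = (LINT t:{0..2 * pi}|lborel. 2) - (LINT t:{0..2 * pi}|lborel. 2 * Re (boundary_value (\<tau> j) t))"
      by (rule set_integral_diff(2)[OF c2 intRe])
    also have "(LINT t:{0..2 * pi}|lborel. 2 * Re (boundary_value (\<tau> j) t)) = 2 * Re (LINT t:{0..2 * pi}|lborel. boundary_value (\<tau> j) t)"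
      using integral_Re[OF int[of j, unfolded set_integrable_def]]
      by (simp add: set_lebesgue_integral_def flip: integral_mult_right_zero)
    also have "\<dots> = 4 * pi * Re (\<tau> j 0)" unfolding mean by simp
    also have "(LINT t:{0..2 * pi}|lborel. (2::real)) = 4 * pi"
      by (simp add: set_integral_const)
    finally show ?thesis .
  qed
  have "(\<lambda>j. 4 * pi - 4 * pi * Re (\<tau> j 0)) \<longlonglongrightarrow> 4 * pi - 4 * pi * Re 1"
    by (intro tendsto_intros lim0)
  hence "(\<lambda>j. (\<integral>t. norm (h j t) \<partial>lborel)) \<longlonglongrightarrow> 0" unfolding hval by simp
  \<comment> \<open>Convergence in the mean gives convergence almost everywhere along a subsequence,
    which is the origin of \<open>r\<close> in the conclusion.\<close>
  from tendsto_L1_AE_subseq[OF hint this] obtain r where r: "strict_mono r"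
    "AE t in lborel. (\<lambda>k. h (r k) t) \<longlonglongrightarrow> 0" by auto
  have nrm': "AE t in lborel. \<forall>j. t \<in> {0..2 * pi} \<longrightarrow> norm (boundary_value (\<tau> j) t) = 1"
    unfolding AE_all_countable using nrm by blast
  have conv: "AE t in lborel. t \<in> {0..2 * pi} \<longrightarrow> (\<lambda>k. boundary_value (\<tau> (r k)) t) \<longlonglongrightarrow> 1"
    using r(2) nrm'
  proof eventually_elim
    case (elim t)
    show ?case
    proof
      assume t: "t \<in> {0..2 * pi}"
      have "h (r k) t = (norm (boundary_value (\<tau> (r k)) t - 1))\<^sup>2" for k
        using norm_minus_one_square[of "boundary_value (\<tau> (r k)) t"] elim(2) t by (simp add: h_def)
      hence "(\<lambda>k. (norm (boundary_value (\<tau> (r k)) t - 1))\<^sup>2) \<longlonglongrightarrow> 0" using elim(1) by simp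
      hence "(\<lambda>k. sqrt ((norm (boundary_value (\<tau> (r k)) t - 1))\<^sup>2)) \<longlonglongrightarrow> sqrt 0" by (rule tendsto_real_sqrt)
      hence "(\<lambda>k. norm (boundary_value (\<tau> (r k)) t - 1)) \<longlonglongrightarrow> 0" by simp
      thus "(\<lambda>k. boundary_value (\<tau> (r k)) t) \<longlonglongrightarrow> 1"
        by (rule LIM_zero_cancel[OF tendsto_norm_zero_cancel])
    qed
  qed
  have one: "boundary_value (\<lambda>z. 1) t = 1" for t by (rule boundary_value_eq) simp
  have "limitin weak_star_Hinf (\<lambda>k. \<tau> (r k)) (\<lambda>z. 1) sequentially"
    unfolding weak_star_Hinf_def
  proof (rule limitin_initial_topology)
    have "set_integrable lborel {0..2 * pi} (\<lambda>t. 0::complex)" by (simp add: set_integrable_def)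
    thus "{\<lambda>u. LINT t:{0..2 * pi}|lborel. boundary_value u t * g t | g :: real \<Rightarrow> complex.
        set_integrable lborel {0..2 * pi} g} \<noteq> {}" by blast
    show "(\<lambda>z. 1) \<in> Hinf" by (auto simp: Hinf_def image_constant_conv)
    fix f assume "f \<in> {\<lambda>u. LINT t:{0..2 * pi}|lborel. boundary_value u t * g t | g :: real \<Rightarrow> complex.
        set_integrable lborel {0..2 * pi} g}"
    then obtain g :: "real \<Rightarrow> complex" where f: "f = (\<lambda>u. LINT t:{0..2 * pi}|lborel. boundary_value u t * g t)"
      and g: "set_integrable lborel {0..2 * pi} g" by blast
    let ?G = "\<lambda>t. indicator {0..2 * pi} t *\<^sub>R g t"
    have G: "integrable lborel ?G" using g by (simp add: set_integrable_def)
    have Gm [measurable]: "?G \<in> borel_measurable borel" using borel_measurable_integrable[OF G] by simp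
    have "(\<lambda>k. \<integral>t. boundary_value (\<tau> (r k)) t * ?G t \<partial>lborel) \<longlonglongrightarrow> (\<integral>t. ?G t \<partial>lborel)"
    proof (rule integral_dominated_convergence[where w = "\<lambda>t. norm (?G t)"])
      show "?G \<in> borel_measurable lborel" using Gm by simp
      show "(\<lambda>t. boundary_value (\<tau> (r k)) t * ?G t) \<in> borel_measurable lborel" for k by measurable
      show "integrable lborel (\<lambda>t. norm (?G t))" by (rule integrable_norm[OF G])
      show "AE t in lborel. (\<lambda>k. boundary_value (\<tau> (r k)) t * ?G t) \<longlonglongrightarrow> ?G t"
        using conv
      proof eventually_elim
        case (elim t)
        show ?case
        proof (cases "t \<in> {0..2 * pi}")
          case True
          hence "(\<lambda>k. boundary_value (\<tau> (r k)) t * ?G t) \<longlonglongrightarrow> 1 * ?G t"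
            using elim by (intro tendsto_mult tendsto_const) auto
          thus ?thesis by simp
        qed simp
      qed
      show "AE t in lborel. norm (boundary_value (\<tau> (r k)) t * ?G t) \<le> norm (?G t)" for k
        using nrm[of "r k"] by eventually_elim (auto simp: indicator_def norm_mult)
    qed
    thus "(\<lambda>k. f (\<tau> (r k))) \<longlonglongrightarrow> f (\<lambda>z. 1)"
      unfolding f one set_lebesgue_integral_def by (simp add: mult_ac)
  qed (rule H)
  with r(1) show ?thesis by blast
qed

text \<open>Sequences with a single nonzero term turn the weak-star functionals into matrix
  coefficients.\<close>

lemma weak_star_operators_limitD:
  assumes lim: "limitin weak_star_operators A L net" and L: "bounded_clinear L"
  shows "((\<lambda>k. cinner (A k h) g) \<longlongrightarrow> cinner (L h) g) net"
proof -
  define x where "x n = (if n = 0 then h else 0)" for n :: nat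
  define y where "y n = (if n = 0 then g else 0)" for n :: nat
  have "summable (\<lambda>n. (norm (x n))\<^sup>2)" "summable (\<lambda>n. (norm (y n))\<^sup>2)"
    by (rule summable_finite[of "{0}"]; simp add: x_def y_def)+
  hence mem: "(\<lambda>A. \<Sum>n. cinner (A (x n)) (y n)) \<in> {\<lambda>A. \<Sum>n. cinner (A (x n)) (y n) | x y :: nat \<Rightarrow> 'a.
        summable (\<lambda>n. (norm (x n))\<^sup>2) \<and> summable (\<lambda>n. (norm (y n))\<^sup>2)}" by blast
  have y0: "cinner z (y n) = 0" if "n \<noteq> 0" for n z
    using that cinner_commute[of z "y n"] by (simp add: y_def)
  have "(\<Sum>n. cinner (B (x n)) (y n)) = cinner (B h) g" for B
    by (subst suminf_finite[of "{0}"]) (simp_all add: y0, simp add: x_def y_def)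
  with limitin_initial_topologyD[OF lim[unfolded weak_star_operators_def] mem] L show ?thesis by simp
qed

section \<open>Bounded holomorphic functions of an operator\<close>

lemma HinfI:
  assumes "u holomorphic_on disc" "\<And>z. z \<in> disc \<Longrightarrow> norm (u z) \<le> M"
  shows "u \<in> Hinf"
  unfolding Hinf_def bounded_iff using assms by (intro CollectI conjI exI[of _ M]) auto

lemma Hinf_const: "(\<lambda>z. c) \<in> Hinf"
  by (rule HinfI[of _ "norm c"]) auto

lemma Hinf_id: "(\<lambda>z. z) \<in> Hinf"
  by (rule HinfI[of _ 1]) auto

lemma Hinf_mult:
  assumes u: "u \<in> Hinf" and v: "v \<in> Hinf"
  shows "(\<lambda>z. u z * v z) \<in> Hinf"
proof -
  obtain M N where b: "M > 0" "\<And>z. z \<in> disc \<Longrightarrow> norm (u z) \<le> M" "N > 0" "\<And>z. z \<in> disc \<Longrightarrow> norm (v z) \<le> N"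
    using HinfD(3)[OF u] HinfD(3)[OF v] by blast
  show ?thesis
  proof (rule HinfI)
    show "(\<lambda>z. u z * v z) holomorphic_on disc" by (intro holomorphic_on_mult HinfD(1) u v)
    show "norm (u z * v z) \<le> M * N" if "z \<in> disc" for z
      unfolding norm_mult using b(1,3) by (intro mult_mono b(2,4) that) auto
  qed
qed

lemma Hinf_add:
  assumes u: "u \<in> Hinf" and v: "v \<in> Hinf"
  shows "(\<lambda>z. u z + v z) \<in> Hinf"
proof -
  obtain M N where b: "M > 0" "\<And>z. z \<in> disc \<Longrightarrow> norm (u z) \<le> M" "N > 0" "\<And>z. z \<in> disc \<Longrightarrow> norm (v z) \<le> N"
    using HinfD(3)[OF u] HinfD(3)[OF v] by blast
  show ?thesis
  proof (rule HinfI)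
    show "(\<lambda>z. u z + v z) holomorphic_on disc" by (intro holomorphic_on_add HinfD(1) u v)
    show "norm (u z + v z) \<le> M + N" if "z \<in> disc" for z
      by (intro norm_triangle_mono b(2,4) that)
  qed
qed

lemma Hinf_lin: "u \<in> Hinf \<Longrightarrow> v \<in> Hinf \<Longrightarrow> (\<lambda>z. u z + c * v z) \<in> Hinf"
  by (intro Hinf_add Hinf_mult Hinf_const)

lemma Hinf_blaschke: "a \<in> disc \<Longrightarrow> blaschke_factor a \<in> Hinf"
  by (rule HinfI[of _ 1]) (auto intro!: blaschke_holomorphic_disc norm_blaschke_le)

lemma Hinf_Szego:
  assumes a: "a \<in> disc" shows "(\<lambda>z. 1 / (1 - cnj a * z)) \<in> Hinf"
proof (rule HinfI[of _ "1 / (1 - norm a)"])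
  show "(\<lambda>z. 1 / (1 - cnj a * z)) holomorphic_on disc"
    using one_minus_cnj_mult_nonzero[OF a] by (intro holomorphic_intros) auto
  fix z :: complex assume z: "z \<in> disc"
  have "norm (cnj a * z) \<le> norm a * 1" unfolding norm_mult using z by (intro mult_mono) auto
  hence "1 - norm a \<le> norm (1 - cnj a * z)" using norm_triangle_ineq2[of 1 "cnj a * z"] by simp
  thus "norm (1 / (1 - cnj a * z)) \<le> 1 / (1 - norm a)"
    using a by (simp add: norm_divide frac_le)
qed

lemma blaschke_or_one_props:
  assumes "blaschke_or_one b"
  shows "b \<in> Hinf" "z \<in> disc \<Longrightarrow> norm (b z) \<le> 1"
  using assms unfolding blaschke_or_one_def
  by (auto simp: norm_mult norm_blaschke_le intro!: Hinf_const Hinf_mult Hinf_blaschke)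

lemma adj_lin:
  assumes A: "bounded_clinear A" and B: "bounded_clinear B" and C: "bounded_clinear C"
    and eq: "\<And>h. C h = A h + c *\<^sub>C B h"
  shows "adj C h = adj A h + cnj c *\<^sub>C adj B h"
  by (rule adj_eqI[OF C])
     (simp add: eq cinner_add_left cinner_add_right cinner_scaleC_left cinner_scaleC_right adj_right[OF A] adj_right[OF B])

section \<open>The functional calculus and its adjoints\<close>

locale functional_calculus =
  fixes T :: "'a::complex_hilbert \<Rightarrow> 'a" and \<Phi> :: "(complex \<Rightarrow> complex) \<Rightarrow> 'a \<Rightarrow> 'a"
  assumes calculus: "is_functional_calculus T \<Phi>"
begin

lemma bcl: "u \<in> Hinf \<Longrightarrow> bounded_clinear (\<Phi> u)"
  using calculus unfolding is_functional_calculus_def by blast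

lemma Phi_mult: "u \<in> Hinf \<Longrightarrow> v \<in> Hinf \<Longrightarrow> \<Phi> (\<lambda>z. u z * v z) = \<Phi> u \<circ> \<Phi> v"
  using calculus unfolding is_functional_calculus_def by blast

lemma Phi_add: "u \<in> Hinf \<Longrightarrow> v \<in> Hinf \<Longrightarrow> \<Phi> (\<lambda>z. u z + v z) = (\<lambda>x. \<Phi> u x + \<Phi> v x)"
  using calculus unfolding is_functional_calculus_def by blast

lemma Phi_scale: "u \<in> Hinf \<Longrightarrow> \<Phi> (\<lambda>z. c * u z) = (\<lambda>x. c *\<^sub>C \<Phi> u x)"
  using calculus unfolding is_functional_calculus_def by blast

lemma Phi_lin: "u \<in> Hinf \<Longrightarrow> v \<in> Hinf \<Longrightarrow> \<Phi> (\<lambda>z. u z + c * v z) h = \<Phi> u h + c *\<^sub>C \<Phi> v h"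
  by (simp add: Phi_add Phi_scale Hinf_mult Hinf_const)

lemma Phi_one: "\<Phi> (\<lambda>z. 1) = (\<lambda>h. h)"
proof -
  have "\<Phi> (poly [:1:]) = poly_operator [:1:] T"
    using calculus unfolding is_functional_calculus_def by blast
  moreover have "poly [:1:] = (\<lambda>z::complex. 1)" by auto
  ultimately show ?thesis by (auto simp: poly_operator_def fun_eq_iff)
qed

lemma Phi_id: "\<Phi> (\<lambda>z. z) = T"
proof -
  have "\<Phi> (poly [:0, 1:]) = poly_operator [:0, 1:] T"
    using calculus unfolding is_functional_calculus_def by blast
  moreover have "poly [:0, 1:] = (\<lambda>z::complex. z)" by auto
  ultimately show ?thesis by (auto simp: poly_operator_def fun_eq_iff)
qed

lemma Phi_bound:
  assumes u: "u \<in> Hinf" and M: "\<And>z. z \<in> disc \<Longrightarrow> norm (u z) \<le> M"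
  shows "norm (\<Phi> u h) \<le> M * norm h"
proof -
  have "Hinf_norm u \<le> M" unfolding Hinf_norm_def by (rule cSUP_least) (auto intro: M)
  moreover have "onorm (\<Phi> u) \<le> Hinf_norm u"
    using calculus u unfolding is_functional_calculus_def by blast
  moreover have "norm (\<Phi> u h) \<le> onorm (\<Phi> u) * norm h"
    by (rule onorm[OF bounded_clinearD(1)[OF bcl[OF u]]])
  ultimately show ?thesis by (meson mult_right_mono norm_ge_zero order_trans)
qed

lemma Phi_contraction:
  assumes "u \<in> Hinf" "\<And>z. z \<in> disc \<Longrightarrow> norm (u z) \<le> 1"
  shows "norm (\<Phi> u h) \<le> norm h"
  using Phi_bound[OF assms] by simp

text \<open>The difference has sup norm 0 on the disc and the calculus is contractive, so the
  arbitrary values off the disc have no influence.\<close>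

lemma Phi_cong:
  assumes u: "u \<in> Hinf" and v: "v \<in> Hinf" and eq: "\<And>z. z \<in> disc \<Longrightarrow> u z = v z"
  shows "\<Phi> u = \<Phi> v"
proof
  fix h
  have "norm (\<Phi> (\<lambda>z. u z + (-1) * v z) h) \<le> 0 * norm h"
    by (rule Phi_bound) (auto simp: eq intro!: Hinf_lin[of u v "-1", simplified] u v)
  thus "\<Phi> u h = \<Phi> v h" using Phi_lin[OF u v, of "-1" h] by simp
qed

lemma bcl_T: "bounded_clinear T"
  using bcl[OF Hinf_id] by (simp add: Phi_id)

lemma norm_T_le: "norm (T h) \<le> norm h"
  using Phi_contraction[OF Hinf_id, of h] by (simp add: Phi_id)

lemma adj_Phi_mult:
  assumes "u \<in> Hinf" "v \<in> Hinf"
  shows "adj (\<Phi> (\<lambda>z. u z * v z)) h = adj (\<Phi> v) (adj (\<Phi> u) h)"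
    "adj (\<Phi> (\<lambda>z. u z * v z)) h = adj (\<Phi> u) (adj (\<Phi> v) h)"
proof -
  have 1: "adj (\<Phi> (\<lambda>z. u z * v z)) h = adj (\<Phi> v) (adj (\<Phi> u) h)" if "u \<in> Hinf" "v \<in> Hinf" for u v
    using that by (simp add: Phi_mult adj_comp bcl)
  show "adj (\<Phi> (\<lambda>z. u z * v z)) h = adj (\<Phi> v) (adj (\<Phi> u) h)" by (rule 1[OF assms])
  show "adj (\<Phi> (\<lambda>z. u z * v z)) h = adj (\<Phi> u) (adj (\<Phi> v) h)"
    using 1[OF assms(2,1)] by (simp add: mult.commute)
qed

lemma adj_Phi_lin:
  assumes "u \<in> Hinf" "v \<in> Hinf"
  shows "adj (\<Phi> (\<lambda>z. u z + c * v z)) h = adj (\<Phi> u) h + cnj c *\<^sub>C adj (\<Phi> v) h"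
  using assms by (intro adj_lin bcl Hinf_lin Phi_lin)

lemma adj_Phi_one: "adj (\<Phi> (\<lambda>z. 1)) h = h"
  by (rule adj_eqI[OF bcl[OF Hinf_const]]) (simp add: Phi_one)

lemma adj_Phi_scale:
  assumes "u \<in> Hinf"
  shows "adj (\<Phi> (\<lambda>z. c * u z)) h = cnj c *\<^sub>C adj (\<Phi> u) h"
  by (rule adj_eqI[OF bcl[OF Hinf_mult[OF Hinf_const assms]]])
     (simp add: Phi_scale assms cinner_scaleC_left cinner_scaleC_right adj_right[OF bcl[OF assms]])

text \<open>The adjoint of \<open>z - a = b\<^sub>a(z) (1 - \<open>cnj a\<close> z)\<close> evaluated at \<open>T\<close>.\<close>

lemma adj_Phi_blaschke:
  assumes a: "a \<in> disc"
  defines "k \<equiv> adj (\<Phi> (blaschke_factor a))"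
  shows "adj T h - cnj a *\<^sub>C h = k h - a *\<^sub>C adj T (k h)"
    "adj T h - cnj a *\<^sub>C h = k (h - a *\<^sub>C adj T h)"
proof -
  note b = Hinf_blaschke[OF a]
  have q: "(\<lambda>z. 1 + (- cnj a) * z) \<in> Hinf" using Hinf_lin[OF Hinf_const Hinf_id, of 1 "- cnj a"] by simp
  have zm: "(\<lambda>z. z + (- a) * 1) \<in> Hinf" by (rule Hinf_lin[OF Hinf_id Hinf_const])
  have eq: "\<Phi> (\<lambda>z. z + (- a) * 1) = \<Phi> (\<lambda>z. blaschke_factor a z * (1 + (- cnj a) * z))"
    using one_minus_cnj_mult_nonzero[OF a]
    by (intro Phi_cong zm Hinf_mult b q) (auto simp: blaschke_factor_def)
  have l: "adj T h - cnj a *\<^sub>C h = adj (\<Phi> (\<lambda>z. z + (- a) * 1)) h"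
    by (simp only: adj_Phi_lin[OF Hinf_id Hinf_const] adj_Phi_one Phi_id) simp
  have r: "adj (\<Phi> (\<lambda>z. 1 + (- cnj a) * z)) y = y - a *\<^sub>C adj T y" for y
    by (simp only: adj_Phi_lin[OF Hinf_const Hinf_id] adj_Phi_one Phi_id) simp
  show "adj T h - cnj a *\<^sub>C h = k h - a *\<^sub>C adj T (k h)"
    unfolding l eq k_def adj_Phi_mult(1)[OF b q] r ..
  show "adj T h - cnj a *\<^sub>C h = k (h - a *\<^sub>C adj T h)"
    unfolding l eq k_def adj_Phi_mult(2)[OF b q] r ..
qed

text \<open>\<open>z - a\<close> and the Blaschke factor differ by \<open>1 - cnj a * z\<close>,
  whose reciprocal is in \<open>Hinf\<close>, so each is a multiple of the other.\<close>

lemma adj_Phi_blaschke_eq_0_iff: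
  assumes a: "a \<in> disc"
  shows "adj (\<Phi> (blaschke_factor a)) h = 0 \<longleftrightarrow> adj T h = cnj a *\<^sub>C h"
proof
  assume "adj (\<Phi> (blaschke_factor a)) h = 0"
  thus "adj T h = cnj a *\<^sub>C h"
    using adj_Phi_blaschke(1)[OF a, of h] bounded_clinearD(5)[OF bounded_clinear_adj[OF bcl_T]] by simp
next
  assume h: "adj T h = cnj a *\<^sub>C h"
  have zm: "(\<lambda>z. z + (- a) * 1) \<in> Hinf" by (rule Hinf_lin[OF Hinf_id Hinf_const])
  have eq: "\<Phi> (blaschke_factor a) = \<Phi> (\<lambda>z. (z + (- a) * 1) * (1 / (1 - cnj a * z)))"
    by (intro Phi_cong Hinf_mult zm Hinf_Szego Hinf_blaschke a) (simp add: blaschke_factor_def)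
  have l: "adj (\<Phi> (\<lambda>z. z + (- a) * 1)) h = adj T h - cnj a *\<^sub>C h"
    by (simp only: adj_Phi_lin[OF Hinf_id Hinf_const] adj_Phi_one Phi_id) simp
  show "adj (\<Phi> (blaschke_factor a)) h = 0"
    unfolding eq adj_Phi_mult(1)[OF zm Hinf_Szego[OF a]] l h
    using bounded_clinearD(5)[OF bounded_clinear_adj[OF bcl[OF Hinf_Szego[OF a]]]] by simp
qed

lemma adj_T_commute:
  assumes u: "u \<in> Hinf"
  shows "adj (\<Phi> u) (adj T h) = adj T (adj (\<Phi> u) h)"
  using adj_Phi_mult[OF u Hinf_id, of h] by (simp add: Phi_id)

text \<open>\<open>u - u \<mu>\<close> is divisible in \<open>Hinf\<close> by the Blaschke factor at
  \<open>\<mu>\<close>, and the adjoint of that factor kills \<open>x\<close>.\<close>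

lemma cinner_Phi_eigenvector:
  assumes \<mu>: "\<mu> \<in> disc" and x: "adj T x = cnj \<mu> *\<^sub>C x" and u: "u \<in> Hinf"
  shows "cinner (\<Phi> u h) x = u \<mu> * cinner h x"
proof -
  obtain M where M: "\<And>z. z \<in> disc \<Longrightarrow> norm (u z) \<le> M" using HinfD(3)[OF u] by blast
  have "\<exists>\<sigma>. \<sigma> holomorphic_on disc \<and> (\<forall>z\<in>disc. norm (\<sigma> z) \<le> M + M) \<and>
    (\<forall>z\<in>disc. u z - u \<mu> = blaschke_factor \<mu> z * \<sigma> z)"
  proof (rule Blaschke_division[OF _ _ \<mu>])
    show "(\<lambda>z. u z - u \<mu>) holomorphic_on disc" by (intro holomorphic_on_diff HinfD(1) u holomorphic_on_const)
    show "norm (u z - u \<mu>) \<le> M + M" if "z \<in> disc" for z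
      using norm_triangle_ineq4[of "u z" "u \<mu>"] M[OF that] M[OF \<mu>] by linarith
  qed simp
  then obtain v where v: "v holomorphic_on disc" "\<And>z. z \<in> disc \<Longrightarrow> norm (v z) \<le> M + M"
    "\<And>z. z \<in> disc \<Longrightarrow> u z - u \<mu> = blaschke_factor \<mu> z * v z" by blast
  have vH: "v \<in> Hinf" by (rule HinfI[OF v(1,2)])
  note b = Hinf_blaschke[OF \<mu>]
  have "\<Phi> u = \<Phi> (\<lambda>z. blaschke_factor \<mu> z * v z + u \<mu> * 1)"
    by (intro Phi_cong u Hinf_lin Hinf_mult b vH Hinf_const) (simp add: v(3)[symmetric])
  hence "\<Phi> u h = \<Phi> (blaschke_factor \<mu>) (\<Phi> v h) + u \<mu> *\<^sub>C h"
    by (simp only: Phi_lin[OF Hinf_mult[OF b vH] Hinf_const] Phi_mult[OF b vH] Phi_one o_def)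
  moreover have "cinner (\<Phi> (blaschke_factor \<mu>) (\<Phi> v h)) x = 0"
    using x by (simp add: adj_right[OF bcl[OF b]] adj_Phi_blaschke_eq_0_iff[OF \<mu>, THEN iffD2])
  ultimately show ?thesis by (simp add: cinner_add_left cinner_scaleC_left)
qed

text \<open>Schur's algorithm: \<open>\<phi> - \<phi>(\<mu>) = b\<^sub>\<mu> \<sigma> (1 - \<open>cnj (\<phi> \<mu>)\<close> \<phi>)\<close> with \<open>\<sigma>\<close> contractive,
  and the norms of the two sides at \<open>x\<close> leave no room for a loss in \<open>\<sigma>(T)\<close> or \<open>b\<^sub>\<mu>(T)\<close>.\<close>

lemma defect_of_norm_attaining:
  assumes \<mu>: "\<mu> \<in> disc" and x: "adj T x = cnj \<mu> *\<^sub>C x" and nx: "norm x = 1"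
    and \<phi>: "\<phi> \<in> Hinf" "\<And>z. z \<in> disc \<Longrightarrow> norm (\<phi> z) \<le> 1" and nh: "norm (\<Phi> \<phi> x) = 1"
  defines "B \<equiv> \<Phi> (blaschke_factor \<mu>)" and "h \<equiv> \<Phi> \<phi> x"
  shows "B (adj B h) + cinner h x *\<^sub>C x = h"
proof -
  note b = Hinf_blaschke[OF \<mu>]
  have B: "bounded_clinear B" unfolding B_def by (rule bcl[OF b])
  note B' = bounded_clinear_adj[OF B]
  have Bx: "adj B x = 0" unfolding B_def using x by (simp add: adj_Phi_blaschke_eq_0_iff[OF \<mu>])
  have Bc: "norm (B y) \<le> norm y" for y
    unfolding B_def by (rule Phi_contraction[OF b]) (rule norm_blaschke_le[OF \<mu>])
  define c where "c = \<phi> \<mu>"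
  have xx: "cinner x x = 1" using nx by (simp add: cinner_self)
  have hx: "cinner h x = c"
    unfolding h_def c_def cinner_Phi_eigenvector[OF \<mu> x \<phi>(1)] xx by simp
  have xh: "cinner x h = cnj c" using hx cinner_commute[of x h] by simp
  have cc: "Re (cnj c * c) = (norm c)\<^sup>2"
    using complex_norm_square[of c] by (metis Re_complex_of_real mult.commute)
  have n1: "(norm (h - c *\<^sub>C x))\<^sup>2 = 1 - (norm c)\<^sup>2"
    using norm_add_square[of h "- (c *\<^sub>C x)"] nh nx cc
    by (simp add: h_def[symmetric] cinner.minus_right cinner_scaleC_right hx norm_scaleC)
  show ?thesis
  proof (cases "norm c < 1")
    case True
    obtain \<sigma> where \<sigma>: "\<sigma> holomorphic_on disc" "\<And>z. z \<in> disc \<Longrightarrow> norm (\<sigma> z) \<le> 1"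
      "\<And>z. z \<in> disc \<Longrightarrow> \<phi> z - c = blaschke_factor \<mu> z * (\<sigma> z * (1 - cnj c * \<phi> z))"
      using Schwarz_Pick_division[OF HinfD(1)[OF \<phi>(1)] \<phi>(2) \<mu>] True unfolding c_def by blast
    have s: "\<sigma> \<in> Hinf" by (rule HinfI[OF \<sigma>(1,2)])
    have q: "(\<lambda>z. 1 + (- cnj c) * \<phi> z) \<in> Hinf" by (rule Hinf_lin[OF Hinf_const \<phi>(1)])
    \<comment> \<open>\<open>w\<close> is \<open>1 - cnj c * \<phi>\<close> evaluated at
      \<open>T\<close> and applied to \<open>x\<close>, so the division formula reads
      \<open>h - c *\<^sub>C x = B (\<Phi> \<sigma> w)\<close>. Both \<open>w\<close> and
      \<open>h - c *\<^sub>C x\<close> have squared norm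
      \<open>1 - (norm c)\<^sup>2\<close>.\<close>
    define w where "w = x - cnj c *\<^sub>C h"
    define y where "y = \<Phi> \<sigma> w"
    have "\<Phi> (\<lambda>z. \<phi> z + (- c) * 1) = \<Phi> (\<lambda>z. blaschke_factor \<mu> z * (\<sigma> z * (1 + (- cnj c) * \<phi> z)))"
      by (intro Phi_cong Hinf_lin Hinf_mult b s q \<phi>(1) Hinf_const) (simp add: \<sigma>(3)[symmetric])
    hence "\<Phi> (\<lambda>z. \<phi> z + (- c) * 1) x = B (\<Phi> \<sigma> (\<Phi> (\<lambda>z. 1 + (- cnj c) * \<phi> z) x))"
      by (simp only: Phi_mult[OF b Hinf_mult[OF s q]] Phi_mult[OF s q] B_def o_def)
    hence By: "h - c *\<^sub>C x = B y"
      by (simp only: Phi_lin[OF \<phi>(1) Hinf_const] Phi_lin[OF Hinf_const \<phi>(1)] Phi_one y_def w_def h_def) simp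
    have "(norm w)\<^sup>2 = 1 - (norm c)\<^sup>2"
      using norm_add_square[of x "- (cnj c *\<^sub>C h)"] nh nx cc
      by (simp add: h_def[symmetric] w_def cinner.minus_right cinner_scaleC_right xh norm_scaleC mult.commute)
    hence "norm w = norm (B y)" using n1 By by (metis power2_eq_iff_nonneg norm_ge_zero)
    moreover have "norm y \<le> norm w" unfolding y_def by (rule Phi_contraction[OF s \<sigma>(2)])
    ultimately have "norm (B y) = norm y" using Bc[of y] by simp
    hence "adj B (B y) = y" by (rule adj_app_norm_preserving[OF B Bc])
    moreover have hy: "h = B y + c *\<^sub>C x" by (simp add: By[symmetric])
    ultimately have "adj B h = y" by (simp add: bounded_clinearD[OF B'] Bx)
    thus ?thesis unfolding hx by (simp only: hy[symmetric])
  next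
    case False
    hence "1 \<le> (norm c)\<^sup>2" by (intro one_le_power) simp
    moreover have "0 \<le> (norm (h - c *\<^sub>C x))\<^sup>2" by simp
    ultimately have "(norm (h - c *\<^sub>C x))\<^sup>2 = 0" using n1 by linarith
    hence "h = c *\<^sub>C x" by simp
    thus ?thesis using hx by (simp add: bounded_clinearD[OF B'] bounded_clinearD[OF B] Bx)
  qed
qed

end

section \<open>The model of a norm-attaining operator\<close>

text \<open>Testing with 1 and \<open>\<i>\<close> recovers both parts; this is the last step of the
  polarisation in \<open>H2_inner_U\<close>.\<close>

lemma complex_eqI_Re_mult_cnj:
  assumes "\<And>c. Re (cnj c * u) = Re (cnj c * v)"
  shows "u = v"
  using assms[of 1] assms[of \<i>] by (simp add: complex_eq_iff)

text \<open>\<open>\<theta>\<close> and \<open>\<psi>\<close> share the factors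
  \<open>\<beta>\<close> and the tails \<open>\<tau>\<close>, and \<open>\<theta>\<close> has one
  Blaschke factor more. All that boundary values contribute is condensed into \<open>weak\<close>,
  along a subsequence \<open>s\<close>.\<close>

locale norm_attaining_model = functional_calculus T \<Phi>
  for T :: "'a::complex_hilbert \<Rightarrow> 'a" and \<Phi> +
  fixes \<mu> c c' :: complex and \<beta> \<tau> :: "nat \<Rightarrow> complex \<Rightarrow> complex" and \<theta> \<psi> :: "complex \<Rightarrow> complex"
    and x :: 'a and s :: "nat \<Rightarrow> nat"
  assumes cyclic: "multiplicity_free T"
    and mu: "\<mu> \<in> disc" and beta: "\<And>n. blaschke_or_one (\<beta> n)"
    and tau_holo: "\<And>j. \<tau> j holomorphic_on disc" and tau_le: "\<And>j z. z \<in> disc \<Longrightarrow> norm (\<tau> j z) \<le> 1"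
    and tau_lim: "\<And>j. uniform_limit (cball 0 (1/2)) (\<lambda>N z. \<Prod>n<N. \<beta> (n + j) z) (\<tau> j) sequentially"
    and tau_one: "uniform_limit (cball 0 (1/2)) \<tau> (\<lambda>_. 1) sequentially"
    and theta: "\<And>z j. z \<in> disc \<Longrightarrow> \<theta> z = c * blaschke_factor \<mu> z * (\<Prod>n<j. \<beta> n z) * \<tau> j z"
    and psi: "\<And>z j. z \<in> disc \<Longrightarrow> \<psi> z = c' * (\<Prod>n<j. \<beta> n z) * \<tau> j z"
    and c: "norm c = 1" "norm c' = 1"
    and theta_zero: "\<Phi> \<theta> = (\<lambda>h. 0)"
    and x_norm: "norm x = 1" and x_eig: "adj T x = cnj \<mu> *\<^sub>C x" and psi_x: "norm (\<Phi> \<psi> x) = 1"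
    and weak: "\<And>h g. (\<lambda>k. cinner (\<Phi> (\<tau> (s k)) h) g) \<longlonglongrightarrow> cinner h g"
begin

section \<open>Partial products and the kernels of their adjoints\<close>

definition F :: "nat \<Rightarrow> complex \<Rightarrow> complex" where "F j z = (\<Prod>n<j. \<beta> n z)"
definition G :: "nat \<Rightarrow> complex \<Rightarrow> complex" where "G j z = blaschke_factor \<mu> z * F j z"

definition V :: "nat \<Rightarrow> 'a set" where "V j = {h. adj (\<Phi> (G j)) h = 0}"

abbreviation B :: "'a \<Rightarrow> 'a" where "B \<equiv> \<Phi> (blaschke_factor \<mu>)"
abbreviation Ts :: "'a \<Rightarrow> 'a" where "Ts \<equiv> adj T"

lemma beta_Hinf: "\<beta> n \<in> Hinf" and beta_le: "z \<in> disc \<Longrightarrow> norm (\<beta> n z) \<le> 1"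
  using blaschke_or_one_props[OF beta] by auto

lemma F_Suc: "F (Suc j) = (\<lambda>z. F j z * \<beta> j z)"
  by (simp add: F_def fun_eq_iff)

lemma G_Suc: "G (Suc j) = (\<lambda>z. G j z * \<beta> j z)"
  by (simp add: G_def F_Suc fun_eq_iff)

lemma F_0: "F 0 = (\<lambda>z. 1)" by (simp add: F_def fun_eq_iff)
lemma G_0: "G 0 = blaschke_factor \<mu>" by (simp add: G_def F_def fun_eq_iff)

lemma F_Hinf: "F j \<in> Hinf"
  by (induction j) (simp_all add: F_0 F_Suc Hinf_const Hinf_mult beta_Hinf)

lemma F_le: "z \<in> disc \<Longrightarrow> norm (F j z) \<le> 1"
  unfolding F_def prod_norm[symmetric] by (intro prod_le_1) (auto intro!: beta_le)

lemma b_Hinf: "blaschke_factor \<mu> \<in> Hinf" by (rule Hinf_blaschke[OF mu])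

lemma G_Hinf: "G j \<in> Hinf"
  unfolding G_def by (rule Hinf_mult[OF b_Hinf F_Hinf])

lemma tau_Hinf: "\<tau> j \<in> Hinf" by (rule HinfI[OF tau_holo tau_le])

lemmas F_contraction = Phi_contraction[OF F_Hinf F_le]
lemmas tau_contraction = Phi_contraction[OF tau_Hinf tau_le]
lemmas beta_contraction = Phi_contraction[OF beta_Hinf beta_le]

lemma theta_holo: "\<theta> holomorphic_on disc"
proof (rule holomorphic_transform)
  show "(\<lambda>z. c * (blaschke_factor \<mu> z * \<tau> 0 z)) holomorphic_on disc"
    by (intro holomorphic_on_mult holomorphic_on_const HinfD(1) b_Hinf tau_Hinf)
qed (simp add: theta[of _ 0])

lemma theta_Hinf: "\<theta> \<in> Hinf"
proof (rule HinfI[OF theta_holo])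
  fix z assume z: "z \<in> disc"
  show "norm (\<theta> z) \<le> 1 * 1"
    unfolding theta[OF z, of 0]
    using mult_mono[OF norm_blaschke_le[OF mu z] tau_le[OF z, of 0]] c by (simp add: norm_mult)
qed

lemma psi_Hinf: "\<psi> \<in> Hinf"
proof (rule HinfI)
  show "\<psi> holomorphic_on disc"
  proof (rule holomorphic_transform)
    show "(\<lambda>z. c' * \<tau> 0 z) holomorphic_on disc"
      by (intro holomorphic_on_mult holomorphic_on_const tau_holo)
  qed (simp add: psi[of _ 0])
  show "norm (\<psi> z) \<le> 1" if "z \<in> disc" for z
    unfolding psi[OF that, of 0] using c tau_le[OF that] by (simp add: norm_mult)
qed

text \<open>\<open>\<Phi> \<psi> x\<close> arises from \<open>\<Phi> (F j) x\<close> by the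
  contraction \<open>\<Phi> (\<tau> j)\<close> and a unimodular constant, so norm lost at
  \<open>F j\<close> could not be regained.\<close>

lemma norm_F_x: "norm (\<Phi> (F j) x) = 1"
proof (rule antisym)
  show "norm (\<Phi> (F j) x) \<le> 1" using F_contraction[where j = j and h = x] by (simp add: x_norm)
  have "\<Phi> \<psi> = \<Phi> (\<lambda>z. c' * (\<tau> j z * F j z))"
    by (intro Phi_cong psi_Hinf Hinf_mult Hinf_const tau_Hinf F_Hinf) (simp add: psi[of _ j] F_def)
  hence "\<Phi> \<psi> x = c' *\<^sub>C \<Phi> (\<tau> j) (\<Phi> (F j) x)"
    by (simp add: Phi_scale[OF Hinf_mult[OF tau_Hinf F_Hinf]] Phi_mult[OF tau_Hinf F_Hinf])
  hence "1 = norm (\<Phi> (\<tau> j) (\<Phi> (F j) x))"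
    using psi_x c by (simp add: norm_scaleC)
  thus "1 \<le> norm (\<Phi> (F j) x)" using tau_contraction[where j = j and h = "\<Phi> (F j) x"] by simp
qed

lemma B_x: "adj B x = 0"
  using x_eig by (simp add: adj_Phi_blaschke_eq_0_iff[OF mu])

lemma x_nonzero: "x \<noteq> 0" using x_norm by auto

lemma eigenvector_x: "Ts h = cnj \<mu> *\<^sub>C h \<Longrightarrow> \<exists>d. h = d *\<^sub>C x"
  by (rule cyclic_adj_eigenvector[OF cyclic bcl_T _ x_eig x_nonzero])

text \<open>This eigenvector marks the direction gained with the factor \<open>\<beta> j\<close>.
  The partial product loses no norm on \<open>y = \<Phi> (\<beta> j) x\<close>, so \<open>g\<close>
  reduces to \<open>adj B y\<close>. If that vanished, \<open>y\<close> would be a unimodular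
  multiple of \<open>x\<close>, whereas the multiple is \<open>\<beta> j \<mu>\<close>, of modulus
  below 1. The adjoint of \<open>\<Phi> (\<beta> j)\<close> takes \<open>y\<close> back to
  \<open>x\<close>, which \<open>adj B\<close> kills; hence the eigenvalue.\<close>

lemma blaschke_step:
  assumes j: "\<beta> j = (\<lambda>z. d * blaschke_factor a z)" and a: "a \<in> disc" and d: "norm d = 1"
  defines "g \<equiv> adj (\<Phi> (G j)) (\<Phi> (F (Suc j)) x)"
  shows "g \<noteq> 0" "Ts g = cnj a *\<^sub>C g"
proof -
  define y where "y = \<Phi> (\<beta> j) x"
  have FS: "\<Phi> (F (Suc j)) x = \<Phi> (F j) y"
    by (simp add: F_Suc Phi_mult[OF F_Hinf beta_Hinf] y_def)
  have ny: "norm y = 1"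
  proof (rule antisym)
    show "norm y \<le> 1" unfolding y_def using beta_contraction[where n = j and h = x] by (simp add: x_norm)
    show "1 \<le> norm y" using F_contraction[where j = j and h = y] norm_F_x[of "Suc j"] by (simp add: FS)
  qed
  have "adj (\<Phi> (F j)) (\<Phi> (F j) y) = y"
    by (rule adj_app_norm_preserving[OF bcl[OF F_Hinf] F_contraction]) (simp_all add: ny FS[symmetric] norm_F_x)
  hence g: "g = adj B y"
    unfolding g_def FS G_def by (simp add: adj_Phi_mult(2)[OF b_Hinf F_Hinf])
  show "g \<noteq> 0"
  proof
    assume "g = 0"
    hence "Ts y = cnj \<mu> *\<^sub>C y" by (simp add: g adj_Phi_blaschke_eq_0_iff[OF mu])
    then obtain e where e: "y = e *\<^sub>C x" using eigenvector_x by blast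
    have xx: "cinner x x = 1" by (simp add: cinner_self x_norm)
    have "norm e = 1" using ny by (simp add: e norm_scaleC x_norm)
    moreover have "cinner y x = \<beta> j \<mu>"
      unfolding y_def cinner_Phi_eigenvector[OF mu x_eig beta_Hinf] xx by simp
    hence "e = \<beta> j \<mu>" by (simp add: e cinner_scaleC_left xx)
    moreover have "norm (\<beta> j \<mu>) < 1" using norm_blaschke_less[OF a mu] d by (simp add: j norm_mult)
    ultimately show False by simp
  qed
  have "adj (\<Phi> (\<beta> j)) y = x"
    unfolding y_def
    by (rule adj_app_norm_preserving[OF bcl[OF beta_Hinf] beta_contraction]) (simp_all add: ny[unfolded y_def] x_norm)
  hence "adj (\<Phi> (\<beta> j)) g = 0"
    unfolding g using adj_Phi_mult[OF b_Hinf beta_Hinf, of j y] B_x by simp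
  hence "cnj d *\<^sub>C adj (\<Phi> (blaschke_factor a)) g = 0"
    unfolding j by (simp add: adj_Phi_scale[OF Hinf_blaschke[OF a]])
  hence "adj (\<Phi> (blaschke_factor a)) g = 0" using d by auto
  thus "Ts g = cnj a *\<^sub>C g" by (simp add: adj_Phi_blaschke_eq_0_iff[OF a])
qed

lemma V_Suc_factor:
  assumes h: "h \<in> V (Suc j)" and j: "\<beta> j = (\<lambda>z. d * blaschke_factor a z)" and a: "a \<in> disc" and d: "norm d = 1"
  shows "Ts (adj (\<Phi> (G j)) h) = cnj a *\<^sub>C adj (\<Phi> (G j)) h"
proof -
  have "adj (\<Phi> (\<beta> j)) (adj (\<Phi> (G j)) h) = 0"
    using h by (simp add: V_def G_Suc adj_Phi_mult(1)[OF G_Hinf beta_Hinf])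
  hence "cnj d *\<^sub>C adj (\<Phi> (blaschke_factor a)) (adj (\<Phi> (G j)) h) = 0"
    unfolding j by (simp add: adj_Phi_scale[OF Hinf_blaschke[OF a]])
  hence "adj (\<Phi> (blaschke_factor a)) (adj (\<Phi> (G j)) h) = 0" using d by auto
  thus ?thesis by (simp add: adj_Phi_blaschke_eq_0_iff[OF a])
qed

text \<open>For \<open>h\<close> in \<open>V (Suc j)\<close> the vector
  \<open>adj (\<Phi> (G j)) h\<close> lies on the line spanned by the eigenvector of
  \<open>blaschke_step\<close>; subtracting the matching multiple of
  \<open>\<Phi> (F (Suc j)) x\<close> from \<open>h\<close> lands in \<open>V j\<close>. Repeated
  roots make no difference.\<close>

lemma V_subset:
  assumes P: "complex_vs.subspace P" and F: "\<And>j. \<Phi> (F j) x \<in> P"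
  shows "V j \<subseteq> P"
proof (induction j)
  case 0
  show ?case
  proof
    fix h assume "h \<in> V 0"
    hence "Ts h = cnj \<mu> *\<^sub>C h" by (simp add: V_def G_0 adj_Phi_blaschke_eq_0_iff[OF mu])
    then obtain d where "h = d *\<^sub>C x" using eigenvector_x by blast
    moreover have "x \<in> P" using F[of 0] by (simp add: F_0 Phi_one)
    ultimately show "h \<in> P" using complex_vs.subspace_scale[OF P] by simp
  qed
next
  case (Suc j)
  show ?case
    using beta[of j] unfolding blaschke_or_one_def
  proof (elim disjE exE conjE)
    assume "\<beta> j = (\<lambda>z. 1)"
    thus ?thesis using Suc by (simp add: V_def G_Suc)
  next
    fix a d assume a: "a \<in> disc" and d: "norm d = 1" and j: "\<beta> j = (\<lambda>z. d * blaschke_factor a z)"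
    note step = blaschke_step[OF j a d]
    note A = bounded_clinear_adj[OF bcl[OF G_Hinf[of j]]]
    show ?thesis
    proof
      fix h assume h: "h \<in> V (Suc j)"
      obtain e where e: "adj (\<Phi> (G j)) h = e *\<^sub>C adj (\<Phi> (G j)) (\<Phi> (F (Suc j)) x)"
        using cyclic_adj_eigenvector[OF cyclic bcl_T V_Suc_factor[OF h j a d] step(2,1)] by blast
      have "h - e *\<^sub>C \<Phi> (F (Suc j)) x \<in> V j"
        unfolding V_def by (simp add: bounded_clinearD[OF A] e)
      hence "h - e *\<^sub>C \<Phi> (F (Suc j)) x \<in> P" using Suc by blast
      hence "(h - e *\<^sub>C \<Phi> (F (Suc j)) x) + e *\<^sub>C \<Phi> (F (Suc j)) x \<in> P"
        by (intro complex_vs.subspace_add[OF P] complex_vs.subspace_scale[OF P] F)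
      thus "h \<in> P" by simp
    qed
  qed
qed

text \<open>\<open>\<tau> j(T)\<^sup>*\<close> maps into \<open>V j\<close> because \<open>\<theta>(T) = 0\<close>, and tends weakly to the identity.\<close>

lemma V_dense:
  assumes cl: "closed P" and P: "complex_vs.subspace P" and V: "\<And>j. V j \<subseteq> P"
  shows "h \<in> P"
proof -
  have "P = UNIV"
  proof (rule ccontr)
    assume "P \<noteq> UNIV"
    then obtain g where g: "g \<noteq> 0" "\<And>y. y \<in> P \<Longrightarrow> cinner g y = 0"
      using exists_orthogonal[OF cl P] by blast
    have tV: "adj (\<Phi> (\<tau> j)) g \<in> V j" for j
    proof -
      have "\<Phi> (\<lambda>z. c * (\<tau> j z * G j z)) = \<Phi> \<theta>"
        by (intro Phi_cong theta_Hinf Hinf_mult Hinf_const tau_Hinf G_Hinf) (simp add: theta[of _ j] G_def F_def mult_ac)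
      hence "c *\<^sub>C \<Phi> (\<lambda>z. \<tau> j z * G j z) y = 0" for y
        by (simp add: Phi_scale[OF Hinf_mult[OF tau_Hinf G_Hinf]] theta_zero fun_eq_iff del: complex_vs.scale_eq_0_iff)
      moreover have "c \<noteq> 0" using c by auto
      ultimately have z: "\<Phi> (\<lambda>z. \<tau> j z * G j z) y = 0" for y by (simp only: complex_vs.scale_eq_0_iff) simp
      have "adj (\<Phi> (\<lambda>z. \<tau> j z * G j z)) g = 0"
        by (rule adj_eqI[OF bcl[OF Hinf_mult[OF tau_Hinf G_Hinf]]]) (simp add: z)
      thus ?thesis by (simp add: V_def adj_Phi_mult(1)[OF tau_Hinf G_Hinf])
    qed
    have "cinner (\<Phi> (\<tau> (s k)) g) g = 0" for k
    proof -
      have "cinner (\<Phi> (\<tau> (s k)) g) g = cinner g (adj (\<Phi> (\<tau> (s k))) g)"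
        by (rule adj_right[OF bcl[OF tau_Hinf]])
      also have "\<dots> = 0" using tV V g(2) by blast
      finally show ?thesis .
    qed
    with weak[of g g] have "cinner g g = 0" by (simp add: LIMSEQ_const_iff)
    with g(1) show False by (simp add: cinner_self_eq_0)
  qed
  thus ?thesis by simp
qed

lemma F_x_dense:
  assumes "closed P" "complex_vs.subspace P" "\<And>j. \<Phi> (F j) x \<in> P"
  shows "h \<in> P"
  by (rule V_dense[OF assms(1,2) V_subset[OF assms(2,3)]])

section \<open>The rank-one defect of the Blaschke factor\<close>

lemmas bcl_B = bcl[OF b_Hinf] and bcl_Bs = bounded_clinear_adj[OF bcl[OF b_Hinf]]
  and bcl_Ts = bounded_clinear_adj[OF bcl_T]

text \<open>Both sides are continuous and linear in \<open>h\<close>, so the identity spreads from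
  the vectors \<open>\<Phi> (F j) x\<close> to their closed span.\<close>

lemma defect_B: "B (adj B h) + cinner h x *\<^sub>C x = h"
proof -
  define P where "P = {h. B (adj B h) + cinner h x *\<^sub>C x = h}"
  have "h \<in> P"
  proof (rule F_x_dense)
    have 1: "bounded_linear (\<lambda>h. B (adj B h))"
      using bounded_linear_compose[OF bounded_clinearD(1)[OF bcl_B] bounded_clinearD(1)[OF bcl_Bs]] .
    have sc: "continuous_on UNIV (\<lambda>h. cinner h x *\<^sub>C x)"
    proof (rule linear_continuous_on, rule bounded_linear_intro[where K = "norm x * norm x"])
      show "norm (cinner y x *\<^sub>C x) \<le> norm y * (norm x * norm x)" for y
        using mult_right_mono[OF norm_cinner_le[of y x], of "norm x"] by (simp add: norm_scaleC mult.assoc)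
    qed (simp_all add: cinner_add_left scaleC_add_left cinner_scaleC_left scaleC_scaleC flip: scaleC_of_real)
    show "closed P" unfolding P_def
      by (intro closed_Collect_eq continuous_on_add linear_continuous_on[OF 1] sc continuous_on_id)
    show "complex_vs.subspace P" unfolding complex_vs.subspace_def P_def
    proof (intro conjI ballI allI)
      fix u v assume u: "u \<in> {h. B (adj B h) + cinner h x *\<^sub>C x = h}" and v: "v \<in> {h. B (adj B h) + cinner h x *\<^sub>C x = h}"
      have "B (adj B (u + v)) + cinner (u + v) x *\<^sub>C x = (B (adj B u) + cinner u x *\<^sub>C x) + (B (adj B v) + cinner v x *\<^sub>C x)"
        by (simp add: bounded_clinearD[OF bcl_B] bounded_clinearD[OF bcl_Bs] cinner_add_left scaleC_add_left)
      thus "u + v \<in> {h. B (adj B h) + cinner h x *\<^sub>C x = h}" using u v by simp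
    next
      fix d u assume u: "u \<in> {h. B (adj B h) + cinner h x *\<^sub>C x = h}"
      have "B (adj B (d *\<^sub>C u)) + cinner (d *\<^sub>C u) x *\<^sub>C x = d *\<^sub>C (B (adj B u) + cinner u x *\<^sub>C x)"
        by (simp add: bounded_clinearD[OF bcl_B] bounded_clinearD[OF bcl_Bs] cinner_scaleC_left scaleC_add_right scaleC_scaleC)
      thus "d *\<^sub>C u \<in> {h. B (adj B h) + cinner h x *\<^sub>C x = h}" using u by simp
    qed (simp add: bounded_clinearD[OF bcl_B] bounded_clinearD[OF bcl_Bs])
    show "\<Phi> (F j) x \<in> P" for j
      unfolding P_def using defect_of_norm_attaining[OF mu x_eig x_norm F_Hinf F_le norm_F_x] by simp
  qed
  thus ?thesis by (simp add: P_def)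
qed

section \<open>Strong convergence of the powers of the adjoint to 0\<close>

lemma norm_Ts_le: "norm (Ts h) \<le> norm h"
  by (rule norm_adj_le[OF bcl_T norm_T_le])

lemma norm_Ts_pow_le: "norm ((Ts ^^ n) h) \<le> norm h"
  by (induction n) (auto intro: order_trans[OF norm_Ts_le])

lemma Ts_pow_add: "(Ts ^^ n) (u + v) = (Ts ^^ n) u + (Ts ^^ n) v"
  by (induction n) (simp_all add: bounded_clinearD[OF bcl_Ts])

lemma Ts_pow_scale: "(Ts ^^ n) (d *\<^sub>C u) = d *\<^sub>C (Ts ^^ n) u"
  by (induction n) (simp_all add: bounded_clinearD[OF bcl_Ts])

text \<open>The norms of \<open>(Ts ^^ n) h\<close> decrease to some \<open>l\<close>, and up to a
  null sequence each is at most \<open>norm a\<close> times its predecessor; hence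
  \<open>l \<le> norm a * l\<close>.\<close>

lemma Ts_pow_tendsto_0_step:
  assumes a: "a \<in> disc" and g: "(\<lambda>n. (Ts ^^ n) (Ts h - cnj a *\<^sub>C h)) \<longlonglongrightarrow> 0"
  shows "(\<lambda>n. (Ts ^^ n) h) \<longlonglongrightarrow> 0"
proof -
  define u where "u n = norm ((Ts ^^ n) h)" for n
  define v where "v n = norm ((Ts ^^ n) (Ts h - cnj a *\<^sub>C h))" for n
  have v0: "v \<longlonglongrightarrow> 0" unfolding v_def using g tendsto_norm_zero by blast
  have dec: "decseq u" unfolding decseq_Suc_iff u_def by (simp add: norm_Ts_le)
  have "u n \<ge> 0" for n by (simp add: u_def)
  then obtain l where l: "u \<longlonglongrightarrow> l" using decseq_convergent[OF dec, of 0] by blast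
  have step: "u (Suc n) \<le> norm a * u n + v n" for n
  proof -
    have "(Ts ^^ Suc n) h = (Ts ^^ n) (cnj a *\<^sub>C h + (Ts h - cnj a *\<^sub>C h))"
      by (simp add: funpow_swap1)
    also have "\<dots> = cnj a *\<^sub>C (Ts ^^ n) h + (Ts ^^ n) (Ts h - cnj a *\<^sub>C h)"
      by (simp only: Ts_pow_add Ts_pow_scale)
    finally have "norm ((Ts ^^ Suc n) h) \<le> norm (cnj a *\<^sub>C (Ts ^^ n) h) + norm ((Ts ^^ n) (Ts h - cnj a *\<^sub>C h))"
      by (simp only: norm_triangle_ineq)
    thus ?thesis by (simp only: u_def v_def norm_scaleC complex_mod_cnj)
  qed
  have "l \<le> norm a * l + 0"
    by (rule LIMSEQ_le[OF LIMSEQ_Suc[OF l] tendsto_add[OF tendsto_mult[OF tendsto_const l] v0]]) (use step in blast)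
  moreover have "l \<ge> 0" by (rule LIMSEQ_le_const[OF l]) (simp add: u_def)
  ultimately have "l = 0" using a mult_less_cancel_right1[of "norm a" l] by (cases "l = 0") (auto simp: mult_le_cancel_right1)
  thus ?thesis using l unfolding u_def by (simp add: tendsto_norm_zero_iff)
qed

text \<open>If the new factor has root \<open>a\<close>, then \<open>Ts - cnj a\<close> maps
  \<open>V (Suc j)\<close> into \<open>V j\<close>.\<close>

lemma V_Ts_pow_tendsto_0: "h \<in> V j \<Longrightarrow> (\<lambda>n. (Ts ^^ n) h) \<longlonglongrightarrow> 0"
proof (induction j arbitrary: h)
  case 0
  hence "Ts h - cnj \<mu> *\<^sub>C h = 0" by (simp add: V_def G_0 adj_Phi_blaschke_eq_0_iff[OF mu])
  moreover have "(Ts ^^ n) 0 = 0" for n by (induction n) (simp_all add: bounded_clinearD[OF bcl_Ts])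
  ultimately show ?case by (subst Ts_pow_tendsto_0_step[OF mu]) simp_all
next
  case (Suc j)
  show ?case
    using beta[of j] unfolding blaschke_or_one_def
  proof (elim disjE exE conjE)
    assume "\<beta> j = (\<lambda>z. 1)"
    thus ?thesis using Suc by (simp add: V_def G_Suc)
  next
    fix a d assume a: "a \<in> disc" and d: "norm d = 1" and j: "\<beta> j = (\<lambda>z. d * blaschke_factor a z)"
    note A = bounded_clinear_adj[OF bcl[OF G_Hinf[of j]]]
    have "adj (\<Phi> (G j)) (Ts h - cnj a *\<^sub>C h) = 0"
      using V_Suc_factor[OF Suc.prems j a d] by (simp add: bounded_clinearD[OF A] adj_T_commute[OF G_Hinf])
    hence "Ts h - cnj a *\<^sub>C h \<in> V j" by (simp add: V_def)
    thus ?thesis by (rule Ts_pow_tendsto_0_step[OF a Suc.IH])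
  qed
qed

lemma Ts_pow_tendsto_0: "(\<lambda>n. (Ts ^^ n) h) \<longlonglongrightarrow> 0"
proof -
  define P where "P = {h. (\<lambda>n. (Ts ^^ n) h) \<longlonglongrightarrow> 0}"
  have "h \<in> P"
  proof (rule V_dense)
    show "complex_vs.subspace P" unfolding complex_vs.subspace_def P_def
    proof (intro conjI ballI allI)
      have "(Ts ^^ n) 0 = 0" for n by (induction n) (simp_all add: bounded_clinearD[OF bcl_Ts])
      thus "0 \<in> {h. (\<lambda>n. (Ts ^^ n) h) \<longlonglongrightarrow> 0}" by simp
      fix u v assume "u \<in> {h. (\<lambda>n. (Ts ^^ n) h) \<longlonglongrightarrow> 0}" "v \<in> {h. (\<lambda>n. (Ts ^^ n) h) \<longlonglongrightarrow> 0}"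
      hence "(\<lambda>n. (Ts ^^ n) u + (Ts ^^ n) v) \<longlonglongrightarrow> 0 + 0" by (intro tendsto_add) auto
      thus "u + v \<in> {h. (\<lambda>n. (Ts ^^ n) h) \<longlonglongrightarrow> 0}" by (simp add: Ts_pow_add)
    next
      fix d :: complex and u assume "u \<in> {h. (\<lambda>n. (Ts ^^ n) h) \<longlonglongrightarrow> 0}"
      hence "(\<lambda>n. norm d * norm ((Ts ^^ n) u)) \<longlonglongrightarrow> norm d * 0"
        by (intro tendsto_mult tendsto_const tendsto_norm_zero) auto
      hence "(\<lambda>n. norm ((Ts ^^ n) (d *\<^sub>C u))) \<longlonglongrightarrow> 0"
        by (simp add: Ts_pow_scale norm_scaleC)
      thus "d *\<^sub>C u \<in> {h. (\<lambda>n. (Ts ^^ n) h) \<longlonglongrightarrow> 0}"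
        by (simp only: tendsto_norm_zero_iff mem_Collect_eq)
    qed
    show "V j \<subseteq> P" for j using V_Ts_pow_tendsto_0 by (auto simp: P_def)
    \<comment> \<open>The powers are uniformly bounded, so their convergence to 0 survives limits of
      vectors.\<close>
    show "closed P"
      unfolding closed_sequential_limits
    proof (intro allI impI, elim conjE)
      fix Y l assume Y: "\<forall>n. Y n \<in> P" and l: "Y \<longlonglongrightarrow> l"
      show "l \<in> P" unfolding P_def
      proof (intro CollectI LIMSEQ_I)
        fix e :: real assume e: "e > 0"
        then obtain m where m: "norm (Y m - l) < e / 2" using l LIMSEQ_D[of Y l "e / 2"] by auto
        have "(\<lambda>n. (Ts ^^ n) (Y m)) \<longlonglongrightarrow> 0" using Y by (simp add: P_def)
        then obtain N where N: "\<And>n. n \<ge> N \<Longrightarrow> norm ((Ts ^^ n) (Y m) - 0) < e / 2"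
          using LIMSEQ_D[of "\<lambda>n. (Ts ^^ n) (Y m)" 0 "e / 2"] e by auto
        show "\<exists>N. \<forall>n\<ge>N. norm ((Ts ^^ n) l - 0) < e"
        proof (intro exI[of _ N] allI impI)
          fix n assume n: "n \<ge> N"
          have "(Ts ^^ n) l = (Ts ^^ n) (Y m) + (Ts ^^ n) (l - Y m)"
            by (simp add: Ts_pow_add[symmetric])
          hence "norm ((Ts ^^ n) l) \<le> norm ((Ts ^^ n) (Y m)) + norm ((Ts ^^ n) (l - Y m))"
            by (simp add: norm_triangle_ineq)
          also have "norm ((Ts ^^ n) (l - Y m)) \<le> norm (Y m - l)"
            using norm_Ts_pow_le[of n "l - Y m"] by (simp add: norm_minus_commute)
          finally show "norm ((Ts ^^ n) l - 0) < e" using m N[OF n] by simp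
        qed
      qed
    qed
  qed
  thus ?thesis by (simp add: P_def)
qed

text \<open>For \<open>h = g - \<mu> *\<^sub>C Ts g\<close> one has
  \<open>cinner h x = cinner g (x - cnj \<mu> *\<^sub>C T x)\<close>; the scalar compensates the
  factor \<open>1 - (norm \<mu>)\<^sup>2\<close> by which the defect of \<open>B\<close> at
  \<open>h\<close> exceeds that of \<open>T\<close> at \<open>g\<close>. In the model this vector
  stands for evaluation at 0: pairing with it gives the constant coefficient of
  \<open>U h\<close>.\<close>

definition \<delta> :: 'a where
  "\<delta> = complex_of_real (1 / sqrt (1 - (norm \<mu>)\<^sup>2)) *\<^sub>C (x - cnj \<mu> *\<^sub>C T x)"

text \<open>The defect identity \<open>1 - b\<^sub>\<mu>(T) b\<^sub>\<mu>(T)\<^sup>* = x \<otimes> x\<close>, evaluated at \<open>(1 - \<mu> T\<^sup>*) g\<close>,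
  becomes \<open>1 - T T\<^sup>* = \<delta> \<otimes> \<delta>\<close>.\<close>

lemma defect_T: "(norm g)\<^sup>2 - (norm (Ts g))\<^sup>2 = (norm (cinner g \<delta>))\<^sup>2"
proof -
  define h where "h = g - \<mu> *\<^sub>C Ts g"
  define m where "m = 1 - (norm \<mu>)\<^sup>2"
  have m: "m > 0" using mu by (simp add: m_def abs_square_less_1)
  define p where "p = Re (cnj \<mu> * cinner g (Ts g))"
  have Bh: "adj B h = Ts g - cnj \<mu> *\<^sub>C g"
    unfolding h_def using adj_Phi_blaschke(2)[OF mu, of g] by simp
  have "complex_of_real ((norm h)\<^sup>2) = cinner h h" by (simp add: cinner_self)
  also have "\<dots> = cinner (B (adj B h) + cinner h x *\<^sub>C x) h" by (simp only: defect_B)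
  also have "\<dots> = cinner (adj B h) (adj B h) + cinner h x * cnj (cinner h x)"
    by (simp add: cinner_add_left cinner_scaleC_left adj_right[OF bcl_B] cinner_commute[of x h])
  also have "\<dots> = complex_of_real ((norm (adj B h))\<^sup>2 + (norm (cinner h x))\<^sup>2)"
    by (simp only: cinner_self complex_norm_square of_real_add)
  finally have 1: "(norm h)\<^sup>2 = (norm (adj B h))\<^sup>2 + (norm (cinner h x))\<^sup>2"
    by (simp only: of_real_eq_iff)
  have 2: "(norm h)\<^sup>2 = (norm g)\<^sup>2 + (norm \<mu>)\<^sup>2 * (norm (Ts g))\<^sup>2 - 2 * p"
    using norm_add_square[of g "- (\<mu> *\<^sub>C Ts g)"]
    by (simp add: h_def cinner.minus_right cinner_scaleC_right norm_scaleC power_mult_distrib p_def)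
  have "Re (\<mu> * cinner (Ts g) g) = Re (cnj (cnj \<mu> * cinner g (Ts g)))"
    using cinner_commute[of "Ts g" g] by simp
  hence p': "Re (\<mu> * cinner (Ts g) g) = p" by (simp only: p_def cnj.sel)
  have 3: "(norm (adj B h))\<^sup>2 = (norm (Ts g))\<^sup>2 + (norm \<mu>)\<^sup>2 * (norm g)\<^sup>2 - 2 * p"
    using norm_add_square[of "Ts g" "- (cnj \<mu> *\<^sub>C g)"] unfolding p'[symmetric]
    by (simp add: Bh cinner.minus_right cinner_scaleC_right norm_scaleC power_mult_distrib)
  have "cinner h x = cinner g (x - cnj \<mu> *\<^sub>C T x)"
    by (simp add: h_def cinner.diff_left cinner.diff_right cinner_scaleC_left cinner_scaleC_right adj_left[OF bcl_T])
  hence "norm (cinner g \<delta>) = norm (cinner h x) / sqrt m"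
    using m by (simp add: \<delta>_def cinner_scaleC_right norm_mult norm_divide m_def[symmetric])
  hence "(norm (cinner g \<delta>))\<^sup>2 = (norm (cinner h x))\<^sup>2 / m"
    using m by (simp add: power_divide)
  \<comment> \<open>The cross terms \<open>p\<close> of the two expansions cancel.\<close>
  moreover have "(norm (cinner h x))\<^sup>2 = m * ((norm g)\<^sup>2 - (norm (Ts g))\<^sup>2)"
    using 1 2 3 by (simp add: m_def algebra_simps)
  ultimately show ?thesis using m by simp
qed

section \<open>The isometry into the Hardy space\<close>

definition U :: "'a \<Rightarrow> complex \<Rightarrow> complex" where
  "U h = H2_of_seq (\<lambda>n. cinner ((Ts ^^ n) h) \<delta>)"

text \<open>By \<open>defect_T\<close> the terms are differences of consecutive values of
  \<open>(norm ((Ts ^^ n) h))\<^sup>2\<close>, so the series telescopes. That these values tend to 0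
  makes \<open>U\<close> isometric and not merely contractive.\<close>

lemma U_sums: "(\<lambda>n. (norm (cinner ((Ts ^^ n) h) \<delta>))\<^sup>2) sums (norm h)\<^sup>2"
proof -
  have "(\<lambda>n. (norm ((Ts ^^ n) h))\<^sup>2) \<longlonglongrightarrow> 0\<^sup>2"
    by (intro tendsto_power tendsto_norm_zero Ts_pow_tendsto_0)
  hence "(\<lambda>n. (norm ((Ts ^^ n) h))\<^sup>2) \<longlonglongrightarrow> 0" by simp
  from telescope_sums'[OF this] show ?thesis by (simp add: defect_T[symmetric])
qed

lemma U_H2: "U h \<in> H2" and taylor_coeff_U: "taylor_coeff (U h) n = cinner ((Ts ^^ n) h) \<delta>"
  unfolding U_def by (rule H2_of_seq_in_H2 taylor_coeff_H2_of_seq, rule sums_summable[OF U_sums])+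

lemma H2_sqnorm_U: "H2_sqnorm (U h) = (norm h)\<^sup>2"
  using U_sums[of h] by (simp add: H2_sqnorm_def taylor_coeff_U sums_iff)

lemma U_lin: "U (g + d *\<^sub>C h) = (\<lambda>z. U g z + d * U h z)"
  by (rule H2_eqI[OF U_H2 H2_lin[OF U_H2 U_H2]])
     (simp add: taylor_coeff_lin H2D(1)[OF U_H2] taylor_coeff_U Ts_pow_add Ts_pow_scale cinner_add_left cinner_scaleC_left)

lemma U_add: "U (g + h) = (\<lambda>z. U g z + U h z)"
  using U_lin[of g 1 h] by simp

lemma U_zero: "U 0 = (\<lambda>z. 0)"
  using H2_sqnorm_U[of 0] by (intro H2_sqnorm_eq_0 U_H2) simp

lemma U_scale: "U (d *\<^sub>C h) = (\<lambda>z. d * U h z)"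
  using U_lin[of 0 d h] by (simp add: U_zero)

lemma H2_inner_U: "H2_inner (U g) (U h) = cinner g h"
proof (rule complex_eqI_Re_mult_cnj)
  fix d
  have "(norm (g + d *\<^sub>C h))\<^sup>2 = H2_sqnorm (\<lambda>z. U g z + d * U h z)"
    by (simp only: U_lin[symmetric] H2_sqnorm_U)
  thus "Re (cnj d * H2_inner (U g) (U h)) = Re (cnj d * cinner g h)"
    by (simp add: norm_add_square H2_sqnorm_lin[OF U_H2 U_H2] H2_sqnorm_U norm_scaleC cinner_scaleC_right power_mult_distrib)
qed

lemma taylor_coeff_U_Ts: "taylor_coeff (U (Ts h)) n = taylor_coeff (U h) (Suc n)"
  by (simp add: taylor_coeff_U funpow_swap1)

lemma H2_inner_shift_U: "k \<in> H2 \<Longrightarrow> H2_inner (\<lambda>z. z * k z) (U h) = H2_inner k (U (Ts h))"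
  by (rule H2_inner_shift[OF _ U_H2 U_H2 taylor_coeff_U_Ts])

text \<open>Writing \<open>g\<close> as \<open>k - cnj a * (z * k)\<close> leaves only
  \<open>k\<close> and \<open>z * k\<close> on the left, and
  \<open>Ts h - cnj a *\<^sub>C h = y - a *\<^sub>C Ts y\<close> is the same relation for operators.
  So the intertwining of \<open>Ts\<close> with the backward shift is enough.\<close>

lemma U_blaschke_intertwine:
  assumes a: "a \<in> disc" and g: "g \<in> H2"
  shows "H2_inner (\<lambda>z. blaschke_factor a z * g z) (U h) = H2_inner g (U (adj (\<Phi> (blaschke_factor a)) h))"
proof -
  define k where "k = (\<lambda>z. g z / (1 - cnj a * z))"
  have k: "k \<in> H2" unfolding k_def by (rule H2_div_Szego[OF g a])
  note zk = H2_shift(1)[OF k]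
  define y where "y = adj (\<Phi> (blaschke_factor a)) h"
  have 1: "(\<lambda>z. blaschke_factor a z * g z) = (\<lambda>z. z * k z + (- a) * k z)"
    by (auto simp: blaschke_factor_def k_def fun_eq_iff algebra_simps add_divide_distrib diff_divide_distrib)
  have 2: "g = (\<lambda>z. k z + (- cnj a) * (z * k z))"
  proof
    fix z
    show "g z = k z + (- cnj a) * (z * k z)"
    proof (cases "z \<in> disc")
      case True
      hence "g z = (1 - cnj a * z) * k z"
        using one_minus_cnj_mult_nonzero[OF a, of z] by (simp add: k_def)
      thus ?thesis by (simp add: algebra_simps)
    qed (simp add: H2D(2)[OF k] H2D(2)[OF g])
  qed
  have inner_lin: "H2_inner k (U (u + d *\<^sub>C v)) = H2_inner k (U u) + cnj d * H2_inner k (U v)" for u d v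
    by (simp only: U_lin H2_inner_commute[OF H2_lin[OF U_H2 U_H2] k] H2_inner_lin[OF U_H2 U_H2 k]
        H2_inner_commute[OF U_H2 k] complex_cnj_add complex_cnj_mult)
  have "H2_inner (\<lambda>z. blaschke_factor a z * g z) (U h) = H2_inner k (U (Ts h)) + (- a) * H2_inner k (U h)"
    unfolding 1 H2_inner_lin[OF zk k U_H2] H2_inner_shift_U[OF k] ..
  also have "\<dots> = H2_inner k (U (Ts h + (- cnj a) *\<^sub>C h))" by (simp only: inner_lin) simp
  also have "Ts h + (- cnj a) *\<^sub>C h = y + (- a) *\<^sub>C Ts y"
    using adj_Phi_blaschke(1)[OF a, of h] by (simp add: y_def)
  also have "H2_inner k (U (y + (- a) *\<^sub>C Ts y)) = H2_inner k (U y) + (- cnj a) * H2_inner (\<lambda>z. z * k z) (U y)"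
    by (simp only: inner_lin H2_inner_shift_U[OF k]) simp
  also have "\<dots> = H2_inner (\<lambda>z. k z + (- cnj a) * (z * k z)) (U y)"
    by (rule H2_inner_lin[OF k zk U_H2, symmetric])
  also have "\<dots> = H2_inner g (U y)" by (simp only: 2[symmetric])
  finally show ?thesis by (simp only: y_def)
qed

lemma U_beta_intertwine:
  assumes g: "g \<in> H2"
  shows "H2_inner (\<lambda>z. \<beta> n z * g z) (U h) = H2_inner g (U (adj (\<Phi> (\<beta> n)) h))"
  using beta[of n] unfolding blaschke_or_one_def
proof (elim disjE exE conjE)
  fix a d assume a: "a \<in> disc" and b: "\<beta> n = (\<lambda>z. d * blaschke_factor a z)"
  have eq: "(\<lambda>z. \<beta> n z * g z) = (\<lambda>z. d * (blaschke_factor a z * g z))" by (simp add: b mult.assoc)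
  have "H2_inner (\<lambda>z. \<beta> n z * g z) (U h) = d * H2_inner g (U (adj (\<Phi> (blaschke_factor a)) h))"
    unfolding eq H2_inner_scale_left[OF H2_blaschke_mult(1)[OF g a] U_H2] U_blaschke_intertwine[OF a g] ..
  thus ?thesis
    unfolding b adj_Phi_scale[OF Hinf_blaschke[OF a]] U_scale
    by (simp add: H2_inner_scale_right[OF U_H2 g])
qed (simp add: adj_Phi_one)

lemma F_mult_H2: "g \<in> H2 \<Longrightarrow> (\<lambda>z. F j z * g z) \<in> H2"
  unfolding F_def by (rule conjunct1[OF H2_prod_mult[OF beta]])

lemma G_mult_H2: "g \<in> H2 \<Longrightarrow> (\<lambda>z. G j z * g z) \<in> H2"
  using H2_blaschke_mult(1)[OF F_mult_H2 mu] by (simp add: G_def mult.assoc)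

lemma U_G_intertwine:
  assumes g: "g \<in> H2"
  shows "H2_inner (\<lambda>z. G j z * g z) (U h) = H2_inner g (U (adj (\<Phi> (G j)) h))"
  using g
proof (induction j arbitrary: g)
  case 0
  thus ?case by (simp add: G_0 U_blaschke_intertwine[OF mu])
next
  case (Suc j)
  have bg: "(\<lambda>z. \<beta> j z * g z) \<in> H2" by (rule H2_blaschke_or_one_mult(1)[OF beta Suc.prems])
  have "H2_inner (\<lambda>z. G (Suc j) z * g z) (U h) = H2_inner (\<lambda>z. G j z * (\<beta> j z * g z)) (U h)"
    by (simp add: G_Suc mult.assoc)
  also have "\<dots> = H2_inner g (U (adj (\<Phi> (G (Suc j))) h))"
    by (simp add: Suc.IH[OF bg] U_beta_intertwine[OF Suc.prems] G_Suc adj_Phi_mult(1)[OF G_Hinf beta_Hinf])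
  finally show ?case .
qed

lemma tau_mult_H2:
  assumes g: "g \<in> H2"
  shows "(\<lambda>z. \<tau> j z * g z) \<in> H2" "H2_sqnorm (\<lambda>z. \<tau> j z * g z) \<le> H2_sqnorm g"
proof -
  have h: "(\<lambda>z. \<Prod>n<N. \<beta> (n + j) z) holomorphic_on disc" for N
    by (intro holomorphic_on_prod HinfD(1) beta_Hinf)
  have p: "(\<lambda>z. (\<Prod>n<N. \<beta> (n + j) z) * g z) \<in> H2 \<and>
      H2_sqnorm (\<lambda>z. (\<Prod>n<N. \<beta> (n + j) z) * g z) = H2_sqnorm g" for N
    by (rule H2_prod_mult[where \<beta> = "\<lambda>n. \<beta> (n + j)", OF beta g])
  show "(\<lambda>z. \<tau> j z * g z) \<in> H2" "H2_sqnorm (\<lambda>z. \<tau> j z * g z) \<le> H2_sqnorm g"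
    using H2_mult_limit[OF tau_lim h tau_holo g] p by (auto simp: order_eq_refl)
qed

text \<open>The factorisation of \<open>\<theta>\<close> is known on the disc; off it both sides
  vanish together with \<open>g\<close>.\<close>

lemma theta_mult:
  assumes g: "g \<in> H2"
  shows "(\<lambda>z. \<theta> z * g z) = (\<lambda>z. G j z * (c * (\<tau> j z * g z)))"
proof
  fix z show "\<theta> z * g z = G j z * (c * (\<tau> j z * g z))"
    using theta[of z j] H2D(2)[OF g, of z] by (cases "z \<in> disc") (auto simp: G_def F_def)
qed

lemma theta_mult_H2: "g \<in> H2 \<Longrightarrow> (\<lambda>z. \<theta> z * g z) \<in> H2"
  unfolding theta_mult[of g 0] by (intro G_mult_H2 H2_scale tau_mult_H2(1))

section \<open>The range of the isometry\<close>

lemma bounded_linear_H2_inner_U: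
  assumes k: "k \<in> H2"
  shows "bounded_linear (\<lambda>h. H2_inner (U h) k)"
proof (rule bounded_linear_intro[where K = "sqrt (H2_sqnorm k)"])
  show "H2_inner (U (g + h)) k = H2_inner (U g) k + H2_inner (U h) k" for g h
    using H2_inner_lin[OF U_H2[of g] U_H2[of h] k, of 1] by (simp add: U_add)
  show "H2_inner (U (r *\<^sub>R h)) k = r *\<^sub>R H2_inner (U h) k" for r h
    unfolding scaleC_of_real[symmetric] U_scale
    by (simp add: H2_inner_scale_left[OF U_H2 k] scaleR_conv_of_real)
  show "norm (H2_inner (U h) k) \<le> norm h * sqrt (H2_sqnorm k)" for h
    using norm_H2_inner_le[OF U_H2[of h] k] by (simp add: H2_sqnorm_U)
qed

text \<open>For \<open>h\<close> in \<open>V j\<close> the factor \<open>G j\<close> of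
  \<open>\<theta>\<close> can be moved onto \<open>h\<close> as an adjoint, where it gives 0. The
  kernels are dense and the condition is closed.\<close>

lemma U_in_model_space: "U h \<in> model_space \<theta>"
  unfolding model_space_def
proof (intro CollectI conjI ballI U_H2)
  fix g assume g: "g \<in> H2"
  note tg = theta_mult_H2[OF g]
  note bl = bounded_linear_H2_inner_U[OF tg]
  define P where "P = {h. H2_inner (U h) (\<lambda>z. \<theta> z * g z) = 0}"
  have "h \<in> P"
  proof (rule V_dense)
    show "closed P" unfolding P_def
      by (intro closed_Collect_eq linear_continuous_on bl continuous_on_const)
    show "complex_vs.subspace P"
      unfolding complex_vs.subspace_def P_def
      by (auto simp: U_zero U_scale H2_inner_scale_left[OF U_H2 tg] linear_simps[OF bl])
    show "V j \<subseteq> P" for j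
    proof
      fix h assume h: "h \<in> V j"
      have k: "(\<lambda>z. c * (\<tau> j z * g z)) \<in> H2" by (intro H2_scale tau_mult_H2(1) g)
      have "H2_inner (\<lambda>z. \<theta> z * g z) (U h) = H2_inner (\<lambda>z. c * (\<tau> j z * g z)) (U 0)"
        unfolding theta_mult[OF g, of j] U_G_intertwine[OF k] using h by (simp add: V_def)
      hence "H2_inner (\<lambda>z. \<theta> z * g z) (U h) = 0"
        using H2_inner_commute[OF U_H2 k, of 0] by (simp add: U_zero)
      thus "h \<in> P" unfolding P_def using H2_inner_commute[OF tg U_H2, of h] by simp
    qed
  qed
  thus "H2_inner (U h) (\<lambda>z. \<theta> z * g z) = 0" by (simp add: P_def)
qed

text \<open>The coefficients of \<open>U g\<close> are \<open>cnj a ^ n * cinner g \<delta>\<close>,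
  so \<open>U g\<close> is a multiple of the Szego kernel at \<open>a\<close>, and not the zero
  multiple because \<open>U\<close> is isometric. Pairing with it evaluates \<open>k\<close> at
  \<open>a\<close>.\<close>

lemma orthogonal_eigenvector_root:
  assumes a: "a \<in> disc" and g: "Ts g = cnj a *\<^sub>C g" "g \<noteq> 0" and k: "k \<in> H2" and orth: "H2_inner k (U g) = 0"
  shows "k a = 0"
proof -
  have pw: "(Ts ^^ n) g = cnj a ^ n *\<^sub>C g" for n
    by (induction n) (simp_all add: bounded_clinearD[OF bcl_Ts] g(1) scaleC_scaleC mult.commute)
  have "(\<lambda>n. cnj (cinner g \<delta>) * (taylor_coeff k n * a ^ n)) sums (cnj (cinner g \<delta>) * k a)"
    by (intro sums_mult taylor_coeff_sums H2D(1) k a)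
  moreover have "cnj (cinner g \<delta>) * (taylor_coeff k n * a ^ n) = taylor_coeff k n * cnj (taylor_coeff (U g) n)" for n
    by (simp add: taylor_coeff_U pw cinner_scaleC_left)
  ultimately have "cnj (cinner g \<delta>) * k a = 0"
    using orth by (simp add: H2_inner_def sums_iff)
  moreover have "cinner g \<delta> \<noteq> 0"
  proof
    assume "cinner g \<delta> = 0"
    hence "H2_sqnorm (U g) = 0" by (simp add: H2_sqnorm_def taylor_coeff_U pw cinner_scaleC_left)
    thus False using g(2) by (simp add: H2_sqnorm_U)
  qed
  ultimately show ?thesis by simp
qed

text \<open>Once \<open>f = G j * k\<close>, moving \<open>G j\<close> to the other side shows
  \<open>k\<close> orthogonal to the image of the next eigenvector from
  \<open>blaschke_step\<close>, so \<open>k\<close> vanishes at the next root. Dividing one root at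
  a time takes care of multiplicities.\<close>

lemma orthogonal_range_divisible:
  assumes f: "f \<in> H2" and orth: "\<And>h. H2_inner f (U h) = 0"
  shows "\<exists>k\<in>H2. \<forall>z. f z = G j z * k z"
proof (induction j)
  case 0
  have "f \<mu> = 0" by (rule orthogonal_eigenvector_root[OF mu x_eig x_nonzero f orth])
  thus ?case unfolding G_0 by (rule H2_divide_blaschke[OF f mu])
next
  case (Suc j)
  then obtain k where k: "k \<in> H2" "\<And>z. f z = G j z * k z" by blast
  show ?case
    using beta[of j] unfolding blaschke_or_one_def
  proof (elim disjE exE conjE)
    assume "\<beta> j = (\<lambda>z. 1)"
    thus ?thesis using k by (auto simp: G_Suc)
  next
    fix a d assume a: "a \<in> disc" and d: "norm d = 1" and b: "\<beta> j = (\<lambda>z. d * blaschke_factor a z)"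
    note step = blaschke_step[OF b a d]
    have "f = (\<lambda>z. G j z * k z)" using k(2) by auto
    hence "H2_inner k (U (adj (\<Phi> (G j)) (\<Phi> (F (Suc j)) x))) = 0"
      using orth U_G_intertwine[OF k(1), of j] by metis
    hence "k a = 0" by (rule orthogonal_eigenvector_root[OF a step(2,1) k(1)])
    then obtain q where q: "q \<in> H2" "\<And>z. k z = blaschke_factor a z * q z"
      using H2_divide_blaschke[OF k(1) a] by blast
    have "d \<noteq> 0" using d by auto
    hence "f z = G (Suc j) z * (inverse d * q z)" for z
      by (simp add: k(2) q(2) G_Suc b)
    thus ?thesis
      by (intro bexI[of _ "\<lambda>z. inverse d * q z"] allI H2_scale q(1))
  qed
qed

lemma model_space_lin:
  assumes f: "f \<in> model_space \<theta>" and g: "g \<in> model_space \<theta>"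
  shows "(\<lambda>z. f z - g z) \<in> model_space \<theta>"
  using assms by (auto simp: model_space_def H2_diff H2_inner_diff_left theta_mult_H2)

text \<open>With \<open>f = G j * k\<close>, orthogonality to \<open>\<theta> * k\<close> says that
  \<open>f\<close> is orthogonal to \<open>\<tau> j * f\<close>. This holds for every
  \<open>j\<close>, and \<open>\<tau> j * f\<close> tends weakly to \<open>f\<close>.\<close>

lemma model_space_orthogonal_range:
  assumes f: "f \<in> model_space \<theta>" and orth: "\<And>h. H2_inner f (U h) = 0"
  shows "f = (\<lambda>z. 0)"
proof -
  have fH: "f \<in> H2" using f by (simp add: model_space_def)
  have "H2_inner f (\<lambda>z. \<tau> j z * f z) = 0" for j
  proof -
    obtain k where k: "k \<in> H2" "\<And>z. f z = G j z * k z"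
      using orthogonal_range_divisible[OF fH orth] by blast
    have "(\<lambda>z. \<theta> z * k z) = (\<lambda>z. c * (\<tau> j z * f z))"
      unfolding theta_mult[OF k(1), of j] by (simp add: k(2) mult_ac)
    moreover have "H2_inner f (\<lambda>z. \<theta> z * k z) = 0" using f k(1) by (simp add: model_space_def)
    ultimately have "cnj c * H2_inner f (\<lambda>z. \<tau> j z * f z) = 0"
      by (simp add: H2_inner_scale_right[OF tau_mult_H2(1)[OF fH] fH])
    thus ?thesis using c by auto
  qed
  with H2_mult_weak_limit[OF tau_one tau_holo fH tau_mult_H2[OF fH]]
  have "H2_inner f f = 0" by (simp add: LIMSEQ_const_iff)
  hence "H2_sqnorm f = 0" by (simp add: H2_inner_self[OF fH])
  thus ?thesis by (rule H2_sqnorm_eq_0[OF fH])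
qed

text \<open>The Riesz vector \<open>v\<close> is the adjoint of \<open>U\<close> applied to
  \<open>f\<close>, so \<open>f - U v\<close> is orthogonal to the range of \<open>U\<close> while
  still in the model space.\<close>

lemma U_surj:
  assumes f: "f \<in> model_space \<theta>"
  shows "\<exists>h. U h = f"
proof -
  have fH: "f \<in> H2" using f by (simp add: model_space_def)
  obtain v where v: "\<And>h. H2_inner (U h) f = cinner h v"
    using riesz_representation[OF bounded_linear_H2_inner_U[OF fH]]
    by (auto simp: U_scale H2_inner_scale_left[OF U_H2 fH])
  have "(\<lambda>z. f z - U v z) = (\<lambda>z. 0)"
  proof (rule model_space_orthogonal_range)
    show "(\<lambda>z. f z - U v z) \<in> model_space \<theta>" by (rule model_space_lin[OF f U_in_model_space])
    show "H2_inner (\<lambda>z. f z - U v z) (U h) = 0" for h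
      unfolding H2_inner_diff_left[OF fH U_H2 U_H2] H2_inner_U H2_inner_commute[OF U_H2 fH] v
      using cinner_commute[of v h] by simp
  qed
  hence "U v = f" by (auto simp: fun_eq_iff)
  thus ?thesis by blast
qed

lemma U_inj: "inj U"
proof (rule injI)
  fix g h assume eq: "U g = U h"
  have "U (g - h) = (\<lambda>z. 0)" using U_lin[of g "-1" h] eq by simp
  hence "(norm (g - h))\<^sup>2 = 0" using H2_sqnorm_U[of "g - h"] by (simp add: H2_sqnorm_def taylor_coeff_zero)
  thus "g = h" by simp
qed

text \<open>Every test function in the model space is some \<open>U w\<close>, where the backward
  shift acts as \<open>U (Ts w)\<close>; the defining property of the Jordan block thus becomes that
  of the adjoint of \<open>T\<close>.\<close>

lemma U_T: "U (T h) = jordan_block \<theta> (U h)"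
  unfolding jordan_block_def
proof (rule the_equality[symmetric])
  have sa: "shift_adjoint (U w) = U (Ts w)" for w
    by (rule shift_adjoint_eq[OF U_H2 U_H2 taylor_coeff_U_Ts])
  have T: "H2_inner (U (T h)) k = H2_inner (U h) (shift_adjoint k)" if k: "k \<in> model_space \<theta>" for k
  proof -
    obtain w where "U w = k" using U_surj[OF k] by blast
    thus ?thesis using sa[of w] by (auto simp: H2_inner_U adj_right[OF bcl_T])
  qed
  thus "U (T h) \<in> model_space \<theta> \<and> (\<forall>k\<in>model_space \<theta>. H2_inner (U (T h)) k = H2_inner (U h) (shift_adjoint k))"
    using U_in_model_space by blast
  fix g assume g: "g \<in> model_space \<theta> \<and> (\<forall>k\<in>model_space \<theta>. H2_inner g k = H2_inner (U h) (shift_adjoint k))"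
  then obtain w where w: "U w = g" using U_surj by blast
  have "cinner (w - T h) (w - T h) = 0"
  proof -
    have "cinner w y = cinner (T h) y" for y
    proof -
      have "H2_inner (U w) (U y) = H2_inner (U (T h)) (U y)"
        using g T[OF U_in_model_space[of y]] U_in_model_space[of y] w by simp
      thus ?thesis by (simp add: H2_inner_U)
    qed
    thus ?thesis by (simp add: cinner.diff_left)
  qed
  thus "g = U (T h)" using w by (simp add: cinner_self_eq_0)
qed

lemma unitarily_equivalent: "unitarily_equivalent_jordan_block T \<theta>"
  unfolding unitarily_equivalent_jordan_block_def
proof (intro exI[of _ U] conjI allI)
  show "bij_betw U UNIV (model_space \<theta>)"
    unfolding bij_betw_def using U_inj U_surj U_in_model_space by auto
qed (rule U_add U_scale H2_inner_U U_T)+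

end

text \<open>A finite Blaschke product is continuous on the closed disc and unimodular on the circle,
  so radial limits of \<open>\<psi>\<close> may be divided by it. It can vanish inside the disc, but
  not near the boundary point approached.\<close>

lemma inner_function_quotient:
  fixes j :: nat
  assumes inn: "inner_function \<psi>" and b: "\<And>n. blaschke_or_one (\<beta> n)" and c: "norm c = 1"
    and \<tau>: "\<tau> holomorphic_on disc" "\<And>z. z \<in> disc \<Longrightarrow> norm (\<tau> z) \<le> 1"
    and fac: "\<And>z. z \<in> disc \<Longrightarrow> \<psi> z = c * (\<Prod>n<j. \<beta> n z) * \<tau> z"
  shows "inner_function \<tau>"
proof -
  define q where "q z = c * (\<Prod>n<j. \<beta> n z)" for z
  have facq: "\<psi> z = q z * \<tau> z" if "z \<in> disc" for z
    unfolding q_def by (rule fac[OF that])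
  have b1: "\<beta> n holomorphic_on cball 0 1" and b2: "norm z = 1 \<Longrightarrow> norm (\<beta> n z) = 1" for n z
    using b[of n] norm_blaschke_circle unfolding blaschke_or_one_def
    by (auto intro!: holomorphic_intros blaschke_holomorphic simp: norm_mult)
  have qc: "continuous_on (cball 0 1) q"
    unfolding q_def by (intro holomorphic_on_imp_continuous_on holomorphic_on_mult holomorphic_on_const holomorphic_on_prod b1)
  have q1: "norm (q z) = 1" if "norm z = 1" for z
    using that c by (simp add: q_def norm_mult b2 flip: prod_norm)
  have AE: "AE t in lborel. t \<in> {0..2 * pi} \<longrightarrow>
        (\<exists>w. ((\<lambda>r. \<psi> (complex_of_real r * cis t)) \<longlongrightarrow> w) (at_left 1) \<and> norm w = 1)"
    using inn by (simp add: inner_function_def)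
  have "AE t in lborel. t \<in> {0..2 * pi} \<longrightarrow>
        (\<exists>w. ((\<lambda>r. \<tau> (complex_of_real r * cis t)) \<longlongrightarrow> w) (at_left 1) \<and> norm w = 1)"
    using AE
  proof eventually_elim
    case (elim t)
    show ?case
    proof
      assume "t \<in> {0..2 * pi}"
      then obtain w where w: "((\<lambda>r. \<psi> (complex_of_real r * cis t)) \<longlongrightarrow> w) (at_left 1)" "norm w = 1"
        using elim by blast
      have ev: "eventually (\<lambda>r::real. r \<in> {0<..<1}) (at_left 1)"
        by (rule eventually_at_leftI[of 0]) auto
      have "((\<lambda>r. complex_of_real r * cis t) \<longlongrightarrow> complex_of_real 1 * cis t) (at_left 1)"
        by (intro tendsto_intros)
      moreover have "eventually (\<lambda>r. complex_of_real r * cis t \<in> cball 0 1) (at_left 1)"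
        using ev by eventually_elim (simp add: norm_mult)
      ultimately have ql: "((\<lambda>r. q (complex_of_real r * cis t)) \<longlongrightarrow> q (cis t)) (at_left 1)"
        using continuous_on_tendsto_compose[OF qc, of "\<lambda>r. complex_of_real r * cis t" "cis t" "at_left 1"] by simp
      have q0: "q (cis t) \<noteq> 0" using q1[of "cis t"] by auto
      have "((\<lambda>r. \<psi> (complex_of_real r * cis t) / q (complex_of_real r * cis t)) \<longlongrightarrow> w / q (cis t)) (at_left 1)"
        by (intro tendsto_divide w ql q0)
      moreover have "eventually (\<lambda>r. q (complex_of_real r * cis t) \<noteq> 0) (at_left 1)"
        using ql q0 by (rule tendsto_imp_eventually_ne)
      hence "eventually (\<lambda>r. \<psi> (complex_of_real r * cis t) / q (complex_of_real r * cis t) = \<tau> (complex_of_real r * cis t)) (at_left 1)"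
        using ev by eventually_elim (simp add: facq norm_mult)
      ultimately have "((\<lambda>r. \<tau> (complex_of_real r * cis t)) \<longlongrightarrow> w / q (cis t)) (at_left 1)"
        by (rule Lim_transform_eventually)
      moreover have "norm (w / q (cis t)) = 1" using w q1[of "cis t"] by (simp add: norm_divide)
      ultimately show "\<exists>w. ((\<lambda>r. \<tau> (complex_of_real r * cis t)) \<longlongrightarrow> w) (at_left 1) \<and> norm w = 1" by blast
    qed
  qed
  thus ?thesis using HinfI[OF \<tau>] by (simp add: inner_function_def)
qed

text \<open>\<open>\<psi>(T)\<^sup>*\<close> maps into the one-dimensional eigenspace of \<open>T\<^sup>*\<close>, so \<open>\<psi>(T)\<close> has rank one and attains its norm.\<close>

lemma (in functional_calculus) norm_attained:
  assumes cyclic: "multiplicity_free T" and \<mu>: "\<mu> \<in> disc" and \<psi>: "\<psi> \<in> Hinf"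
    and zero: "\<And>h. \<Phi> (blaschke_factor \<mu>) (\<Phi> \<psi> h) = 0" and nrm: "onorm (\<Phi> \<psi>) = 1"
  shows "\<exists>x. norm x = 1 \<and> adj T x = cnj \<mu> *\<^sub>C x \<and> norm (\<Phi> \<psi> x) = 1"
proof -
  note P = bcl[OF \<psi>] and b = Hinf_blaschke[OF \<mu>]
  have eig: "adj T (adj (\<Phi> \<psi>) h) = cnj \<mu> *\<^sub>C adj (\<Phi> \<psi>) h" for h
  proof -
    have "adj (\<Phi> (\<lambda>z. blaschke_factor \<mu> z * \<psi> z)) h = 0"
      by (rule adj_eqI[OF bcl[OF Hinf_mult[OF b \<psi>]]]) (simp add: Phi_mult[OF b \<psi>] zero)
    hence "adj (\<Phi> (blaschke_factor \<mu>)) (adj (\<Phi> \<psi>) h) = 0" by (simp add: adj_Phi_mult(2)[OF b \<psi>])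
    thus ?thesis by (simp add: adj_Phi_blaschke_eq_0_iff[OF \<mu>])
  qed
  have "\<Phi> \<psi> \<noteq> (\<lambda>h. 0)"
  proof
    assume "\<Phi> \<psi> = (\<lambda>h. 0)"
    hence "onorm (\<Phi> \<psi>) = 0" using onorm_eq_0[OF bounded_clinearD(1)[OF P]] by simp
    thus False using nrm by simp
  qed
  then obtain u where u: "\<Phi> \<psi> u \<noteq> 0" by auto
  \<comment> \<open>A nonzero vector in the range of \<open>adj (\<Phi> \<psi>)\<close>, hence an
    eigenvector; normalised, it will attain the norm.\<close>
  define y where "y = adj (\<Phi> \<psi>) (\<Phi> \<psi> u)"
  have y0: "y \<noteq> 0"
  proof
    assume "y = 0"
    hence "cinner (\<Phi> \<psi> u) (\<Phi> \<psi> u) = 0" by (simp add: adj_right[OF P] y_def)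
    thus False using u by (simp add: cinner_self_eq_0)
  qed
  define x where "x = complex_of_real (1 / norm y) *\<^sub>C y"
  have nx: "norm x = 1" using y0 by (simp add: x_def norm_scaleC norm_divide)
  have "adj T y = cnj \<mu> *\<^sub>C y" unfolding y_def by (rule eig)
  hence ex: "adj T x = cnj \<mu> *\<^sub>C x"
    by (simp add: x_def bounded_clinearD[OF bounded_clinear_adj[OF bcl_T]] scaleC_scaleC mult.commute)
  have x0: "x \<noteq> 0" using nx by auto
  have le: "norm (\<Phi> \<psi> x) \<le> 1"
    using onorm[OF bounded_clinearD(1)[OF P], of x] nrm nx by simp
  \<comment> \<open>No vector is stretched more than \<open>x\<close>: the adjoint takes
    \<open>\<Phi> \<psi> h\<close> to a multiple \<open>e\<close> of \<open>x\<close>, and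
    \<open>e\<close> is read off by pairing with \<open>x\<close>.\<close>
  have "norm (\<Phi> \<psi> h) \<le> norm (\<Phi> \<psi> x) * norm h" for h
  proof (cases "\<Phi> \<psi> h = 0")
    case False
    obtain e where e: "adj (\<Phi> \<psi>) (\<Phi> \<psi> h) = e *\<^sub>C x"
      using cyclic_adj_eigenvector[OF cyclic bcl_T eig ex x0] by blast
    have "e = cinner (e *\<^sub>C x) x" by (simp add: cinner_scaleC_left cinner_self nx)
    also have "\<dots> = cinner (\<Phi> \<psi> h) (\<Phi> \<psi> x)" by (simp only: e[symmetric] adj_left[OF P])
    finally have "norm e \<le> norm (\<Phi> \<psi> h) * norm (\<Phi> \<psi> x)" by (metis norm_cinner_le)
    hence 1: "norm e * norm h \<le> norm (\<Phi> \<psi> h) * norm (\<Phi> \<psi> x) * norm h" by (rule mult_right_mono) simp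
    have "(norm (\<Phi> \<psi> h))\<^sup>2 = norm (cinner (\<Phi> \<psi> h) (\<Phi> \<psi> h))" by (simp add: cinner_self norm_power)
    also have "\<dots> = norm (cinner h (e *\<^sub>C x))" by (simp only: adj_right[OF P] e)
    also have "\<dots> \<le> norm h * norm e" using norm_cinner_le[of h "e *\<^sub>C x"] by (simp add: norm_scaleC nx)
    also have "\<dots> \<le> norm (\<Phi> \<psi> h) * (norm (\<Phi> \<psi> x) * norm h)" using 1 by (simp add: mult_ac)
    finally show ?thesis using False by (simp add: power2_eq_square)
  qed simp
  hence "onorm (\<Phi> \<psi>) \<le> norm (\<Phi> \<psi> x)" by (rule onorm_bound[rotated]) simp
  with nrm le nx ex show ?thesis by (intro exI[of _ x]) auto
qed

theorem theorem1p5: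
  fixes T :: "'a::complex_hilbert \<Rightarrow> 'a"
    and \<theta> \<psi> :: "complex \<Rightarrow> complex"
  assumes "class_C0 T"
    and "multiplicity_free T"
    and "minimal_function T \<theta>"
    and "blaschke_product \<theta>"
    and "big_inner_divisor \<psi> \<theta>"
    and "onorm (Hinf_calculus T \<psi>) = 1"
  shows "unitarily_equivalent_jordan_block T \<theta>"
proof -
  define \<Phi> where "\<Phi> = Hinf_calculus T"
  have "\<exists>\<Phi>. is_functional_calculus T \<Phi>" using assms(1) by (auto simp: class_C0_def)
  hence fc: "is_functional_calculus T \<Phi>" unfolding \<Phi>_def Hinf_calculus_def by (rule someI_ex)
  interpret functional_calculus T \<Phi> by unfold_locales (rule fc)
  have th: "\<theta> \<in> Hinf" using assms(3) by (simp add: minimal_function_def inner_function_def)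
  \<comment> \<open>Dividing itself, \<open>\<theta>\<close> lies in the kernel of the
    calculus.\<close>
  have "Hinf_divides \<theta> \<theta>" unfolding Hinf_divides_def by (rule bexI[OF _ Hinf_const[of 1]]) simp
  hence th0: "\<Phi> \<theta> = (\<lambda>h. 0)" using assms(3) th unfolding minimal_function_def \<Phi>_def by blast
  obtain \<mu> c1 where \<mu>: "\<mu> \<in> disc" and c1: "norm c1 = 1"
    and fac: "\<And>z. z \<in> disc \<Longrightarrow> \<theta> z = \<psi> z * (c1 * blaschke_factor \<mu> z)" and inn: "inner_function \<psi>"
    using assms(5) unfolding big_inner_divisor_def by blast
  have \<psi>: "\<psi> \<in> Hinf" using inn by (simp add: inner_function_def)
  have c10: "c1 \<noteq> 0" using c1 by auto
  have "\<theta> \<mu> = 0" using fac[OF \<mu>] by (simp add: blaschke_factor_def)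
  from blaschke_product_structure[OF assms(4) \<mu> this] obtain \<beta> \<tau> c where
    c: "norm c = 1" and \<beta>: "\<And>n. blaschke_or_one (\<beta> n)"
    and \<tau>: "\<And>j. \<tau> j holomorphic_on disc" "\<And>j z. z \<in> disc \<Longrightarrow> norm (\<tau> j z) \<le> 1"
    and lim: "\<And>j r. r < 1 \<Longrightarrow> uniform_limit (cball 0 r) (\<lambda>N z. \<Prod>n<N. \<beta> (n + j) z) (\<tau> j) sequentially"
    and prod: "\<And>j z. z \<in> disc \<Longrightarrow> \<theta> z = c * blaschke_factor \<mu> z * (\<Prod>n<j. \<beta> n z) * \<tau> j z"
    and one: "\<And>r. r < 1 \<Longrightarrow> uniform_limit (cball 0 r) \<tau> (\<lambda>_. 1) sequentially"
    by blast
  \<comment> \<open>The factor at \<open>\<mu>\<close> comes with the constant \<open>c1\<close> in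
    the divisor and with \<open>c\<close> in the product, so \<open>\<psi>\<close> carries their
    quotient.\<close>
  define c' where "c' = c / c1"
  have c': "norm c' = 1" using c c1 by (simp add: c'_def norm_divide)
  have psi_prod: "\<psi> z = c' * (\<Prod>n<j. \<beta> n z) * \<tau> j z" if z: "z \<in> disc" for z j
  proof -
    \<comment> \<open>The factor at \<open>\<mu>\<close> can be cancelled away from
      \<open>\<mu>\<close> only; the difference \<open>d\<close> is continuous and so vanishes at
      \<open>\<mu>\<close> too.\<close>
    define d where "d z = \<psi> z - c' * (\<Prod>n<j. \<beta> n z) * \<tau> j z" for z
    have dz: "d z = 0" if "z \<in> disc" "z \<noteq> \<mu>" for z
    proof -
      have "blaschke_factor \<mu> z \<noteq> 0" using blaschke_eq_0_iff[OF \<mu> that(1)] that(2) by simp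
      moreover have "\<theta> z = blaschke_factor \<mu> z * (c1 * \<psi> z)"
        by (simp add: fac[OF that(1)] mult_ac)
      moreover have "\<theta> z = blaschke_factor \<mu> z * (c * (\<Prod>n<j. \<beta> n z) * \<tau> j z)"
        by (simp add: prod[OF that(1), of j] mult_ac)
      ultimately have "c1 * \<psi> z = c * (\<Prod>n<j. \<beta> n z) * \<tau> j z" by simp
      thus ?thesis using c10 by (simp add: d_def c'_def field_simps)
    qed
    have "d holomorphic_on disc"
      unfolding d_def by (intro holomorphic_on_diff holomorphic_on_mult holomorphic_on_const holomorphic_on_prod
          HinfD(1) \<psi> \<tau> blaschke_or_one_props(1) \<beta>)
    hence "isCont d \<mu>"
      using \<mu> by (meson continuous_on_eq_continuous_at holomorphic_on_imp_continuous_on open_ball)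
    hence "(d \<longlongrightarrow> d \<mu>) (at \<mu>)" by (simp add: isCont_def)
    moreover have "(d \<longlongrightarrow> 0) (at \<mu>)"
      by (rule tendsto_eventually) (use eventually_at_in_open[of disc \<mu>] \<mu> dz in \<open>auto elim!: eventually_mono\<close>)
    ultimately have "d \<mu> = 0" using tendsto_unique[OF at_neq_bot] by blast
    thus ?thesis using dz[OF z] by (cases "z = \<mu>") (auto simp: d_def)
  qed
  have "(\<lambda>j. \<tau> j 0) \<longlonglongrightarrow> 1"
    using tendsto_uniform_limitI[OF one[of "1/2"], where x = 0] by simp
  moreover have "inner_function (\<tau> j)" for j
    by (rule inner_function_quotient[OF inn \<beta> c' \<tau> psi_prod])
  ultimately obtain s where s: "limitin weak_star_Hinf (\<lambda>k. \<tau> (s k)) (\<lambda>z. 1) sequentially"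
    using inner_functions_weak_star_limit[of \<tau>] by blast
  have "continuous_map weak_star_Hinf weak_star_operators \<Phi>"
    using fc unfolding is_functional_calculus_def by blast
  from continuous_map_limit[OF this s]
  have lw: "limitin weak_star_operators (\<lambda>k. \<Phi> (\<tau> (s k))) (\<Phi> (\<lambda>z. 1)) sequentially" by (simp add: o_def)
  have weak: "(\<lambda>k. cinner (\<Phi> (\<tau> (s k)) h) g) \<longlonglongrightarrow> cinner h g" for h g
    using weak_star_operators_limitD[OF lw bcl[OF Hinf_const], of h g] by (simp add: Phi_one)
  have zero: "\<Phi> (blaschke_factor \<mu>) (\<Phi> \<psi> h) = 0" for h
  proof -
    have "\<Phi> \<theta> = \<Phi> (\<lambda>z. c1 * (blaschke_factor \<mu> z * \<psi> z))"
      by (intro Phi_cong th Hinf_mult Hinf_const Hinf_blaschke \<mu> \<psi>) (simp add: fac)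
    hence "c1 *\<^sub>C \<Phi> (blaschke_factor \<mu>) (\<Phi> \<psi> h) = \<Phi> \<theta> h"
      by (simp add: Phi_scale[OF Hinf_mult[OF Hinf_blaschke[OF \<mu>] \<psi>]] Phi_mult[OF Hinf_blaschke[OF \<mu>] \<psi>])
    thus ?thesis using c10 by (simp add: th0)
  qed
  obtain x where x: "norm x = 1" "adj T x = cnj \<mu> *\<^sub>C x" "norm (\<Phi> \<psi> x) = 1"
    using norm_attained[OF assms(2) \<mu> \<psi> zero] assms(6) unfolding \<Phi>_def by blast
  interpret norm_attaining_model T \<Phi> \<mu> c c' \<beta> \<tau> \<theta> \<psi> x s
    by unfold_locales (use assms(2) \<mu> \<beta> \<tau> lim[of "1/2"] one[of "1/2"] prod psi_prod c c' th0 x weak in \<open>auto simp only: order_refl | simp\<close>)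
  show ?thesis by (rule unitarily_equivalent)
qed

end
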